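(* Let $p,q\in\mathbb{F}[t]$ be monic polynomials of degree $2$ and set $\delta:=\operatorname{tr}p-\operatorname{tr}q$. (a) For every integer $n\ge1$ and every monic irreducible $r\in\mathbb{F}[t]$ such that $r(t^2-\delta t)$ has no root in $\operatorname{Root}(p)-\operatorname{Root}(q)$, if $v$ is an endomorphism represented by the companion matrix $C\bigl(r^n(t^2-\delta t)\bigr)$, then $S(v)$ is an indecomposable symplectic $(p,q)$-difference (and it is $(p,q)$-regular). (b) Every indecomposable symplectic $(p,q)$-difference $(b,u)$ in which $u$ is $(p,q)$-regular is isometric to $S(v)$ for some endomorphism $v$ represented by a matrix $C\bigl(r^n(t^2-\delta t)\bigr)$ with $n$ and $r$ as in (a).
   Context: $\mathbb{F}$ is an arbitrary field (characteristic $2$ allowed), with a fixed algebraic closure $\overline{\mathbb{F}}$; all vector spaces are finite-dimensional over $\mathbb{F}$. For a monic polynomial $r\in\mathbb{F}[t]$ of degree $n>0$, $\operatorname{tr}r$ is the opposite of the coefficient of $r$ on $t^{n-1}$, and $\operatorname{Root}(r)$ is the set of roots of $r$ in $\overline{\mathbb{F}}$; $\operatorname{Root}(p)-\operatorname{Root}(q):=\{x-y : x\in\operatorname{Root}(p),\,y\in\operatorname{Root}(q)\}$. $r^n(t^2-\delta t)$ denotes the polynomial $r^n$ evaluated at $t^2-\delta t$. $C(s)$ denotes the companion matrix of the monic polynomial $s$. An endomorphism is $(p,q)$-regular if none of its eigenvalues in $\overline{\mathbb{F}}$ belongs to $\operatorname{Root}(p)-\operatorname{Root}(q)$. A symplectic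 form is a non-degenerate alternating bilinear form. Given a symplectic form $b$ on $V$, an endomorphism $u$ of $V$ is $b$-alternating if $b(x,u(x))=0$ for all $x\in V$. A symplectic pair $(b,u)$ consists of a symplectic form $b$ on a vector space and a $b$-alternating endomorphism $u$ of it; it is trivial if the space is $\{0\}$, and it is called $(p,q)$-regular if $u$ is. It is a symplectic $(p,q)$-difference if there are $b$-alternating endomorphisms $u_1,u_2$ with $u=u_1-u_2$, $p(u_1)=0$ and $q(u_2)=0$. Two symplectic pairs $(b,u)$ on $V$ and $(b',u')$ on $V'$ are isometric if there is a linear isomorphism $\varphi:V\to V'$ with $b'(\varphi(x),\varphi(y))=b(x,y)$ and $u'\circ\varphi=\varphi\circ u$. Their orthogonal direct sum is $(b\bot b',u\oplus u')$ on $V\times V'$. A symplectic $(p,q)$-difference is indecomposable if it is non-trivial and not isometric to the orthogonal direct sum of two non-trivial symplectic $(p,q)$-differences. For an endomorphism $v$ of $V$ with transpose $v^t:\varphi\mapsto\varphi\circ v$ on the dual space $V^\star$, put $h(v):=v\oplus v^t$ on $V\times V^\star$ and $S_V((x,\varphi),(y,\psi)):=\varphi(y)-\psi(x)$. The symplectic extension of $v$ is the symplectic pair $S(v):=(S_V,h(v))$. *)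

theory Defs
  imports
    "Jordan_Normal_Form.Char_Poly"
    "HOL-Algebra.Algebraic_Closure_Type"
    "HOL-Analysis.Product_Vector"
    "HOL-Library.Function_Algebras"
begin

section \<open>Polynomials and matrices\<close>

definition poly_trace :: "'a::field poly \<Rightarrow> 'a" where
  "poly_trace r = - poly.coeff r (Polynomial.degree r - 1)"

definition root_set :: "'a::field poly \<Rightarrow> 'a alg_closure set" where
  "root_set r = {x. poly (map_poly to_ac r) x = 0}"

definition root_diffs :: "'a::field poly \<Rightarrow> 'a poly \<Rightarrow> 'a alg_closure set" where
  "root_diffs p q = {x - y | x y. x \<in> root_set p \<and> y \<in> root_set q}"

text \<open>Ones on the subdiagonal, and the opposites of the coefficients in the last column.\<close>

definition companion :: "'a::field poly \<Rightarrow> 'a mat" where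
  "companion r = (let n = Polynomial.degree r in
     mat n n (\<lambda>(i, j). if j = n - 1 then - poly.coeff r i else if i = j + 1 then 1 else 0))"

section \<open>Finite-dimensional vector spaces\<close>

text \<open>A vector space is a subset \<open>V\<close> of a type, with the addition of the type and the scalar
  multiplication \<open>s\<close>. Maps on \<open>V\<close> are functions on the whole type, of which only the
  values on \<open>V\<close> matter.\<close>

definition fd_space :: "('a::field \<Rightarrow> 'v::ab_group_add \<Rightarrow> 'v) \<Rightarrow> 'v set \<Rightarrow> bool" where
  "fd_space s V \<longleftrightarrow> vector_space s \<and> (\<exists>B. finite B \<and> Modules.module.span s B = V)"

definition linear_on ::
  "('a::field \<Rightarrow> 'v::ab_group_add \<Rightarrow> 'v) \<Rightarrow> ('a \<Rightarrow> 'w::ab_group_add \<Rightarrow> 'w) \<Rightarrow> 'v set \<Rightarrow> ('v \<Rightarrow> 'w) \<Rightarrow> bool" where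
  "linear_on s t V f \<longleftrightarrow>
     (\<forall>x\<in>V. \<forall>y\<in>V. f (x + y) = f x + f y) \<and> (\<forall>c. \<forall>x\<in>V. f (s c x) = t c (f x))"

definition endo_on :: "('a::field \<Rightarrow> 'v::ab_group_add \<Rightarrow> 'v) \<Rightarrow> 'v set \<Rightarrow> ('v \<Rightarrow> 'v) \<Rightarrow> bool" where
  "endo_on s V u \<longleftrightarrow> linear_on s s V u \<and> u ` V \<subseteq> V"

definition poly_endo :: "('a::field \<Rightarrow> 'v::ab_group_add \<Rightarrow> 'v) \<Rightarrow> 'a poly \<Rightarrow> ('v \<Rightarrow> 'v) \<Rightarrow> 'v \<Rightarrow> 'v" where
  "poly_endo s p u x = (\<Sum>i\<le>Polynomial.degree p. s (poly.coeff p i) ((u ^^ i) x))"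

definition represented_by ::
  "('a::field \<Rightarrow> 'v::ab_group_add \<Rightarrow> 'v) \<Rightarrow> 'v set \<Rightarrow> ('v \<Rightarrow> 'v) \<Rightarrow> 'a mat \<Rightarrow> bool" where
  "represented_by s V u A \<longleftrightarrow> (\<exists>bs.
     distinct bs \<and> \<not> Modules.module.dependent s (set bs) \<and> Modules.module.span s (set bs) = V \<and>
     A \<in> carrier_mat (length bs) (length bs) \<and>
     (\<forall>j<length bs. u (bs ! j) = (\<Sum>i<length bs. s (A $$ (i, j)) (bs ! i))))"

definition closure_eigenvalues ::
  "('a::field \<Rightarrow> 'v::ab_group_add \<Rightarrow> 'v) \<Rightarrow> 'v set \<Rightarrow> ('v \<Rightarrow> 'v) \<Rightarrow> 'a alg_closure set" where
  "closure_eigenvalues s V u =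
     {k. \<exists>A. represented_by s V u A \<and> eigenvalue (map_mat to_ac A) k}"

definition pq_regular ::
  "'a::field poly \<Rightarrow> 'a poly \<Rightarrow> ('a \<Rightarrow> 'v::ab_group_add \<Rightarrow> 'v) \<Rightarrow> 'v set \<Rightarrow> ('v \<Rightarrow> 'v) \<Rightarrow> bool" where
  "pq_regular p q s V u \<longleftrightarrow> closure_eigenvalues s V u \<inter> root_diffs p q = {}"

section \<open>Symplectic pairs\<close>

definition bilinear_on ::
  "('a::field \<Rightarrow> 'v::ab_group_add \<Rightarrow> 'v) \<Rightarrow> 'v set \<Rightarrow> ('v \<Rightarrow> 'v \<Rightarrow> 'a) \<Rightarrow> bool" where
  "bilinear_on s V b \<longleftrightarrow>
     (\<forall>x\<in>V. linear_on s (*) V (b x)) \<and> (\<forall>y\<in>V. linear_on s (*) V (\<lambda>x. b x y))"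

definition symplectic_form ::
  "('a::field \<Rightarrow> 'v::ab_group_add \<Rightarrow> 'v) \<Rightarrow> 'v set \<Rightarrow> ('v \<Rightarrow> 'v \<Rightarrow> 'a) \<Rightarrow> bool" where
  "symplectic_form s V b \<longleftrightarrow> bilinear_on s V b \<and> (\<forall>x\<in>V. b x x = 0) \<and>
     (\<forall>x\<in>V. (\<forall>y\<in>V. b x y = 0) \<longrightarrow> x = 0)"

definition alternating_endo ::
  "('a::field \<Rightarrow> 'v::ab_group_add \<Rightarrow> 'v) \<Rightarrow> 'v set \<Rightarrow> ('v \<Rightarrow> 'v \<Rightarrow> 'a) \<Rightarrow> ('v \<Rightarrow> 'v) \<Rightarrow> bool" where
  "alternating_endo s V b u \<longleftrightarrow> endo_on s V u \<and> (\<forall>x\<in>V. b x (u x) = 0)"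

definition symplectic_pair ::
  "('a::field \<Rightarrow> 'v::ab_group_add \<Rightarrow> 'v) \<Rightarrow> 'v set \<Rightarrow> ('v \<Rightarrow> 'v \<Rightarrow> 'a) \<Rightarrow> ('v \<Rightarrow> 'v) \<Rightarrow> bool" where
  "symplectic_pair s V b u \<longleftrightarrow> fd_space s V \<and> symplectic_form s V b \<and> alternating_endo s V b u"

definition symplectic_difference ::
  "'a::field poly \<Rightarrow> 'a poly \<Rightarrow> ('a \<Rightarrow> 'v::ab_group_add \<Rightarrow> 'v) \<Rightarrow> 'v set \<Rightarrow> ('v \<Rightarrow> 'v \<Rightarrow> 'a) \<Rightarrow> ('v \<Rightarrow> 'v) \<Rightarrow> bool"
  where
  "symplectic_difference p q s V b u \<longleftrightarrow> symplectic_pair s V b u \<and>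
     (\<exists>u1 u2. alternating_endo s V b u1 \<and> alternating_endo s V b u2 \<and>
        (\<forall>x\<in>V. u x = u1 x - u2 x) \<and>
        (\<forall>x\<in>V. poly_endo s p u1 x = 0) \<and> (\<forall>x\<in>V. poly_endo s q u2 x = 0))"

definition isometric ::
  "('a::field \<Rightarrow> 'v::ab_group_add \<Rightarrow> 'v) \<Rightarrow> 'v set \<Rightarrow> ('v \<Rightarrow> 'v \<Rightarrow> 'a) \<Rightarrow> ('v \<Rightarrow> 'v) \<Rightarrow>
   ('a \<Rightarrow> 'w::ab_group_add \<Rightarrow> 'w) \<Rightarrow> 'w set \<Rightarrow> ('w \<Rightarrow> 'w \<Rightarrow> 'a) \<Rightarrow> ('w \<Rightarrow> 'w) \<Rightarrow> bool" where
  "isometric s V b u t W c w \<longleftrightarrow> (\<exists>\<phi>. linear_on s t V \<phi> \<and> bij_betw \<phi> V W \<and>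
     (\<forall>x\<in>V. \<forall>y\<in>V. c (\<phi> x) (\<phi> y) = b x y) \<and> (\<forall>x\<in>V. w (\<phi> x) = \<phi> (u x)))"

definition sum_form ::
  "('v \<Rightarrow> 'v \<Rightarrow> 'a::field) \<Rightarrow> ('w \<Rightarrow> 'w \<Rightarrow> 'a) \<Rightarrow> 'v \<times> 'w \<Rightarrow> 'v \<times> 'w \<Rightarrow> 'a" where
  "sum_form b c x y = b (fst x) (fst y) + c (snd x) (snd y)"

text \<open>The two summands are sought in the type of \<open>V\<close> itself, with any scalar multiplications;
  as shown below, summands in other types would give the same notion.\<close>

definition indecomposable_difference ::
  "'a::field poly \<Rightarrow> 'a poly \<Rightarrow> ('a \<Rightarrow> 'v::ab_group_add \<Rightarrow> 'v) \<Rightarrow> 'v set \<Rightarrow> ('v \<Rightarrow> 'v \<Rightarrow> 'a) \<Rightarrow> ('v \<Rightarrow> 'v) \<Rightarrow> bool"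
  where
  "indecomposable_difference p q s V b u \<longleftrightarrow>
     symplectic_difference p q s V b u \<and> V \<noteq> {0} \<and>
     \<not> (\<exists>(s1 :: 'a \<Rightarrow> 'v \<Rightarrow> 'v) V1 b1 u1 (s2 :: 'a \<Rightarrow> 'v \<Rightarrow> 'v) V2 b2 u2.
          symplectic_difference p q s1 V1 b1 u1 \<and> V1 \<noteq> {0} \<and>
          symplectic_difference p q s2 V2 b2 u2 \<and> V2 \<noteq> {0} \<and>
          isometric s V b u
            (module_prod.scale s1 s2) (V1 \<times> V2) (sum_form b1 b2) (map_prod u1 u2))"

lemma fd_space_subspace: "fd_space s V \<Longrightarrow> Modules.module.subspace s V"
  unfolding fd_space_def vector_space_def[symmetric]
  by (metis module.subspace_span module_iff_vector_space)

lemma linear_on_zero: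
  assumes "fd_space t W" "vector_space s" "linear_on t s W f"
  shows "f 0 = 0"
proof -
  interpret t: vector_space t using assms(1) by (simp add: fd_space_def)
  interpret s: vector_space s by fact
  have "0 \<in> W" using fd_space_subspace[OF assms(1)] by (rule t.subspace_0)
  then have "f (t 0 0) = s 0 (f 0)" using assms(3) by (simp only: linear_on_def)
  then show ?thesis by simp
qed

lemma linear_on_sum:
  assumes "fd_space t W" "vector_space s" "linear_on t s W f" "\<And>i. i \<in> I \<Longrightarrow> g i \<in> W"
  shows "f (\<Sum>i\<in>I. g i) = (\<Sum>i\<in>I. f (g i))"
  using assms(4)
proof (induction I rule: infinite_finite_induct)
  case (insert a I)
  interpret t: vector_space t using assms(1) by (simp add: fd_space_def)
  have "(\<Sum>i\<in>I. g i) \<in> W"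
    using fd_space_subspace[OF assms(1)] insert.prems by (intro t.subspace_sum) auto
  then show ?case using insert assms(3) by (simp add: linear_on_def)
qed (use linear_on_zero[OF assms(1-3)] in simp_all)

locale space_embedding =
  fixes t :: "'a::field \<Rightarrow> 'w::ab_group_add \<Rightarrow> 'w" and W
    and s :: "'a \<Rightarrow> 'v::ab_group_add \<Rightarrow> 'v" and f :: "'w \<Rightarrow> 'v" and g :: "'v \<Rightarrow> 'w"
  assumes fdW: "fd_space t W" and vs: "vector_space s" and lin: "linear_on t s W f"
    and gf: "\<And>x. x \<in> W \<Longrightarrow> g (f x) = x"
begin

sublocale t: vector_space t using fdW by (simp add: fd_space_def)
sublocale s: vector_space s by (rule vs)

lemma sub: "t.subspace W"
  using fdW by (rule fd_space_subspace)

lemma mem [simp]: "x \<in> W \<Longrightarrow> y \<in> W \<Longrightarrow> x + y \<in> W" "x \<in> W \<Longrightarrow> t c x \<in> W"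
  using t.subspace_add[OF sub] t.subspace_scale[OF sub] by auto

lemma lin_add: "x \<in> W \<Longrightarrow> y \<in> W \<Longrightarrow> f x + f y = f (x + y)"
  and lin_scale: "x \<in> W \<Longrightarrow> s c (f x) = f (t c x)"
  using lin by (auto simp: linear_on_def)

lemma lin_zero: "f 0 = 0"
  using fdW vs lin by (rule linear_on_zero)

lemma lin_diff:
  assumes "x \<in> W" "y \<in> W"
  shows "f (x - y) = f x - f y"
  using lin_add[OF t.subspace_diff[OF sub assms] assms(2)] by (simp add: algebra_simps)

lemma fd_space_image: "fd_space s (f ` W)"
proof -
  obtain B where B: "finite B" "t.span B = W" using fdW by (auto simp: fd_space_def)
  have BW: "B \<subseteq> W" using B t.span_superset by blast
  have "s.subspace (f ` W)"
    using imageI[OF t.subspace_0[OF sub], of f]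
    by (auto simp: s.subspace_def lin_add lin_scale lin_zero)
  then have 1: "s.span (f ` B) \<subseteq> f ` W" using BW by (intro s.span_minimal) auto
  have "t.subspace {x \<in> W. f x \<in> s.span (f ` B)}"
    using t.subspace_0[OF sub]
    by (auto simp: t.subspace_def lin_zero lin_add[symmetric] lin_scale[symmetric]
        intro: s.span_zero s.span_add s.span_scale)
  then have "t.span B \<subseteq> {x \<in> W. f x \<in> s.span (f ` B)}"
    using BW by (intro t.span_minimal) (auto intro: s.span_base)
  then have "s.span (f ` B) = f ` W" using B 1 by auto
  then show ?thesis using B vs by (auto simp: fd_space_def)
qed

lemma alternating_endo_image:
  assumes "alternating_endo t W c w"
  shows "alternating_endo s (f ` W) (\<lambda>x y. c (g x) (g y)) (\<lambda>x. f (w (g x)))"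
  using assms
  by (auto simp: alternating_endo_def endo_on_def linear_on_def gf lin_add lin_scale image_subset_iff)

lemma symplectic_form_image:
  assumes "symplectic_form t W c"
  shows "symplectic_form s (f ` W) (\<lambda>x y. c (g x) (g y))"
  using assms lin_zero
  by (auto simp: symplectic_form_def bilinear_on_def linear_on_def gf lin_add lin_scale)

lemma poly_endo_image:
  assumes w: "endo_on t W w" and x: "x \<in> W"
  shows "poly_endo s p (\<lambda>x. f (w (g x))) (f x) = f (poly_endo t p w x)"
proof -
  have mem': "(w ^^ i) x \<in> W" for i
    using w x by (induction i) (auto simp: endo_on_def)
  have "((\<lambda>x. f (w (g x))) ^^ i) (f x) = f ((w ^^ i) x)" for i
    by (induction i) (auto simp: gf mem')
  then show ?thesis
    by (simp add: poly_endo_def linear_on_sum[OF fdW vs lin] mem' lin_scale)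
qed

lemma symplectic_difference_image:
  assumes "symplectic_difference p q t W c w"
  shows "symplectic_difference p q s (f ` W) (\<lambda>x y. c (g x) (g y)) (\<lambda>x. f (w (g x)))"
proof -
  obtain w1 w2 where w: "alternating_endo t W c w1" "alternating_endo t W c w2"
      "\<forall>x\<in>W. w x = w1 x - w2 x" "\<forall>x\<in>W. poly_endo t p w1 x = 0" "\<forall>x\<in>W. poly_endo t q w2 x = 0"
    using assms by (auto simp: symplectic_difference_def)
  have e: "endo_on t W w1" "endo_on t W w2" using w by (auto simp: alternating_endo_def)
  have "f (w x) = f (w1 x) - f (w2 x)" if "x \<in> W" for x
    using e that w(3) by (auto simp: endo_on_def image_subset_iff lin_diff)
  then have "\<forall>x\<in>f ` W. f (w (g x)) = f (w1 (g x)) - f (w2 (g x))" by (auto simp: gf)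
  moreover have "\<forall>x\<in>f ` W. poly_endo s p (\<lambda>x. f (w1 (g x))) x = 0"
    and "\<forall>x\<in>f ` W. poly_endo s q (\<lambda>x. f (w2 (g x))) x = 0"
    using e w by (auto simp: poly_endo_image lin_zero)
  moreover have "symplectic_pair s (f ` W) (\<lambda>x y. c (g x) (g y)) (\<lambda>x. f (w (g x)))"
    using assms fd_space_image alternating_endo_image symplectic_form_image
    by (simp add: symplectic_difference_def symplectic_pair_def)
  ultimately show ?thesis
    using alternating_endo_image[OF w(1)] alternating_endo_image[OF w(2)]
    unfolding symplectic_difference_def
    by (intro conjI exI[of _ "\<lambda>x. f (w1 (g x))"] exI[of _ "\<lambda>x. f (w2 (g x))"]) assumption+
qed

end

lemma indecomposable_difference_universe:
  fixes t1 :: "'a::field \<Rightarrow> 'x::ab_group_add \<Rightarrow> 'x" and t2 :: "'a \<Rightarrow> 'y::ab_group_add \<Rightarrow> 'y"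
    and s :: "'a \<Rightarrow> 'v::ab_group_add \<Rightarrow> 'v"
  assumes V: "indecomposable_difference p q s V b u"
    and W1: "symplectic_difference p q t1 W1 c1 w1" "W1 \<noteq> {0}"
    and W2: "symplectic_difference p q t2 W2 c2 w2" "W2 \<noteq> {0}"
  shows "\<not> isometric s V b u
    (module_prod.scale t1 t2) (W1 \<times> W2) (sum_form c1 c2) (map_prod w1 w2)"
proof
  assume "isometric s V b u
    (module_prod.scale t1 t2) (W1 \<times> W2) (sum_form c1 c2) (map_prod w1 w2)"
  then obtain \<phi> where \<phi>: "linear_on s (module_prod.scale t1 t2) V \<phi>" "bij_betw \<phi> V (W1 \<times> W2)"
    and form: "\<And>x y. x \<in> V \<Longrightarrow> y \<in> V \<Longrightarrow> sum_form c1 c2 (\<phi> x) (\<phi> y) = b x y"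
    and com: "\<And>x. x \<in> V \<Longrightarrow> map_prod w1 w2 (\<phi> x) = \<phi> (u x)"
    by (auto simp: isometric_def)
  have fd: "fd_space s V" "fd_space t1 W1" "fd_space t2 W2" and uV: "endo_on s V u"
    using V W1 W2 by (auto simp: indecomposable_difference_def symplectic_difference_def
        symplectic_pair_def alternating_endo_def)
  interpret s: vector_space s using fd by (simp add: fd_space_def)
  interpret t1: vector_space t1 using fd by (simp add: fd_space_def)
  interpret t2: vector_space t2 using fd by (simp add: fd_space_def)
  interpret tt: module_prod t1 t2 ..
  define \<psi> where "\<psi> = the_inv_into V \<phi>"
  have inj: "inj_on \<phi> V" and im: "\<phi> ` V = W1 \<times> W2" using \<phi>(2) by (auto simp: bij_betw_def)
  have \<psi>\<phi>: "\<psi> (\<phi> x) = x" if "x \<in> V" for x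
    using inj that by (simp add: \<psi>_def the_inv_into_f_f)
  have \<phi>\<psi>: "\<phi> (\<psi> z) = z" and \<psi>V: "\<psi> z \<in> V" if "z \<in> W1 \<times> W2" for z
    using inj im that by (auto simp: \<psi>_def f_the_inv_into_f intro: the_inv_into_into)
  have s_mem: "x \<in> V \<Longrightarrow> y \<in> V \<Longrightarrow> x + y \<in> V" "x \<in> V \<Longrightarrow> s c x \<in> V" for x y c
    using fd_space_subspace[OF fd(1)] by (auto intro: s.subspace_add s.subspace_scale)
  have \<psi>_add: "\<psi> (y + z) = \<psi> y + \<psi> z" if "y \<in> W1 \<times> W2" "z \<in> W1 \<times> W2" for y z
  proof -
    have "\<phi> (\<psi> y + \<psi> z) = y + z" using \<phi>(1) that by (simp add: linear_on_def \<phi>\<psi> \<psi>V)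
    then show ?thesis using \<psi>\<phi> s_mem(1)[OF \<psi>V \<psi>V, OF that] by metis
  qed
  have \<psi>_scale: "\<psi> (tt.scale c z) = s c (\<psi> z)" if "z \<in> W1 \<times> W2" for c z
  proof -
    have "\<phi> (s c (\<psi> z)) = tt.scale c z" using \<phi>(1) that by (simp add: linear_on_def \<phi>\<psi> \<psi>V)
    then show ?thesis using \<psi>\<phi> s_mem(2)[OF \<psi>V, OF that] by metis
  qed
  have zero: "0 \<in> W1" "0 \<in> W2"
    using fd_space_subspace[OF fd(2)] fd_space_subspace[OF fd(3)]
    by (auto intro: t1.subspace_0 t2.subspace_0)
  define f1 f2 g1 g2 where "f1 = (\<lambda>x. \<psi> (x, 0))" and "f2 = (\<lambda>x. \<psi> (0, x))"
    and "g1 = fst \<circ> \<phi>" and "g2 = snd \<circ> \<phi>"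
  interpret e1: space_embedding t1 W1 s f1 g1
  proof
    show "linear_on t1 s W1 f1"
      using zero \<psi>_add[of "(_, 0)" "(_, 0)"] \<psi>_scale[of "(_, 0)"]
      by (auto simp: linear_on_def f1_def tt.scale_prod)
  qed (use fd zero in \<open>auto simp: f1_def g1_def \<phi>\<psi>\<close>)
  interpret e2: space_embedding t2 W2 s f2 g2
  proof
    show "linear_on t2 s W2 f2"
      using zero \<psi>_add[of "(0, _)" "(0, _)"] \<psi>_scale[of "(0, _)"]
      by (auto simp: linear_on_def f2_def tt.scale_prod)
  qed (use fd zero in \<open>auto simp: f2_def g2_def \<phi>\<psi>\<close>)
  have \<phi>W: "fst (\<phi> x) \<in> W1" "snd (\<phi> x) \<in> W2" if "x \<in> V" for x
    using im that by (metis imageI mem_Times_iff)+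
  have "isometric s V b u (module_prod.scale s s) (f1 ` W1 \<times> f2 ` W2)
      (sum_form (\<lambda>x y. c1 (g1 x) (g1 y)) (\<lambda>x y. c2 (g2 x) (g2 y)))
      (map_prod (\<lambda>x. f1 (w1 (g1 x))) (\<lambda>x. f2 (w2 (g2 x))))"
    unfolding isometric_def
  proof (intro exI conjI ballI)
    interpret ss: module_prod s s ..
    let ?\<chi> = "\<lambda>x. (f1 (fst (\<phi> x)), f2 (snd (\<phi> x)))"
    show "linear_on s ss.scale V ?\<chi>"
      using \<phi>(1)
      by (auto simp: linear_on_def ss.scale_prod tt.scale_def e1.lin_add e2.lin_add
          e1.lin_scale e2.lin_scale \<phi>W)
    have "bij_betw f1 W1 (f1 ` W1)" "bij_betw f2 W2 (f2 ` W2)"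
      by (auto intro!: inj_on_imp_bij_betw inj_on_inverseI[of _ g1] inj_on_inverseI[of _ g2]
          simp: e1.gf e2.gf)
    then have "bij_betw (map_prod f1 f2) (W1 \<times> W2) (f1 ` W1 \<times> f2 ` W2)"
      by (rule bij_betw_map_prod)
    then have "bij_betw (map_prod f1 f2 \<circ> \<phi>) V (f1 ` W1 \<times> f2 ` W2)"
      using \<phi>(2) by (intro bij_betw_trans)
    then show "bij_betw ?\<chi> V (f1 ` W1 \<times> f2 ` W2)"
      by (simp add: comp_def map_prod_def case_prod_beta)
    show "sum_form (\<lambda>x y. c1 (g1 x) (g1 y)) (\<lambda>x y. c2 (g2 x) (g2 y)) (?\<chi> x) (?\<chi> y) = b x y"
      if "x \<in> V" "y \<in> V" for x y
      using form[OF that] that by (simp add: sum_form_def e1.gf e2.gf \<phi>W)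
    show "map_prod (\<lambda>x. f1 (w1 (g1 x))) (\<lambda>x. f2 (w2 (g2 x))) (?\<chi> x) = ?\<chi> (u x)"
      if "x \<in> V" for x
      using com[OF that] that by (auto simp: e1.gf e2.gf \<phi>W map_prod_def case_prod_beta prod_eq_iff)
  qed
  moreover have "f1 ` W1 \<noteq> {0}"
  proof
    assume *: "f1 ` W1 = {0}"
    have "x = 0" if "x \<in> W1" for x
    proof -
      have "f1 x = f1 0" using * that by (simp add: set_eq_iff image_iff e1.lin_zero) metis
      then show "x = 0" using that zero e1.gf by metis
    qed
    then show False using W1(2) zero by auto
  qed
  moreover have "f2 ` W2 \<noteq> {0}"
  proof
    assume *: "f2 ` W2 = {0}"
    have "x = 0" if "x \<in> W2" for x
    proof -
      have "f2 x = f2 0" using * that by (simp add: set_eq_iff image_iff e2.lin_zero) metis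
      then show "x = 0" using that zero e2.gf by metis
    qed
    then show False using W2(2) zero by auto
  qed
  moreover note e1.symplectic_difference_image[OF W1(1)] e2.symplectic_difference_image[OF W2(1)]
  ultimately show False
    using V unfolding indecomposable_difference_def by meson
qed

section \<open>Symplectic extensions\<close>

definition fun_scale :: "'a::field \<Rightarrow> ('v \<Rightarrow> 'a) \<Rightarrow> 'v \<Rightarrow> 'a" where
  "fun_scale c f = (\<lambda>x. c * f x)"

text \<open>A linear form on \<open>V\<close> is extended by \<open>0\<close> outside of \<open>V\<close>, so that it is determined
  by its values on \<open>V\<close>.\<close>

definition dual_space :: "('a::field \<Rightarrow> 'v::ab_group_add \<Rightarrow> 'v) \<Rightarrow> 'v set \<Rightarrow> ('v \<Rightarrow> 'a) set" where
  "dual_space s V = {\<phi>. linear_on s (*) V \<phi> \<and> (\<forall>x. x \<notin> V \<longrightarrow> \<phi> x = 0)}"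

definition transpose_on :: "'v set \<Rightarrow> ('v \<Rightarrow> 'v) \<Rightarrow> ('v \<Rightarrow> 'a::field) \<Rightarrow> 'v \<Rightarrow> 'a" where
  "transpose_on V v \<phi> = (\<lambda>x. if x \<in> V then \<phi> (v x) else 0)"

definition ext_scale ::
  "('a::field \<Rightarrow> 'v::ab_group_add \<Rightarrow> 'v) \<Rightarrow> 'a \<Rightarrow> 'v \<times> ('v \<Rightarrow> 'a) \<Rightarrow> 'v \<times> ('v \<Rightarrow> 'a)" where
  "ext_scale s = module_prod.scale s fun_scale"

definition ext_space ::
  "('a::field \<Rightarrow> 'v::ab_group_add \<Rightarrow> 'v) \<Rightarrow> 'v set \<Rightarrow> ('v \<times> ('v \<Rightarrow> 'a)) set" where
  "ext_space s V = V \<times> dual_space s V"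

definition ext_form :: "'v \<times> ('v \<Rightarrow> 'a::field) \<Rightarrow> 'v \<times> ('v \<Rightarrow> 'a) \<Rightarrow> 'a" where
  "ext_form = (\<lambda>(x, \<phi>) (y, \<psi>). \<phi> y - \<psi> x)"

definition ext_endo :: "'v set \<Rightarrow> ('v \<Rightarrow> 'v) \<Rightarrow> 'v \<times> ('v \<Rightarrow> 'a::field) \<Rightarrow> 'v \<times> ('v \<Rightarrow> 'a)" where
  "ext_endo V v = map_prod v (transpose_on V v)"

end

(*
  Write p(t) = t^2 - \<tau> t + \<alpha>, q(t) = t^2 - \<mu> t + \<beta>, and let u = a - b with p(a) = 0 and q(b) = 0.
  Then w = u^2 - \<delta> u commutes with a and b, and a f(u) = f(\<delta> - u) a + g(u) for some
  polynomial g depending on f, so that every vector y generates the submodule F[u] y + F[u] a y.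
  Both summands are totally isotropic, and their pairing is governed by the functional
  f |-> B(y, f(u) a y), which vanishes on F[w].

  If this functional is as non-degenerate as the annihilator r^n(w) of y permits, the submodule is
  non-degenerate, splits off orthogonally, and is the symplectic extension of the cyclic
  endomorphism u of F[u] y.  Such a y exists: otherwise a and u would commute on a
  nonzero subspace c(w) V, whereas (u a - a u)^2 is a polynomial in u whose roots are the root
  differences.  Conversely, these formulas define a and b on the symplectic extension of the companion
  matrix of r^n(t^2 - \<delta> t), which has no proper orthogonal summand because one of the two summands
  would contain a y as above, whose submodule already has full dimension.
*)
theory Submission
  imports Defs
begin

section \<open>Divided differences of polynomials\<close>

text \<open>Characteristic 2 shapes the proof. For \<delta> = 0 it makes 2t - \<delta> zero: the
  difference of f(t) and f(\<delta> - t) cannot be divided by it, and invariance under t |->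
  \<delta> - t does not single out F[t^2 - \<delta> t]. The divided difference, built by a
  recursion, has kernel exactly F[t^2 - \<delta> t] in every characteristic. Self-adjointness does
  not imply alternation either, so the vanishing of the form is obtained from halves of powers of u
  and from norms f(t) f(\<delta> - t).

  The converse construction is read off from the action of a on f(u) y + g(u) a y. In the
  coordinates f(t) and g(\<delta> - t), with D sending f to its divided difference times
  \<open>kap\<close>, this action is the matrix with rows (D, -\<alpha>) and (1, \<tau> - D), whose
  entries commute. The reflection of the second coordinate is also what turns the action of u on it
  into \<delta> - u, the adjoint of u for an alternating form on F[t]/P.\<close>

definition reflect :: "'a::field \<Rightarrow> 'a poly \<Rightarrow> 'a poly" where
  "reflect \<delta> f = pcompose f [:\<delta>, -1:]"

definition qmap :: "'a::field \<Rightarrow> 'a poly" where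
  "qmap \<delta> = [:0, -\<delta>, 1:]"

text \<open>With x = t and y = \<delta> - t this is (x^i - y^i) / (x - y); the recursion comes from
  x^(i+1) - y^(i+1) = x^i (x - y) + y (x^i - y^i).\<close>

fun ddiff_monom :: "'a::field \<Rightarrow> nat \<Rightarrow> 'a poly" where
  "ddiff_monom \<delta> 0 = 0"
| "ddiff_monom \<delta> (Suc i) = Polynomial.monom 1 i + [:\<delta>, -1:] * ddiff_monom \<delta> i"

text \<open>The quotient of \<open>f - reflect \<delta> f\<close> by \<open>2 * t - \<delta>\<close>, defined without a division so as to
  make sense when \<open>2 * t = \<delta>\<close>, in characteristic 2.\<close>

definition ddiff :: "'a::field \<Rightarrow> 'a poly \<Rightarrow> 'a poly" where
  "ddiff \<delta> f = (\<Sum>i\<le>Polynomial.degree f. [:poly.coeff f i:] * ddiff_monom \<delta> i)"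

lemma poly_pCons_eq: "pCons c f = [:c:] + [:0, 1:] * (f :: 'a::comm_ring_1 poly)"
  by simp

lemma ddiff_pCons: "ddiff \<delta> (pCons c f) = f + [:\<delta>, -1:] * ddiff \<delta> f"
proof -
  have "ddiff \<delta> (pCons c f) =
      (\<Sum>i\<le>Suc (Polynomial.degree f). [:poly.coeff (pCons c f) i:] * ddiff_monom \<delta> i)"
    unfolding ddiff_def by (rule sum.mono_neutral_left) (auto simp: coeff_eq_0 degree_pCons_le)
  also have "\<dots> = (\<Sum>i\<le>Polynomial.degree f. [:poly.coeff f i:] * ddiff_monom \<delta> (Suc i))"
    by (subst sum.atMost_Suc_shift) simp
  also have "\<dots> = (\<Sum>i\<le>Polynomial.degree f. Polynomial.monom (poly.coeff f i) i)
      + [:\<delta>, -1:] * ddiff \<delta> f"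
    unfolding ddiff_def sum_distrib_left sum.distrib[symmetric]
    by (intro sum.cong refl)
      (simp add: ring_distribs smult_monom mult.left_commute del: mult_pCons_left mult_pCons_right,
        simp add: smult_monom)
  finally show ?thesis by (simp only: poly_as_sum_of_monoms)
qed

lemma ddiff_0 [simp]: "ddiff \<delta> 0 = 0"
  and ddiff_const [simp]: "ddiff \<delta> [:c:] = 0"
  by (simp_all add: ddiff_def)

lemma ddiff_X [simp]: "ddiff \<delta> [:c, d:] = [:d:]"
  using ddiff_pCons[of \<delta> c "[:d:]"] by simp

lemma ddiff_add: "ddiff \<delta> (f + g) = ddiff \<delta> f + ddiff \<delta> g"
proof (induction f g rule: poly_induct2)
  case (pCons a p b q)
  have "ddiff \<delta> (pCons a p + pCons b q) = (p + q) + [:\<delta>, -1:] * ddiff \<delta> (p + q)"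
    by (simp only: add_pCons ddiff_pCons)
  also have "\<dots> = ddiff \<delta> (pCons a p) + ddiff \<delta> (pCons b q)"
    unfolding pCons.IH ddiff_pCons by (simp only: algebra_simps)
  finally show ?case .
qed simp

lemma reflect_pCons: "reflect \<delta> (pCons c f) = [:c:] + [:\<delta>, -1:] * reflect \<delta> f"
  by (simp only: reflect_def pcompose_pCons)

lemma reflect_hom:
  "reflect \<delta> (f + g) = reflect \<delta> f + reflect \<delta> g"
  "reflect \<delta> (f - g) = reflect \<delta> f - reflect \<delta> g"
  "reflect \<delta> (f * g) = reflect \<delta> f * reflect \<delta> g"
  "reflect \<delta> [:c:] = [:c:]" "reflect \<delta> 1 = 1" "reflect \<delta> 0 = 0"
  by (simp_all add: reflect_def pcompose_add pcompose_diff pcompose_mult pcompose_1)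

lemma reflect_reflect [simp]: "reflect \<delta> (reflect \<delta> f) = f"
proof -
  have "pcompose [:\<delta>, -1:] [:\<delta>, -1:] = [:0, 1:]" by (simp add: pcompose_pCons)
  then show ?thesis unfolding reflect_def pcompose_assoc[symmetric] by simp
qed

text \<open>Twisted Leibniz rule. With a prime for \<open>reflect \<delta>\<close>, it is f g - f'
  g' = (f - f') g + f' (g - g') divided by 2t - \<delta>; the induction on f avoids this
  division.\<close>

lemma ddiff_mult: "ddiff \<delta> (f * g) = ddiff \<delta> f * g + reflect \<delta> f * ddiff \<delta> g"
proof (induction f)
  case (pCons c f)
  have *: "pCons c f * g = [:c:] * g + pCons 0 (f * g)" by simp
  have c: "ddiff \<delta> ([:c:] * g) = [:c:] * ddiff \<delta> g"
  proof (induction g)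
    case (pCons d g)
    have "ddiff \<delta> ([:c:] * pCons d g) = ddiff \<delta> (pCons (c * d) ([:c:] * g))" by (simp add: mult.commute)
    also have "\<dots> = [:c:] * g + [:\<delta>, -1:] * ([:c:] * ddiff \<delta> g)"
      by (simp only: ddiff_pCons pCons.IH)
    also have "\<dots> = [:c:] * ddiff \<delta> (pCons d g)"
      by (simp only: ddiff_pCons ring_distribs mult.left_commute)
    finally show ?case .
  qed simp
  have "ddiff \<delta> (pCons c f * g) = [:c:] * ddiff \<delta> g + f * g +
      [:\<delta>, -1:] * (ddiff \<delta> f * g + reflect \<delta> f * ddiff \<delta> g)"
    by (simp only: * ddiff_add c ddiff_pCons pCons.IH add.assoc)
  then show ?case
    by (simp only: ddiff_pCons reflect_pCons ring_distribs ac_simps)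
qed (simp add: reflect_def)

text \<open>The relation behind the divided difference, with the denominator cleared. If 2t =
  \<delta>, it carries no information on \<open>ddiff\<close> and only says that
  \<open>reflect \<delta>\<close> is the identity.\<close>

lemma reflect_eq: "reflect \<delta> f = f + [:\<delta>, -2:] * ddiff \<delta> f"
proof (induction f)
  case (pCons c f)
  have "reflect \<delta> (pCons c f) = [:c:] + [:\<delta>, -1:] * (f + [:\<delta>, -2:] * ddiff \<delta> f)"
    by (simp only: reflect_pCons pCons.IH)
  also have "\<dots> = pCons c f + [:\<delta>, -2:] * ddiff \<delta> (pCons c f)"
  proof -
    have "[:\<delta>, -1:] * f = [:0, 1:] * f + [:\<delta>, -2:] * f"
      by (simp only: distrib_right[symmetric]) simp
    then show ?thesis
      unfolding ddiff_pCons unfolding poly_pCons_eq[of c f]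
      by (simp only: ring_distribs ac_simps)
  qed
  finally show ?case .
qed (simp add: reflect_def)

lemma ddiff_reflect: "ddiff \<delta> (reflect \<delta> f) = - ddiff \<delta> f"
proof (induction f)
  case (pCons c f)
  have x: "reflect \<delta> [:\<delta>, -1:] = [:0, 1:]" by (simp add: reflect_def pcompose_pCons)
  have "ddiff \<delta> (reflect \<delta> (pCons c f)) = - reflect \<delta> f - [:0, 1:] * ddiff \<delta> f"
    unfolding reflect_pCons[of \<delta> c f] ddiff_add ddiff_mult x pCons.IH by simp
  also have "\<dots> = - (f + ([:\<delta>, -2:] + [:0, 1:]) * ddiff \<delta> f)"
    unfolding reflect_eq by (simp only: ring_distribs minus_add_distrib diff_conv_add_uminus ac_simps)
  also have "[:\<delta>, -2:] + [:0, 1:] = [:\<delta>, -1:]" by simp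
  finally show ?case by (simp only: ddiff_pCons)
qed (simp add: reflect_def)

text \<open>A divided difference is symmetric in t and \<delta> - t, hence a polynomial in t^2 -
  \<delta> t.\<close>

lemma ddiff_ddiff [simp]: "ddiff \<delta> (ddiff \<delta> f) = 0"
proof (induction f)
  case (pCons c f)
  show ?case by (simp only: ddiff_pCons ddiff_add ddiff_mult pCons.IH ddiff_X) simp
qed simp

section \<open>Polynomials in t^2 - \<delta> t\<close>

lemma pcompose_qmap_pCons:
  "pcompose (pCons c h) (qmap \<delta>) = [:c:] + qmap \<delta> * pcompose h (qmap \<delta>)"
  by (rule pcompose_pCons)

lemma reflect_qmap [simp]: "reflect \<delta> (qmap \<delta>) = qmap \<delta>"
  by (simp add: reflect_def qmap_def pcompose_pCons)

lemma ddiff_qmap [simp]: "ddiff \<delta> (qmap \<delta>) = 0"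
  by (simp add: qmap_def ddiff_pCons[of \<delta> 0])

lemma reflect_pcompose_qmap [simp]: "reflect \<delta> (pcompose h (qmap \<delta>)) = pcompose h (qmap \<delta>)"
  using reflect_qmap[of \<delta>] unfolding reflect_def pcompose_assoc[symmetric] by simp

lemma ddiff_pcompose_qmap [simp]: "ddiff \<delta> (pcompose h (qmap \<delta>)) = 0"
  by (induction h) (simp_all only: pcompose_qmap_pCons ddiff_add ddiff_mult ddiff_const ddiff_qmap
      pcompose_0 ddiff_0 mult_zero_left mult_zero_right add_0)

text \<open>Over F[w] with w = t^2 - \<delta> t, the variable t satisfies the monic equation t^2 = w
  + \<delta> t, so 1 and t generate F[t].\<close>

lemma qmap_decomposition:
  obtains h k where "f = pcompose h (qmap \<delta>) + [:0, 1:] * pcompose k (qmap \<delta>)"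
proof -
  have "\<exists>h k. f = pcompose h (qmap \<delta>) + [:0, 1:] * pcompose k (qmap \<delta>)"
  proof (induction f)
    case 0
    show ?case by (intro exI[of _ 0]) simp
  next
    case (pCons c f)
    then obtain h k where f: "f = pcompose h (qmap \<delta>) + [:0, 1:] * pcompose k (qmap \<delta>)" by blast
    have X2: "[:0, 1:] * [:0, 1:] = qmap \<delta> + [:0, 1:] * [:\<delta>:]" by (simp add: qmap_def)
    have "pCons c f = [:c:] + [:0, 1:] * pcompose h (qmap \<delta>)
        + ([:0, 1:] * [:0, 1:]) * pcompose k (qmap \<delta>)"
      unfolding poly_pCons_eq[of c f] unfolding f by (simp only: ring_distribs ac_simps)
    also have "\<dots> = pcompose (pCons c k) (qmap \<delta>) + [:0, 1:] * pcompose (h + [:\<delta>:] * k) (qmap \<delta>)"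
      unfolding X2 pcompose_qmap_pCons[of c k] pcompose_add pcompose_mult pcompose_const
      by (simp only: ring_distribs ac_simps)
    finally show ?case by blast
  qed
  then show thesis using that by blast
qed

text \<open>\<open>ddiff \<delta>\<close> is linear over F[t^2 - \<delta> t], kills 1 and maps t to
  1: it reads off the coordinate on t in \<open>qmap_decomposition\<close>.\<close>

lemma ddiff_eq_0_imp:
  assumes "ddiff \<delta> f = 0"
  obtains h where "f = pcompose h (qmap \<delta>)"
proof -
  obtain h k where f: "f = pcompose h (qmap \<delta>) + [:0, 1:] * pcompose k (qmap \<delta>)"
    by (rule qmap_decomposition)
  have "ddiff \<delta> f = pcompose k (qmap \<delta>)" unfolding f ddiff_add ddiff_mult by simp
  then show thesis using assms f that[of h] by simp
qed

section \<open>The functional reading off the top coefficient modulo a polynomial\<close>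

definition top_coeff :: "'a::field poly \<Rightarrow> 'a poly \<Rightarrow> 'a" where
  "top_coeff P f = poly.coeff (f mod P) (Polynomial.degree P - 1)"

lemma top_coeff_add: "top_coeff P (f + g) = top_coeff P f + top_coeff P g"
  and top_coeff_diff: "top_coeff P (f - g) = top_coeff P f - top_coeff P g"
  and top_coeff_const_mult: "top_coeff P ([:c:] * f) = c * top_coeff P f"
  and top_coeff_dvd: "P dvd f \<Longrightarrow> top_coeff P f = 0"
  by (simp_all add: top_coeff_def poly_mod_add_left poly_mod_diff_left mod_smult_left
      mod_eq_0_iff_dvd)

text \<open>Multiplying a nonzero remainder of degree k by t^(N - 1 - k), where N is the degree of
  P, moves its leading coefficient to degree N - 1 without any further reduction modulo P.\<close>

lemma top_coeff_nondegenerate: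
  assumes "Polynomial.degree P > 0" and "\<And>g. top_coeff P (f * g) = 0"
  shows "P dvd f"
proof (rule ccontr)
  assume "\<not> P dvd f"
  then have nz: "f mod P \<noteq> 0" by (simp add: mod_eq_0_iff_dvd)
  let ?k = "Polynomial.degree (f mod P)" and ?N = "Polynomial.degree P"
  have k: "?k < ?N" using degree_mod_less[of P f] assms(1) nz by (cases "P = 0") auto
  let ?g = "Polynomial.monom 1 (?N - 1 - ?k) :: 'a poly"
  have deg: "Polynomial.degree (f mod P * ?g) < ?N"
    using k nz by (subst degree_mult_eq) (auto simp: degree_monom_eq monom_eq_0_iff)
  have "f * ?g mod P = f mod P * ?g mod P" by (simp add: mod_mult_left_eq)
  also have "\<dots> = f mod P * ?g" using deg by (rule mod_poly_less)
  finally have "top_coeff P (f * ?g) = Polynomial.lead_coeff (f mod P)"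
    unfolding top_coeff_def using k by (simp add: mult.commute[of "f mod P"] coeff_monom_mult)
  then show False using assms(2) nz by simp
qed

text \<open>Division with remainder is compatible with the substitution of t^2 - \<delta> t: the
  remainder modulo P comes from \<open>h mod R\<close>, so its degree is even and at most that of P
  minus 2.\<close>

lemma top_coeff_pcompose_qmap:
  fixes R :: "'a::field poly"
  assumes "Polynomial.degree R > 0"
  shows "top_coeff (pcompose R (qmap \<delta>)) (pcompose h (qmap \<delta>)) = 0"
proof -
  have dq: "Polynomial.degree (qmap \<delta>) = 2" by (simp add: qmap_def)
  let ?k = "pcompose (h mod R) (qmap \<delta>)" and ?P = "pcompose R (qmap \<delta>)"
  have dP: "Polynomial.degree ?P = Polynomial.degree R * 2"
    by (simp only: degree_pcompose dq)
  have "Polynomial.degree (h mod R) < Polynomial.degree R"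
    using degree_mod_less'[of R h] assms by (cases "h mod R = 0"; cases "R = 0") auto
  then have dk: "Polynomial.degree ?k < Polynomial.degree ?P - 1"
    unfolding dP by (simp only: degree_pcompose dq)
  have "pcompose h (qmap \<delta>) = pcompose (h div R) (qmap \<delta>) * ?P + ?k"
    by (simp only: pcompose_mult[symmetric] pcompose_add[symmetric] div_mult_mod_eq)
  then have "pcompose h (qmap \<delta>) mod ?P = ?k mod ?P" by simp
  also have "\<dots> = ?k" by (rule mod_poly_less[OF order.strict_trans2[OF dk diff_le_self]])
  finally show ?thesis using coeff_eq_0[OF dk] by (simp only: top_coeff_def)
qed

section \<open>The polynomial of root differences\<close>

locale quadratics =
  fixes \<tau> \<mu> \<alpha> \<beta> :: "'a::field"
begin

definition "\<delta> = \<tau> - \<mu>"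

text \<open>Expanding q(a - u) = 0 and substituting a^2 = \<tau> a - \<alpha> gives a u = (\<delta>
  - u) a + (u^2 + \<mu> u + \<beta> - \<alpha>); \<open>kap\<close> is the last term.\<close>

definition kap :: "'a poly" where "kap = [:\<beta> - \<alpha>, \<mu>, 1:]"

text \<open>The product of the \<open>t - (x - y)\<close> for \<open>x\<close> a root of \<open>p\<close> and \<open>y\<close> a
  root of \<open>q\<close>.\<close>

definition rdpoly :: "'a poly" where
  "rdpoly = kap * kap - [:\<tau>:] * kap * [:-\<delta>, 2:] + [:\<alpha>:] * [:-\<delta>, 2:] * [:-\<delta>, 2:]"

text \<open>The differences x1 - y1 and x2 - y2 add up to \<delta>, so their two linear factors
  multiply to w + (x1 - y1) (x2 - y2) with w = t^2 - \<delta> t, and likewise for x1 - y2 and x2 -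
  y1. The product of these two factors, as a polynomial in w, has the coefficients below.\<close>

definition rdpoly0 :: "'a poly" where
  "rdpoly0 = [:(\<alpha> + \<beta>) * (\<alpha> + \<beta>) - \<tau> * \<mu> * (\<alpha> + \<beta>) + \<beta> * \<tau> * \<tau> + \<alpha> * \<mu> * \<mu> - 4 * \<alpha> * \<beta>,
    2 * (\<alpha> + \<beta>) - \<tau> * \<mu>, 1:]"

lemma kap_eq: "kap = qmap \<delta> + [:\<beta> - \<alpha>, \<tau>:]"
  by (simp add: kap_def qmap_def \<delta>_def)

lemma ddiff_kap [simp]: "ddiff \<delta> kap = [:\<tau>:]"
  by (simp add: kap_eq ddiff_add)

lemma reflect_kap: "reflect \<delta> kap = kap + [:\<tau>:] * [:\<delta>, -2:]"
  by (simp add: reflect_eq)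

lemma pcompose_rdpoly0: "pcompose rdpoly0 (qmap \<delta>) = rdpoly"
  by (simp add: rdpoly0_def rdpoly_def qmap_def pcompose_pCons kap_def \<delta>_def algebra_simps)

text \<open>With N = 2t - \<delta>, \<open>rdpoly\<close> is N^2 p(kap / N) = (kap - x1 N) (kap - x2
  N), and each kap - x N, for x a root of p, factors as (t - (x - y1)) (t - (x - y2)).\<close>

lemma poly_rdpoly:
  fixes h :: "'a \<Rightarrow> 'b::field" and x1 x2 y1 y2 z :: 'b
  assumes "\<And>x y. h (x + y) = h x + h y" "\<And>x y. h (x - y) = h x - h y" "\<And>x. h (- x) = - h x"
    and "\<And>x y. h (x * y) = h x * h y" "h 0 = 0" "h 1 = 1"
    and "h \<tau> = x1 + x2" "h \<alpha> = x1 * x2" "h \<mu> = y1 + y2" "h \<beta> = y1 * y2"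
  shows "poly (map_poly h rdpoly) z
    = (z - (x1 - y1)) * (z - (x1 - y2)) * (z - (x2 - y1)) * (z - (x2 - y2))"
proof -
  have 2: "h 2 = 2" unfolding one_add_one[symmetric] assms by simp
  have 3: "h 3 = 3" "h 4 = 4" using assms(1)[of 1 2] assms(1)[of 2 2] assms(6) 2 by simp_all
  show ?thesis
    by (simp add: rdpoly_def kap_def \<delta>_def map_poly_pCons assms 2 3 algebra_simps)
qed

end

section \<open>Linear algebra in a subspace\<close>

context vector_space
begin

text \<open>Stated for families because the iterates of a vector are not known in advance to be
  distinct.\<close>

lemma family_independent:
  assumes "finite I" and fam: "\<And>c. (\<Sum>i\<in>I. scale (c i) (x i)) = 0 \<Longrightarrow> \<forall>i\<in>I. c i = 0"
  shows "inj_on x I" "independent (x ` I)"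
proof -
  show inj: "inj_on x I"
  proof (rule inj_onI, rule ccontr)
    fix i j assume ij: "i \<in> I" "j \<in> I" "x i = x j" "i \<noteq> j"
    let ?c = "\<lambda>k. if k = i then 1 else if k = j then - 1 else 0"
    have "(\<Sum>k\<in>I. scale (?c k) (x k)) = (\<Sum>k\<in>{i, j}. scale (?c k) (x k))"
      using assms(1) ij by (intro sum.mono_neutral_right) auto
    also have "\<dots> = 0" using ij by simp
    finally show False using fam[of ?c] ij by auto
  qed
  show "independent (x ` I)"
  proof (rule independent_if_scalars_zero)
    fix f v assume "(\<Sum>v\<in>x ` I. scale (f v) v) = 0" "v \<in> x ` I"
    then show "f v = 0" using fam[of "f \<circ> x"] inj by (auto simp: sum.reindex)
  qed (use assms in simp)
qed

lemma dependent_family: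
  assumes "finite B" "finite I" "card B < card I" "x ` I \<subseteq> span B"
  obtains c i where "(\<Sum>i\<in>I. scale (c i) (x i)) = 0" "i \<in> I" "c i \<noteq> 0"
proof (rule ccontr)
  assume "\<not> thesis"
  then have fam: "\<And>c. (\<Sum>i\<in>I. scale (c i) (x i)) = 0 \<Longrightarrow> \<forall>i\<in>I. c i = 0"
    using that by blast
  have "card (x ` I) = card I" using family_independent(1)[OF assms(2) fam] by (rule card_image)
  moreover have "card (x ` I) \<le> card B"
    using independent_span_bound[OF assms(1) family_independent(2)[OF assms(2) fam] assms(4)] by simp
  ultimately show False using assms(3) by simp
qed

lemma independent_list_coeffs:
  assumes "distinct bs" "independent (set bs)"
    and "(\<Sum>i<length bs. scale (c i) (bs ! i)) = 0" "i < length bs"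
  shows "c i = 0"
proof -
  have inj: "inj_on ((!) bs) {..<length bs}" using assms(1) by (auto simp: inj_on_def nth_eq_iff_index_eq)
  have bij: "bij_betw ((!) bs) {..<length bs} (set bs)" using assms(1) by (rule bij_betw_nth) auto
  let ?g = "the_inv_into {..<length bs} ((!) bs)"
  have g: "?g (bs ! j) = j" if "j < length bs" for j using the_inv_into_f_f[OF inj] that by simp
  have "(\<Sum>v\<in>set bs. scale (c (?g v)) v) = (\<Sum>i<length bs. scale (c (?g (bs ! i))) (bs ! i))"
    by (rule sum.reindex_bij_betw[OF bij, symmetric])
  also have "\<dots> = (\<Sum>i<length bs. scale (c i) (bs ! i))" by (rule sum.cong) (simp_all add: g)
  also have "\<dots> = 0" by fact
  finally have "c (?g (bs ! i)) = 0"
    using independentD[OF assms(2), of "set bs" "\<lambda>v. c (?g v)"] assms(4) by simp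
  then show ?thesis using g assms(4) by simp
qed

lemma fd_space_subspace_of:
  assumes "fd_space scale V" "subspace U" "U \<subseteq> V"
  shows "fd_space scale U"
proof -
  obtain B where B: "finite B" "span B = V" using assms by (auto simp: fd_space_def)
  obtain C where C: "C \<subseteq> U" "independent C" "U \<subseteq> span C"
    using maximal_independent_subset by metis
  have "finite C" using independent_span_bound[OF B(1) C(2)] B C assms by auto
  moreover have "span C = U" using C assms span_minimal by blast
  ultimately show ?thesis using assms by (auto simp: fd_space_def)
qed

lemma linear_on_span_image:
  assumes t: "vector_space t" and f: "linear_on scale t (span B) f"
  shows "Modules.module.span t (f ` B) = f ` span B"
proof
  interpret t: vector_space t by fact
  have mem: "x + y \<in> span B" "scale c x \<in> span B" if "x \<in> span B" "y \<in> span B" for x y c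
    using that by (auto intro: span_add span_scale)
  have f0: "f 0 = 0"
    using f span_zero[of B] unfolding linear_on_def by (metis scale_zero_left t.scale_zero_left)
  have "t.subspace (f ` span B)"
  proof (rule t.subspaceI)
    show "0 \<in> f ` span B" using f0 span_zero[of B] by (metis imageI)
    fix x y c assume "x \<in> f ` span B" "y \<in> f ` span B"
    then obtain x' y' where *: "x = f x'" "x' \<in> span B" "y = f y'" "y' \<in> span B" by blast
    then have "x + y = f (x' + y')" using f by (simp add: linear_on_def)
    then show "x + y \<in> f ` span B" using mem * by simp
    have "t c x = f (scale c x')" using f * by (simp add: linear_on_def)
    then show "t c x \<in> f ` span B" using mem * by simp
  qed
  then show "t.span (f ` B) \<subseteq> f ` span B" using span_superset by (intro t.span_minimal) auto
  show "f ` span B \<subseteq> t.span (f ` B)"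
  proof
    fix y assume "y \<in> f ` span B"
    then obtain x where x: "y = f x" "x \<in> span B" by blast
    have "x \<in> span B \<and> f x \<in> t.span (f ` B)" using x(2)
    proof (induction x rule: span_induct_alt)
      case base
      show ?case using f0 t.span_zero span_zero by simp
    next
      case (step c b z)
      have "b \<in> span B" "z \<in> span B" using step span_base by auto
      then have "f (scale c b + z) = t c (f b) + f z" "scale c b + z \<in> span B"
        using f mem by (simp_all add: linear_on_def)
      then show ?case using step by (simp add: t.span_add t.span_scale t.span_base)
    qed
    then show "y \<in> t.span (f ` B)" using x by simp
  qed
qed

text \<open>Riesz representation, in coordinates: the induction hypothesis gives a dual family of \<open>E\<close>,
  by which a new vector is made orthogonal to \<open>E\<close>.\<close>

lemma bilinear_represent_values:
  assumes sub: "subspace V" and B: "bilinear_on scale V b"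
    and E: "finite E" "independent E" "E \<subseteq> V"
    and nd: "\<And>x. x \<in> span E \<Longrightarrow> (\<And>z. z \<in> V \<Longrightarrow> b z x = 0) \<Longrightarrow> x = 0"
  shows "\<exists>z\<in>V. \<forall>e\<in>E. b z e = \<phi> e"
  using E nd
proof (induction E arbitrary: \<phi> rule: finite_induct)
  case empty
  then show ?case using subspace_0[OF sub] by blast
next
  case (insert e E)
  have mem [simp]: "x + y \<in> V" "scale c x \<in> V" "x - y \<in> V" if "x \<in> V" "y \<in> V" for x y c
    using that sub by (auto intro: subspace_add subspace_scale subspace_diff)
  have b_lin [simp]: "b (x + y) z = b x z + b y z" "b (scale c x) z = c * b x z"
    "b z (x + y) = b z x + b z y" "b z (scale c x) = c * b z x" if "x \<in> V" "y \<in> V" "z \<in> V" for x y z c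
    using that B by (auto simp: bilinear_on_def linear_on_def)
  have b_diff [simp]: "b (x - y) z = b x z - b y z" "b z (x - y) = b z x - b z y"
    if "x \<in> V" "y \<in> V" "z \<in> V" for x y z
    using b_lin(1)[of "x - y" y z] b_lin(3)[of "x - y" y z] that by (auto simp del: b_lin)
  have b_0 [simp]: "b 0 z = 0" "b z 0 = 0" if "z \<in> V" for z
    using b_diff[of z z z] that by simp_all
  have sum_mem [simp]: "(\<Sum>i\<in>F. scale (c i) (f i)) \<in> V" if "\<And>i. i \<in> F \<Longrightarrow> f i \<in> V" for F c and f :: "'b \<Rightarrow> 'b"
    using that sub by (auto intro!: subspace_sum subspace_scale)
  have b_sum: "b (\<Sum>i\<in>F. scale (c i) (f i)) z = (\<Sum>i\<in>F. c i * b (f i) z)"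
    "b z (\<Sum>i\<in>F. scale (c i) (f i)) = (\<Sum>i\<in>F. c i * b z (f i))"
    if "\<And>i. i \<in> F \<Longrightarrow> f i \<in> V" "z \<in> V" for F c z and f :: "'b \<Rightarrow> 'b"
    using that by (induction F rule: infinite_finite_induct) auto
  have E: "independent E" "E \<subseteq> V" "e \<in> V" "e \<notin> span E"
    using insert.prems insert.hyps by (auto simp: independent_insert)
  have ndE: "x = 0" if "x \<in> span E" "\<And>z. z \<in> V \<Longrightarrow> b z x = 0" for x
    using that insert.prems(3) span_mono[of E "insert e E"] by blast
  note IH = insert.IH[OF E(1,2) ndE]
  have "\<exists>z\<in>V. \<forall>e''\<in>E. b z e'' = (if e'' = e' then 1 else 0)" for e' by (rule IH)
  then obtain d where d: "\<And>e'. d e' \<in> V" "\<And>e' e''. e'' \<in> E \<Longrightarrow> b (d e') e'' = (if e'' = e' then 1 else 0)"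
    by metis
  define e0 where "e0 = e - (\<Sum>e'\<in>E. scale (b (d e') e) e')"
  have "(\<Sum>e'\<in>E. scale (b (d e') e) e') \<in> span E"
    by (intro span_sum span_scale span_base)
  then have "e0 \<in> span (insert e E)" "e0 \<noteq> 0"
    using E(4) span_mono[of E "insert e E"] span_base[of e "insert e E"]
    by (auto simp: e0_def intro: span_diff)
  then obtain z0 where z0: "z0 \<in> V" "b z0 e0 \<noteq> 0" using insert.prems(3) by blast
  \<comment> \<open>Subtracting along the dual family makes z0 vanish on E. The value at e becomes
    \<open>b z0 e0\<close>, because correcting z0 on the left or e on the right removes the same
    terms.\<close>
  define z1 where "z1 = z0 - (\<Sum>e'\<in>E. scale (b z0 e') (d e'))"
  have EV: "x \<in> V" if "x \<in> E" for x using that E by blast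
  have z1: "z1 \<in> V" unfolding z1_def using z0 d by simp
  have "b z1 e'' = 0" if "e'' \<in> E" for e''
    using z0 d(1) that EV insert.hyps by (simp add: z1_def b_sum d(2) if_distrib sum.delta cong: if_cong)
  moreover have "b z1 e = b z0 e0"
    using z0 d(1) EV E(3) by (simp add: z1_def e0_def b_sum mult.commute)
  moreover obtain z2 where z2: "z2 \<in> V" "\<forall>e\<in>E. b z2 e = \<phi> e" using IH by blast
  ultimately have "\<forall>e'\<in>insert e E. b (z2 + scale ((\<phi> e - b z2 e) / b z0 e0) z1) e' = \<phi> e'"
    using z1 z0 EV E(3) by simp
  moreover have "z2 + scale ((\<phi> e - b z2 e) / b z0 e0) z1 \<in> V" using z1 z2 by simp
  ultimately show ?case by blast
qed

text \<open>Nondegeneracy is asked of U against all of V, so that U may be totally isotropic, as the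
  Lagrangian in \<open>lagrangian_splitting_isometric\<close> is.\<close>

lemma bilinear_represent:
  assumes fd: "fd_space scale V" and B: "bilinear_on scale V b"
    and U: "subspace U" "U \<subseteq> V" and \<phi>: "linear_on scale (*) U \<phi>"
    and nd: "\<And>x. x \<in> U \<Longrightarrow> (\<And>z. z \<in> V \<Longrightarrow> b z x = 0) \<Longrightarrow> x = 0"
  obtains z where "z \<in> V" "\<And>x. x \<in> U \<Longrightarrow> b z x = \<phi> x"
proof -
  have sub: "subspace V" using fd by (rule fd_space_subspace)
  obtain C where C: "C \<subseteq> U" "independent C" "U \<subseteq> span C"
    using maximal_independent_subset by metis
  obtain B0 where B0: "finite B0" "span B0 = V" using fd by (auto simp: fd_space_def)
  have fin: "finite C" using independent_span_bound[OF B0(1) C(2)] B0 C U by auto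
  have UC: "span C = U" using C U span_minimal by blast
  have "\<exists>z\<in>V. \<forall>e\<in>C. b z e = \<phi> e"
    by (rule bilinear_represent_values[OF sub B fin C(2)]) (use C U UC nd in auto)
  then obtain z where z: "z \<in> V" "\<forall>e\<in>C. b z e = \<phi> e" by blast
  have bz: "linear_on scale (*) V (b z)" using B z by (simp add: bilinear_on_def)
  have "b z x = \<phi> x" if "x \<in> U" for x
  proof -
    have "x \<in> span C" using that UC by simp
    then have "x \<in> U \<and> b z x = \<phi> x"
    proof (induction x rule: span_induct_alt)
      case base
      have "0 \<in> U" using U by (simp add: subspace_0)
      then have "b z (scale 0 0) = 0 * b z 0" "\<phi> (scale 0 0) = 0 * \<phi> 0"
        using bz \<phi> U by (auto simp only: linear_on_def)
      then show ?case using \<open>0 \<in> U\<close> by simp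
    next
      case (step c e x)
      have "e \<in> U" "x \<in> U" using step UC C by auto
      moreover have "scale c e \<in> U" using U \<open>e \<in> U\<close> by (simp add: subspace_scale)
      ultimately have "b z (scale c e + x) = c * b z e + b z x" "\<phi> (scale c e + x) = c * \<phi> e + \<phi> x"
        using bz \<phi> U by (auto simp: linear_on_def subset_eq)
      moreover have "scale c e + x \<in> U" using U \<open>x \<in> U\<close> \<open>scale c e \<in> U\<close> by (simp add: subspace_add)
      ultimately show ?case using step z by simp
    qed
    then show ?thesis ..
  qed
  then show thesis using that z by blast
qed

end

section \<open>Polynomials in an endomorphism\<close>

locale endo_space = vector_space s for s :: "'a::field \<Rightarrow> 'v::ab_group_add \<Rightarrow> 'v" (infixr "*s" 75) +
  fixes V u
  assumes sub: "subspace V" and endo: "endo_on s V u"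
begin

lemma mem [simp]:
  "0 \<in> V" "x \<in> V \<Longrightarrow> y \<in> V \<Longrightarrow> x + y \<in> V" "x \<in> V \<Longrightarrow> y \<in> V \<Longrightarrow> x - y \<in> V"
  "x \<in> V \<Longrightarrow> c *s x \<in> V" "x \<in> V \<Longrightarrow> - x \<in> V" "x \<in> V \<Longrightarrow> u x \<in> V"
  using sub endo by (auto intro: subspace_0 subspace_add subspace_diff subspace_scale subspace_neg
      simp: endo_on_def)

lemma endo_lin:
  "x \<in> V \<Longrightarrow> y \<in> V \<Longrightarrow> u (x + y) = u x + u y" "x \<in> V \<Longrightarrow> u (c *s x) = c *s u x"
  using endo by (auto simp: endo_on_def linear_on_def)

lemma endo_0: "u 0 = 0"
  using endo_lin(2)[of 0 0, OF mem(1)] by simp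

lemma endo_neg: "x \<in> V \<Longrightarrow> u (- x) = - u x"
  using endo_lin(2)[of x "-1"] by simp

lemma endo_diff: "x \<in> V \<Longrightarrow> y \<in> V \<Longrightarrow> u (x - y) = u x - u y"
  using endo_lin(1)[of x "- y"] by (simp add: endo_neg)

lemma funpow_mem [simp]: "x \<in> V \<Longrightarrow> (u ^^ i) x \<in> V"
  by (induction i) auto

abbreviation pe :: "'a poly \<Rightarrow> 'v \<Rightarrow> 'v" where "pe f \<equiv> poly_endo s f u"

lemma pe_0 [simp]: "pe 0 x = 0"
  by (simp add: poly_endo_def)

lemma pe_pCons:
  assumes "x \<in> V"
  shows "pe (pCons c f) x = c *s x + u (pe f x)"
proof -
  have "pe (pCons c f) x = (\<Sum>i\<le>Suc (Polynomial.degree f). poly.coeff (pCons c f) i *s (u ^^ i) x)"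
    unfolding poly_endo_def by (rule sum.mono_neutral_left) (auto simp: coeff_eq_0 degree_pCons_le)
  also have "\<dots> = c *s x + (\<Sum>i\<le>Polynomial.degree f. poly.coeff f i *s u ((u ^^ i) x))"
    by (subst sum.atMost_Suc_shift) simp
  also have "(\<Sum>i\<le>n. poly.coeff f i *s u ((u ^^ i) x)) = u (\<Sum>i\<le>n. poly.coeff f i *s (u ^^ i) x)" for n
  proof (induction n)
    case (Suc n)
    have "(\<Sum>i\<le>n. poly.coeff f i *s (u ^^ i) x) \<in> V"
      using assms by (intro subspace_sum[OF sub]) auto
    then show ?case using Suc assms by (simp add: endo_lin)
  qed (use assms in \<open>simp add: endo_lin\<close>)
  finally show ?thesis by (simp add: poly_endo_def)
qed

lemma pe_mem [simp]: "x \<in> V \<Longrightarrow> pe f x \<in> V"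
  by (induction f) (auto simp: pe_pCons)

lemma pe_add: "x \<in> V \<Longrightarrow> pe (f + g) x = pe f x + pe g x"
  by (induction f g rule: poly_induct2)
    (simp_all add: pe_pCons endo_lin scale_left_distrib algebra_simps)

lemma pe_smult: "x \<in> V \<Longrightarrow> pe (Polynomial.smult c f) x = c *s pe f x"
  by (induction f) (simp_all add: pe_pCons endo_lin scale_right_distrib)

lemma pe_const [simp]: "x \<in> V \<Longrightarrow> pe [:c:] x = c *s x"
  by (simp add: pe_pCons endo_0)

lemma pe_const_mult [simp]: "x \<in> V \<Longrightarrow> pe ([:c:] * f) x = c *s pe f x"
  by (simp add: pe_smult)

lemma pe_1 [simp]: "x \<in> V \<Longrightarrow> pe 1 x = x"
  unfolding one_pCons by simp

lemma pe_X [simp]: "x \<in> V \<Longrightarrow> pe [:0, 1:] x = u x"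
  by (simp add: pe_pCons endo_0)

lemma pe_neg: "x \<in> V \<Longrightarrow> pe (- f) x = - pe f x"
  using pe_smult[of x "-1" f] by simp

lemma pe_diff: "x \<in> V \<Longrightarrow> pe (f - g) x = pe f x - pe g x"
  using pe_add[of x f "- g"] by (simp add: pe_neg)

lemma pe_mult: "x \<in> V \<Longrightarrow> pe (f * g) x = pe f (pe g x)"
proof (induction f)
  case (pCons c f)
  have "pCons c f * g = Polynomial.smult c g + pCons 0 (f * g)" by simp
  then show ?case using pCons by (simp add: pe_add pe_smult pe_pCons del: mult_pCons_left)
qed simp

lemma pe_commute: "x \<in> V \<Longrightarrow> pe f (pe g x) = pe g (pe f x)"
  by (simp add: pe_mult[symmetric] mult.commute)

lemma pe_endo: "x \<in> V \<Longrightarrow> pe f (u x) = u (pe f x)"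
  using pe_commute[of x f "[:0, 1:]"] by simp

lemma pe_lin:
  "x \<in> V \<Longrightarrow> y \<in> V \<Longrightarrow> pe f (x + y) = pe f x + pe f y" "x \<in> V \<Longrightarrow> pe f (c *s x) = c *s pe f x"
  by (induction f; simp add: pe_pCons endo_lin scale_right_distrib algebra_simps)+

lemma pe_zero [simp]: "pe f 0 = 0"
  using pe_lin(2)[of 0 f 0, OF mem(1)] by simp

lemma pe_arg_neg: "x \<in> V \<Longrightarrow> pe f (- x) = - pe f x"
  using pe_lin(2)[of x f "-1"] by simp

lemma pe_arg_diff: "x \<in> V \<Longrightarrow> y \<in> V \<Longrightarrow> pe f (x - y) = pe f x - pe f y"
  using pe_lin(1)[of x "- y" f] by (simp add: pe_arg_neg)

lemma pe_monom: "x \<in> V \<Longrightarrow> pe (Polynomial.monom c i) x = c *s (u ^^ i) x"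
  by (induction i) (simp_all add: monom_0 monom_Suc pe_pCons endo_lin endo_0)

lemma pe_sum: "x \<in> V \<Longrightarrow> pe (\<Sum>i\<in>I. f i) x = (\<Sum>i\<in>I. pe (f i) x)"
  by (induction I rule: infinite_finite_induct) (auto simp: pe_add)

lemma pe_dvd: "x \<in> V \<Longrightarrow> pe f x = 0 \<Longrightarrow> f dvd g \<Longrightarrow> pe g x = 0"
  by (auto simp: dvd_def mult.commute[of f] pe_mult)

lemma pe_coprime:
  assumes "x \<in> V" "pe f x = 0" "pe g x = 0" "k * f + l * g = 1"
  shows "x = 0"
proof -
  have "x = pe (k * f + l * g) x" using assms by simp
  also have "\<dots> = 0" using assms(1-3) by (simp add: pe_add pe_mult)
  finally show ?thesis .
qed

text \<open>A dependence among the iterates of each vector of a finite spanning set gives a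
  polynomial that kills it, and the product of these polynomials kills V.\<close>

lemma exists_annihilating_poly:
  assumes "fd_space s V"
  obtains f where "f \<noteq> 0" "\<And>x. x \<in> V \<Longrightarrow> pe f x = 0"
proof -
  obtain B where B: "finite B" "span B = V" using assms by (auto simp: fd_space_def)
  have "\<exists>f. f \<noteq> 0 \<and> pe f x = 0" if x: "x \<in> V" for x
  proof -
    have "(\<lambda>i. (u ^^ i) x) ` {..card B} \<subseteq> span B" using x B(2) funpow_mem by blast
    moreover have "card B < card {..card B}" by simp
    ultimately obtain c i where
      c: "(\<Sum>i\<le>card B. c i *s (u ^^ i) x) = 0" "i \<in> {..card B}" "c i \<noteq> 0"
      using dependent_family[OF B(1) finite_atMost] by blast
    let ?f = "\<Sum>i\<le>card B. Polynomial.monom (c i) i"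
    have "poly.coeff ?f i = c i" using c(2) by (simp add: coeff_sum)
    then have "?f \<noteq> 0" using c(3) by (metis coeff_0)
    moreover have "pe ?f x = 0" using c x by (simp add: pe_sum pe_monom)
    ultimately show ?thesis by blast
  qed
  then obtain F where F: "\<And>x. x \<in> V \<Longrightarrow> F x \<noteq> 0 \<and> pe (F x) x = 0" by metis
  have BV: "x \<in> V" if "x \<in> B" for x using B that span_base by blast
  define f where "f = (\<Prod>x\<in>B. F x)"
  have "pe f x = 0" if "x \<in> V" for x
  proof -
    have "x \<in> span B" using that B by simp
    then have "x \<in> V \<and> pe f x = 0"
    proof (induction x rule: span_induct_alt)
      case (step c b x)
      have "pe f b = 0" using dvd_prodI[OF B(1) step(1), of F] F[OF BV[OF step(1)]] BV[OF step(1)] pe_dvd[of b "F b" f]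
        by (simp add: f_def)
      moreover have "b \<in> V" "x \<in> V" using step BV by auto
      ultimately show ?case using step(2) by (simp add: pe_lin)
    qed simp
    then show ?thesis ..
  qed
  moreover have "f \<noteq> 0" using B(1) BV F by (simp add: f_def)
  ultimately show thesis using that by blast
qed

section \<open>Cyclic subspaces and companion matrices\<close>

definition cyc :: "'v \<Rightarrow> 'v set" where "cyc y = range (\<lambda>f. pe f y)"

lemma cyc_subspace: "y \<in> V \<Longrightarrow> subspace (cyc y)"
proof (rule subspaceI)
  assume y: "y \<in> V"
  show "0 \<in> cyc y" unfolding cyc_def by (metis pe_0 rangeI)
  fix a b c assume "a \<in> cyc y" "b \<in> cyc y"
  then obtain f g where "a = pe f y" "b = pe g y" by (auto simp: cyc_def)
  then have "a + b = pe (f + g) y" "c *s a = pe (Polynomial.smult c f) y"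
    using y by (simp_all add: pe_add pe_smult)
  then show "a + b \<in> cyc y" "c *s a \<in> cyc y" by (auto simp: cyc_def)
qed

lemma cyc_subset: "y \<in> V \<Longrightarrow> cyc y \<subseteq> V"
  by (auto simp: cyc_def)

lemma cyc_endo: "y \<in> V \<Longrightarrow> endo_on s (cyc y) u"
proof -
  assume y: "y \<in> V"
  have "u z \<in> cyc y" if z: "z \<in> cyc y" for z
  proof -
    obtain f where "z = pe f y" using z by (auto simp: cyc_def)
    then have "u z = pe (pCons 0 f) y" using y by (simp add: pe_pCons)
    then show ?thesis by (simp add: cyc_def)
  qed
  moreover have "linear_on s s (cyc y) u"
    using cyc_subset[OF y] by (auto simp: linear_on_def subset_eq intro!: endo_lin)
  ultimately show ?thesis by (auto simp: endo_on_def)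
qed

definition poly_of :: "nat \<Rightarrow> (nat \<Rightarrow> 'a) \<Rightarrow> 'a poly" where
  "poly_of n c = (\<Sum>i<n. Polynomial.monom (c i) i)"

lemma coeff_poly_of: "i < n \<Longrightarrow> poly.coeff (poly_of n c) i = c i"
  by (simp add: poly_of_def coeff_sum)

lemma degree_poly_of: "0 < n \<Longrightarrow> Polynomial.degree (poly_of n c) < n"
  unfolding poly_of_def
  by (rule degree_sum_less) (auto intro: le_less_trans[OF degree_monom_le])

lemma pe_poly_of: "y \<in> V \<Longrightarrow> pe (poly_of n c) y = (\<Sum>i<n. c i *s (u ^^ i) y)"
  by (simp add: poly_of_def pe_sum pe_monom)

lemma poly_of_coeff:
  assumes "Polynomial.degree f < n"
  shows "poly_of n (poly.coeff f) = f"
proof (rule poly_eqI)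
  fix i show "poly.coeff (poly_of n (poly.coeff f)) i = poly.coeff f i"
    using assms by (cases "i < n") (auto simp: coeff_poly_of poly_of_def coeff_sum coeff_eq_0)
qed

lemma poly_of_plus_top:
  assumes "Polynomial.lead_coeff P = 1"
  shows "poly_of (Polynomial.degree P) (poly.coeff P) + Polynomial.monom 1 (Polynomial.degree P) = P"
proof (rule poly_eqI)
  fix i show "poly.coeff (poly_of (Polynomial.degree P) (poly.coeff P)
      + Polynomial.monom 1 (Polynomial.degree P)) i = poly.coeff P i"
    using assms by (cases "i < Polynomial.degree P"; cases "i = Polynomial.degree P")
      (auto simp: poly_of_def coeff_sum coeff_eq_0)
qed

lemma pe_mod:
  assumes "y \<in> V" "pe P y = 0"
  shows "pe (f mod P) y = pe f y"
proof -
  have "pe f y = pe (f div P * P + f mod P) y" by simp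
  also have "\<dots> = pe (f mod P) y" by (simp only: pe_add[OF assms(1)] pe_mult[OF assms(1)] assms(2) pe_zero add_0)
  finally show ?thesis by simp
qed

lemma companion_index:
  "i < Polynomial.degree P \<Longrightarrow> j < Polynomial.degree P \<Longrightarrow> companion P $$ (i, j) =
    (if j = Polynomial.degree P - 1 then - poly.coeff P i else if i = j + 1 then 1 else 0)"
  by (simp add: companion_def Let_def)

text \<open>The basis consists of the iterates of y below the degree of P. They are independent
  since no nonzero polynomial of smaller degree than P kills y, they span by reduction modulo P, and
  P(u) y = 0 gives the last column.\<close>

lemma represented_by_companion_cyc:
  assumes y: "y \<in> V" and P: "Polynomial.lead_coeff P = 1" "Polynomial.degree P > 0"
    and ann: "\<And>f. pe f y = 0 \<longleftrightarrow> P dvd f"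
  shows "represented_by s (cyc y) u (companion P)"
proof -
  let ?N = "Polynomial.degree P" and ?x = "\<lambda>i. (u ^^ i) y"
  define bs where "bs = map ?x [0..<?N]"
  have len: "length bs = ?N" and nth: "\<And>i. i < ?N \<Longrightarrow> bs ! i = ?x i" by (simp_all add: bs_def)
  have set: "set bs = ?x ` {..<?N}" by (auto simp: bs_def)
  have fam: "\<forall>i\<in>{..<?N}. c i = 0" if "(\<Sum>i<?N. c i *s ?x i) = 0" for c
  proof -
    have "P dvd poly_of ?N c" using that ann[of "poly_of ?N c"] y by (simp add: pe_poly_of)
    then have "poly_of ?N c = 0"
      using degree_poly_of[OF P(2), of c] dvd_imp_degree_le[of P "poly_of ?N c"] by linarith
    then have "c i = 0" if "i < ?N" for i using coeff_poly_of[OF that, of c] by simp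
    then show ?thesis by simp
  qed
  note ind = family_independent[OF finite_lessThan fam]
  have "distinct bs" using ind(1) by (simp add: bs_def distinct_map atLeast0LessThan)
  moreover have "independent (set bs)" using ind(2) set by simp
  moreover have "span (set bs) = cyc y"
  proof
    have "?x i \<in> cyc y" for i using pe_monom[OF y, of 1 i] by (auto simp: cyc_def image_iff intro: exI[of _ "Polynomial.monom 1 i"])
    then show "span (set bs) \<subseteq> cyc y" using set cyc_subspace[OF y] by (intro span_minimal) auto
    show "cyc y \<subseteq> span (set bs)"
    proof
      fix z assume "z \<in> cyc y"
      then obtain f where f: "z = pe f y" by (auto simp: cyc_def)
      have "pe P y = 0" using ann by simp
      then have "z = pe (f mod P) y" using f y pe_mod by simp
      also have "f mod P = poly_of ?N (poly.coeff (f mod P))"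
        using degree_mod_less[of P f] P(2) by (subst poly_of_coeff) (cases "P = 0"; auto)+
      also have "pe \<dots> y \<in> span (set bs)"
        using y set by (auto simp: pe_poly_of intro!: span_sum span_scale intro: span_base)
      finally show "z \<in> span (set bs)" .
    qed
  qed
  moreover have "companion P \<in> carrier_mat (length bs) (length bs)"
    by (simp add: companion_def Let_def len)
  moreover have "u (bs ! j) = (\<Sum>i<length bs. companion P $$ (i, j) *s (bs ! i))" if j: "j < length bs" for j
  proof (cases "j = ?N - 1")
    case False
    then have j': "Suc j < ?N" using j len by simp
    have "(\<Sum>i<length bs. companion P $$ (i, j) *s (bs ! i))
        = (\<Sum>i<?N. if i = Suc j then bs ! i else 0)"
      using False j len by (intro sum.cong) (auto simp: companion_index)
    also have "\<dots> = u (bs ! j)" using j' by (simp add: nth)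
    finally show ?thesis by simp
  next
    case True
    have "pe (poly_of ?N (poly.coeff P) + Polynomial.monom 1 ?N) y = 0"
      unfolding poly_of_plus_top[OF P(1)] using ann by simp
    then have "(\<Sum>i<?N. poly.coeff P i *s ?x i) + (u ^^ ?N) y = 0"
      using y by (simp add: pe_add pe_poly_of pe_monom)
    then have "(u ^^ ?N) y = - (\<Sum>i<?N. poly.coeff P i *s ?x i)" by (simp only: add_eq_0_iff)
    moreover have "u (bs ! j) = (u ^^ ?N) y"
      using True P(2) nth[of j] by (cases ?N) auto
    moreover have "(\<Sum>i<length bs. companion P $$ (i, j) *s (bs ! i)) = (\<Sum>i<?N. - (poly.coeff P i *s ?x i))"
      using True j len by (intro sum.cong) (auto simp: companion_index nth)
    ultimately show ?thesis by (simp add: sum_negf)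
  qed
  ultimately show ?thesis unfolding represented_by_def by blast
qed

text \<open>The subdiagonal of ones forces the j-th basis vector to be the j-th iterate of the first
  one, which is therefore a cyclic vector; the last column then says that P(u) kills it.\<close>

lemma represented_by_companion_imp_cyc:
  assumes P: "Polynomial.lead_coeff P = 1" "Polynomial.degree P > 0"
    and rep: "represented_by s V u (companion P)"
  obtains y where "y \<in> V" "cyc y = V" "\<And>f. pe f y = 0 \<longleftrightarrow> P dvd f"
proof -
  let ?N = "Polynomial.degree P"
  obtain bs where bs: "distinct bs" "independent (set bs)" "span (set bs) = V"
    "companion P \<in> carrier_mat (length bs) (length bs)"
    "\<And>j. j < length bs \<Longrightarrow> u (bs ! j) = (\<Sum>i<length bs. companion P $$ (i, j) *s (bs ! i))"
    using rep by (auto simp: represented_by_def)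
  have len: "length bs = ?N" using carrier_matD(1)[OF bs(4)] by (simp add: companion_def Let_def)
  let ?y = "bs ! 0"
  have y: "?y \<in> V" using span_base[of ?y "set bs"] bs(3) len P by simp
  have pow: "(u ^^ j) ?y = bs ! j" if "j < ?N" for j
    using that
  proof (induction j)
    case (Suc j)
    have "(u ^^ Suc j) ?y = u (bs ! j)" using Suc by simp
    also have "\<dots> = (\<Sum>i<?N. companion P $$ (i, j) *s (bs ! i))"
      using bs(5)[of j] Suc.prems len by simp
    also have "\<dots> = (\<Sum>i<?N. if i = Suc j then bs ! i else 0)"
      using Suc.prems by (intro sum.cong) (auto simp: companion_index)
    also have "\<dots> = bs ! Suc j" using Suc by simp
    finally show ?case .
  qed simp
  have "(u ^^ ?N) ?y = u (bs ! (?N - 1))"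
    using pow[of "?N - 1"] P(2) by (cases ?N) auto
  also have "\<dots> = (\<Sum>i<?N. companion P $$ (i, ?N - 1) *s (bs ! i))"
    using bs(5)[of "?N - 1"] P(2) len by simp
  also have "\<dots> = (\<Sum>i<?N. - (poly.coeff P i *s (u ^^ i) ?y))"
    using P(2) by (intro sum.cong) (auto simp: companion_index pow)
  finally have top: "(u ^^ ?N) ?y = - (\<Sum>i<?N. poly.coeff P i *s (u ^^ i) ?y)"
    by (simp add: sum_negf)
  have "pe P ?y = pe (poly_of ?N (poly.coeff P) + Polynomial.monom 1 ?N) ?y"
    unfolding poly_of_plus_top[OF P(1)] ..
  also have "\<dots> = 0" using y by (simp add: pe_add pe_poly_of pe_monom top)
  finally have Py: "pe P ?y = 0" .
  have "P dvd f" if "pe f ?y = 0" for f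
  proof -
    have deg: "Polynomial.degree (f mod P) < ?N"
      using degree_mod_less[of P f] P(2) by (cases "P = 0") auto
    have "pe (poly_of ?N (poly.coeff (f mod P))) ?y = 0"
      using that y Py deg by (simp add: poly_of_coeff pe_mod)
    then have 0: "(\<Sum>i<length bs. poly.coeff (f mod P) i *s (bs ! i)) = 0"
      using y by (simp add: pe_poly_of pow len)
    have "poly.coeff (f mod P) i = 0" if "i < ?N" for i
      by (rule independent_list_coeffs[OF bs(1,2) 0]) (simp add: len that)
    then have "poly.coeff (f mod P) i = 0" for i
      using deg by (cases "i < ?N") (auto simp: coeff_eq_0)
    then have "f mod P = 0" by (simp add: poly_eq_iff)
    then show ?thesis by (simp add: mod_eq_0_iff_dvd)
  qed
  then have ann: "pe f ?y = 0 \<longleftrightarrow> P dvd f" for f using pe_dvd[OF y Py] by blast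
  have "set bs \<subseteq> cyc ?y"
  proof
    fix b assume "b \<in> set bs"
    then obtain i where "i < ?N" "b = bs ! i" using len by (metis in_set_conv_nth)
    then have "b = pe (Polynomial.monom 1 i) ?y" using y by (simp add: pe_monom pow)
    then show "b \<in> cyc ?y" by (simp add: cyc_def)
  qed
  then have "V \<subseteq> cyc ?y" using bs(3) cyc_subspace[OF y] by (metis span_minimal)
  then have "cyc ?y = V" using cyc_subset[OF y] by blast
  then show thesis using that y ann by blast
qed

end

lemma pe_intertwine:
  assumes "endo_space s V u" "endo_space t W w" "linear_on s t V f" "f ` V \<subseteq> W"
    and "\<And>x. x \<in> V \<Longrightarrow> f (u x) = w (f x)" and x: "x \<in> V"
  shows "f (poly_endo s h u x) = poly_endo t h w (f x)"
proof -
  interpret V: endo_space s V u by fact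
  interpret W: endo_space t W w by fact
  have lin: "f (x + y) = f x + f y" "f (s c x) = t c (f x)" if "x \<in> V" "y \<in> V" for x y c
    using that assms(3) by (auto simp: linear_on_def)
  have "f x \<in> W" using x assms(4) by blast
  have "f 0 = 0" using lin(2)[of 0 0 0] by simp
  then show ?thesis
    by (induction h) (use x \<open>f x \<in> W\<close> assms(5) lin in \<open>simp_all add: V.pe_pCons W.pe_pCons\<close>)
qed

section \<open>Bezout identities\<close>

lemma poly_bezout:
  fixes f g :: "'a::field poly"
  shows "\<exists>d k l. d = k * f + l * g \<and> d dvd f \<and> d dvd g"
\<comment> \<open>The value 0 is reserved for g = 0, so that the measure also drops from a nonzero
  constant g to the remainder 0.\<close>
proof (induction "if g = 0 then 0 else Suc (Polynomial.degree g)" arbitrary: f g rule: less_induct)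
  case less
  show ?case
  proof (cases "g = 0")
    case True
    then show ?thesis by (intro exI[of _ f] exI[of _ 1] exI[of _ 0]) simp
  next
    case False
    then have "f mod g = 0 \<or> Polynomial.degree (f mod g) < Polynomial.degree g"
      by (intro degree_mod_less) simp
    then have "\<exists>d k l. d = k * g + l * (f mod g) \<and> d dvd g \<and> d dvd f mod g"
      using False by (intro less) auto
    then obtain d k l where d: "d = k * g + l * (f mod g)" "d dvd g" "d dvd f mod g" by blast
    have "l * f = l * (f div g) * g + l * (f mod g)"
      unfolding mult.assoc distrib_left[symmetric] by simp
    then have "d = l * f + (k - l * (f div g)) * g" using d(1) by (simp only: left_diff_distrib) simp
    moreover have "d dvd f" using d(2,3) by (metis dvd_mod_iff)
    ultimately show ?thesis using d(2) by blast
  qed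
qed

text \<open>The common divisor d must be a unit: otherwise its cofactor e in r is one, so that r
  divides d and hence f.\<close>

lemma irreducible_bezout:
  fixes r f :: "'a::field poly"
  assumes "Factorial_Ring.irreducible r" "\<not> r dvd f"
  obtains k l where "k * r + l * f = 1"
proof -
  obtain d k l where d: "d = k * r + l * f" "d dvd r" "d dvd f" using poly_bezout by blast
  from d(2) obtain e where e: "r = d * e" by blast
  have "\<not> e dvd 1"
  proof
    assume "e dvd 1"
    then obtain e' where "1 = e * e'" by blast
    then have "d = r * e'" using e by (simp add: mult.assoc)
    then show False using d(3) assms(2) by (metis dvd_mult_left)
  qed
  then have "d dvd 1" using comm_semiring_1_class.irreducibleD[OF assms(1) e] by blast
  then obtain d' where "1 = d * d'" by blast
  then have "(d' * k) * r + (d' * l) * f = 1" using d(1) by (simp add: algebra_simps)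
  then show thesis using that by blast
qed

section \<open>Symplectic differences\<close>

lemma symplectic_form_antisym:
  assumes "symplectic_form s V b" "vector_space s" "Modules.module.subspace s V" "x \<in> V" "y \<in> V"
  shows "b x y = - b y x"
proof -
  interpret vector_space s by fact
  have "x + y \<in> V" using assms by (simp add: subspace_add)
  then have "b (x + y) (x + y) = 0" "b x x = 0" "b y y = 0"
    using assms by (simp_all add: symplectic_form_def)
  moreover have "bilinear_on s V b" using assms(1) by (simp add: symplectic_form_def)
  then have "b (x + y) (x + y) = b x x + b y x + (b x y + b y y)"
    using assms(4,5) \<open>x + y \<in> V\<close> by (simp add: bilinear_on_def linear_on_def)
  ultimately have "b y x + b x y = 0" by simp
  then show ?thesis by (simp add: add_eq_0_iff)
qed

text \<open>The relation \<open>a_u\<close> expresses \<open>q (a - u) = 0\<close>.\<close>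

locale sp_difference = endo_space s V u + quadratics \<tau> \<mu> \<alpha> \<beta>
  for s :: "'a::field \<Rightarrow> 'v::ab_group_add \<Rightarrow> 'v" (infixr "*s" 75) and V u and \<tau> \<mu> \<alpha> \<beta> :: 'a +
  fixes B a
  assumes fd: "fd_space s V" and form: "symplectic_form s V B"
    and alt_u: "alternating_endo s V B u" and alt_a: "alternating_endo s V B a"
    and a_a: "x \<in> V \<Longrightarrow> a (a x) = \<tau> *s a x - \<alpha> *s x"
    and a_u: "x \<in> V \<Longrightarrow> a (u x) = \<delta> *s a x - u (a x) + pe kap x"
begin

lemma endo_a: "endo_on s V a"
  using alt_a by (simp add: alternating_endo_def)

lemma a_mem [simp]: "x \<in> V \<Longrightarrow> a x \<in> V"
  using endo_a by (auto simp: endo_on_def)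

lemma a_lin: "x \<in> V \<Longrightarrow> y \<in> V \<Longrightarrow> a (x + y) = a x + a y" "x \<in> V \<Longrightarrow> a (c *s x) = c *s a x"
  using endo_a by (auto simp: endo_on_def linear_on_def)

lemma a_0: "a 0 = 0"
  using a_lin(2)[of 0 0, OF mem(1)] by simp

lemma a_diff: "x \<in> V \<Longrightarrow> y \<in> V \<Longrightarrow> a (x - y) = a x - a y"
  using a_lin(1)[of "x - y" y] by (simp add: algebra_simps)

lemma B_lin:
  assumes "x \<in> V" "y \<in> V" "z \<in> V"
  shows "B (x + y) z = B x z + B y z" "B (c *s x) z = c * B x z"
    "B z (x + y) = B z x + B z y" "B z (c *s x) = c * B z x"
  using assms form by (auto simp: symplectic_form_def bilinear_on_def linear_on_def)

lemma B_diff: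
  assumes "x \<in> V" "y \<in> V" "z \<in> V"
  shows "B (x - y) z = B x z - B y z" "B z (x - y) = B z x - B z y"
  using B_lin(1)[of "x - y" y z] B_lin(3)[of "x - y" y z] assms by simp_all

lemma B_0: "z \<in> V \<Longrightarrow> B 0 z = 0" "z \<in> V \<Longrightarrow> B z 0 = 0"
  using B_diff[of z z z] by simp_all

lemma B_self: "x \<in> V \<Longrightarrow> B x x = 0"
  using form by (simp add: symplectic_form_def)

lemma B_nondegenerate: "x \<in> V \<Longrightarrow> (\<And>y. y \<in> V \<Longrightarrow> B x y = 0) \<Longrightarrow> x = 0"
  using form by (simp add: symplectic_form_def)

lemma B_antisym: "x \<in> V \<Longrightarrow> y \<in> V \<Longrightarrow> B x y = - B y x"
  by (rule symplectic_form_antisym[OF form vector_space_axioms sub])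

text \<open>Polarisation of B(z, w z) = 0 gives B(x, w y) + B(y, w x) = 0, and antisymmetry turns
  the second term into - B(w x, y).\<close>

lemma selfadjoint:
  assumes w: "alternating_endo s V B w" and xy: "x \<in> V" "y \<in> V"
  shows "B (w x) y = B x (w y)"
proof -
  have w_mem: "w z \<in> V" if "z \<in> V" for z using w that by (auto simp: alternating_endo_def endo_on_def)
  have w_add: "w (x + y) = w x + w y" using w xy by (simp add: alternating_endo_def endo_on_def linear_on_def)
  have alt: "B z (w z) = 0" if "z \<in> V" for z using w that by (simp add: alternating_endo_def)
  have "B (x + y) (w (x + y)) = 0" using alt xy by simp
  then have "B x (w y) + B y (w x) = 0"
    using xy alt by (simp add: w_add w_mem B_lin add.commute)
  then show ?thesis using B_antisym[of "w x" y] xy w_mem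
    by (simp add: add_eq_0_iff)
qed

lemmas selfadjoint_a = selfadjoint[OF alt_a] and selfadjoint_u = selfadjoint[OF alt_u]

lemma selfadjoint_pe:
  assumes "x \<in> V" "y \<in> V"
  shows "B (pe f x) y = B x (pe f y)"
  using assms(2)
  by (induction f arbitrary: y) (simp_all add: assms(1) pe_pCons B_lin B_0 selfadjoint_u pe_endo)

text \<open>Self-adjointness and antisymmetry alone would give 2 B(x, f(u) x) = 0, which is empty in
  characteristic 2. Moving half of each power of u to the left leaves B(z, z) or B(z, u z) with z =
  u^k x, and both vanish.\<close>

lemma pe_alternating:
  assumes "x \<in> V"
  shows "B x (pe f x) = 0"
proof -
  have swap: "B ((u ^^ i) x) y = B x ((u ^^ i) y)" if "y \<in> V" for i y
    using that
  proof (induction i arbitrary: y)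
    case (Suc i)
    then have "B ((u ^^ Suc i) x) y = B x ((u ^^ i) (u y))" using assms by (simp add: selfadjoint_u)
    then show ?case by (simp add: funpow_swap1)
  qed simp
  have pow: "B x ((u ^^ i) x) = 0" for i
  proof -
    consider k where "i = k + k" | k where "i = k + Suc k"
      by (metis evenE oddE add_Suc_right mult_2 Suc_eq_plus1)
    then show ?thesis
    proof cases
      case 1
      then have "B x ((u ^^ i) x) = B ((u ^^ k) x) ((u ^^ k) x)"
        using assms by (simp add: swap funpow_add)
      then show ?thesis using assms by (simp add: B_self)
    next
      case 2
      then have "B x ((u ^^ i) x) = B ((u ^^ k) x) (u ((u ^^ k) x))"
        using assms by (simp only: swap mem funpow_mem funpow_add o_apply funpow.simps)
      then show ?thesis using assms alt_u by (simp add: alternating_endo_def)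
    qed
  qed
  have "B x (\<Sum>i\<in>I. c i *s (u ^^ i) x) = (\<Sum>i\<in>I. c i * B x ((u ^^ i) x))" for c and I :: "nat set"
  proof (induction I rule: infinite_finite_induct)
    case (insert i I)
    have "(\<Sum>i\<in>I. c i *s (u ^^ i) x) \<in> V" using assms by (intro subspace_sum[OF sub]) simp
    then show ?case using insert assms by (simp add: B_lin)
  qed (use assms in \<open>simp_all add: B_0\<close>)
  then show ?thesis by (simp add: poly_endo_def pow)
qed

text \<open>Passing a through one factor u by \<open>a_u\<close> reproduces the recursions
  \<open>reflect_pCons\<close> and \<open>ddiff_pCons\<close>, which identifies the inhomogeneous
  term as kap times the divided difference.\<close>

lemma a_pe:
  assumes "x \<in> V"
  shows "a (pe f x) = pe (reflect \<delta> f) (a x) + pe (kap * ddiff \<delta> f) x"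
proof (induction f)
  case 0
  show ?case by (simp add: a_0 reflect_hom)
next
  case (pCons c f)
  have X: "pe [:\<delta>, -1:] z = \<delta> *s z - u z" if "z \<in> V" for z
    using that by (simp add: pe_pCons endo_neg endo_0 endo_lin)
  let ?z = "pe f x"
  have "a (pe (pCons c f) x) = c *s a x + (\<delta> *s a ?z - u (a ?z)) + pe kap ?z"
    using assms by (simp add: pe_pCons a_lin a_u)
  also have "\<delta> *s a ?z - u (a ?z) = pe [:\<delta>, -1:] (a ?z)" using assms by (simp add: X)
  also have "\<dots> = pe ([:\<delta>, -1:] * reflect \<delta> f) (a x) + pe (kap * ([:\<delta>, -1:] * ddiff \<delta> f)) x"
    unfolding pCons.IH mult.left_commute[of kap]
    using assms by (simp only: pe_lin pe_mem a_mem pe_mult)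
  also have "pe kap ?z = pe (kap * f) x" using assms by (simp only: pe_mult)
  finally show ?case
    unfolding reflect_pCons ddiff_pCons distrib_left
    using assms by (simp only: pe_add pe_const a_mem pe_mem add_ac)
qed

lemma a_pe_qmap: "x \<in> V \<Longrightarrow> a (pe (pcompose h (qmap \<delta>)) x) = pe (pcompose h (qmap \<delta>)) (a x)"
  by (simp add: a_pe)

text \<open>For z = f(u) y, the vector (reflect f)(u) a y differs from a z by a polynomial in u
  applied to y. Pairing z with a z gives 0 because a is alternating, and pairing it with the
  correction gives 0 by \<open>pe_alternating\<close>.\<close>

lemma form_norm:
  assumes y: "y \<in> V"
  shows "B y (pe (f * reflect \<delta> f) (a y)) = 0"
proof -
  have "B y (pe (f * reflect \<delta> f) (a y)) = B (pe f y) (pe (reflect \<delta> f) (a y))"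
    using y by (simp add: pe_mult selfadjoint_pe)
  also have "pe (reflect \<delta> f) (a y) = a (pe f y) - pe (kap * ddiff \<delta> f) y"
    using y by (simp add: a_pe)
  also have "B (pe f y) \<dots> = - B y (pe (f * (kap * ddiff \<delta> f)) y)"
    using y alt_a by (simp add: B_diff alternating_endo_def selfadjoint_pe pe_mult[of _ f])
  also have "\<dots> = 0" using y by (simp only: pe_alternating) simp
  finally show ?thesis .
qed

text \<open>Up to sign, every power of \<open>t^2 - \<delta> t\<close> is a norm \<open>f * reflect \<delta> f\<close>.\<close>

lemma form_pcompose_qmap:
  assumes y: "y \<in> V"
  shows "B y (pe (pcompose h (qmap \<delta>)) (a y)) = 0"
proof -
  have refl: "reflect \<delta> (qmap \<delta> ^ j) = qmap \<delta> ^ j" for j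
    by (induction j) (simp_all add: reflect_hom)
  have pow: "B y (pe (qmap \<delta> ^ k) (a y)) = 0" for k
  proof -
    consider j where "k = j + j" | j where "k = Suc (j + j)"
      by (metis evenE oddE mult_2 Suc_eq_plus1)
    then show ?thesis
    proof cases
      case 1
      then show ?thesis using form_norm[OF y, of "qmap \<delta> ^ j"] by (simp add: refl power_add)
    next
      case 2
      have "(qmap \<delta> ^ j * [:0, 1:]) * reflect \<delta> (qmap \<delta> ^ j * [:0, 1:])
          = qmap \<delta> ^ (j + j) * ([:0, 1:] * reflect \<delta> [:0, 1:])"
        unfolding reflect_hom refl power_add by (simp only: ac_simps)
      also have "[:0, 1:] * reflect \<delta> [:0, 1:] = - qmap \<delta>"
        by (simp add: reflect_def pcompose_pCons qmap_def)
      also have "qmap \<delta> ^ (j + j) * - qmap \<delta> = - (qmap \<delta> ^ k)"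
        unfolding 2 power_Suc2 by (rule mult_minus_right)
      finally have "(qmap \<delta> ^ j * [:0, 1:]) * reflect \<delta> (qmap \<delta> ^ j * [:0, 1:]) = - (qmap \<delta> ^ k)" .
      then show ?thesis using form_norm[OF y, of "qmap \<delta> ^ j * [:0, 1:]"] y
        B_lin(4)[of "pe (qmap \<delta> ^ k) (a y)" _ y "-1"] by (simp add: pe_neg)
    qed
  qed
  \<comment> \<open>Generalised over k because peeling a coefficient off h leaves one more factor
    \<open>qmap \<delta>\<close>.\<close>
  have "B y (pe (qmap \<delta> ^ k * pcompose h (qmap \<delta>)) (a y)) = 0" for k
  proof (induction h arbitrary: k)
    case (pCons c h)
    have "qmap \<delta> ^ k * pcompose (pCons c h) (qmap \<delta>)
        = [:c:] * qmap \<delta> ^ k + qmap \<delta> ^ Suc k * pcompose h (qmap \<delta>)"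
      unfolding pcompose_qmap_pCons power_Suc2 by (simp only: distrib_left mult.assoc mult.commute[of "[:c:]"])
    then show ?case using y pow pCons.IH[of "Suc k"]
      by (simp only: pe_add pe_const_mult a_mem B_lin pe_mem mem) simp
  qed (use y in \<open>simp add: B_0\<close>)
  from this[of 0] show ?thesis by simp
qed

text \<open>E is N(u) a - kap(u) with N = 2t - \<delta>. Moving a past both coefficients gives a E =
  kap(u) a + (\<alpha> N - \<tau> kap)(u), and in N(u) a E - kap(u) E the two terms containing a
  cancel.\<close>

lemma commutator_twice:
  assumes z: "z \<in> V"
  defines "E \<equiv> \<lambda>z. u (a z) - a (u z)"
  shows "E (E z) = pe rdpoly z"
proof -
  define N where "N = [:-\<delta>, 2:]"
  have "pe N z = u z + u z - \<delta> *s z" if "z \<in> V" for z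
    using that scale_left_distrib[of 1 1 "u z"] by (simp add: N_def pe_pCons endo_0 endo_lin)
  then have E: "E z = pe N (a z) - pe kap z" if "z \<in> V" for z
    using that by (simp add: E_def a_u)
  have rN: "reflect \<delta> N = - N" and dN: "ddiff \<delta> N = [:1:] + [:1:]"
    by (simp_all add: N_def reflect_def pcompose_pCons)
  have rk: "reflect \<delta> kap = kap - [:\<tau>:] * N" by (simp add: reflect_kap N_def)
  have dist: "pe ([:c:] * f) x = c *s pe f x" "pe (f * [:c:]) x = c *s pe f x" if "x \<in> V" for c f x
    using that by (simp_all add: pe_smult)
  have "a (E z) = pe (- N) (\<tau> *s a z - \<alpha> *s z) + pe (kap * ([:1:] + [:1:])) (a z)
      - (pe (kap - [:\<tau>:] * N) (a z) + pe (kap * [:\<tau>:]) z)"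
    using z by (simp only: E a_diff pe_mem a_mem a_pe a_a rN dN rk ddiff_kap)
  also have "\<dots> = pe kap (a z) + pe ([:\<alpha>:] * N - kap * [:\<tau>:]) z"
    unfolding distrib_left using z
    by (simp only: pe_arg_diff pe_lin pe_add pe_diff pe_neg dist a_mem mem) (simp add: algebra_simps)
  finally have aE: "a (E z) = pe kap (a z) + pe ([:\<alpha>:] * N - kap * [:\<tau>:]) z" .
  have "E z \<in> V" using z by (simp add: E)
  then have "E (E z) = pe N (a (E z)) - pe kap (pe N (a z) - pe kap z)" using E z by simp
  also have "\<dots> = pe (N * ([:\<alpha>:] * N - kap * [:\<tau>:]) + kap * kap) z"
    unfolding aE using z
    by (simp only: pe_lin pe_arg_diff pe_add pe_mult pe_mem a_mem pe_commute[of "a z" N kap]) simp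
  also have "N * ([:\<alpha>:] * N - kap * [:\<tau>:]) + kap * kap = rdpoly"
    unfolding rdpoly_def N_def[symmetric] right_diff_distrib by (simp only: ac_simps) simp
  finally show ?thesis .
qed

text \<open>With w = u^2 - \<delta> u, the hypothesis says that T = c(w) u a is alternating, hence
  self-adjoint. Its adjoint is c(w) a u, so c(w) kills the image of the commutator of u and a, and a
  fortiori that of its square, which is \<open>rdpoly\<close> at u.\<close>

lemma commutator_eq_0:
  assumes "\<And>y. y \<in> V \<Longrightarrow> B y (pe (pcompose c (qmap \<delta>) * [:0, 1:]) (a y)) = 0" and z: "z \<in> V"
  shows "pe (pcompose c (qmap \<delta>) * rdpoly) z = 0"
proof -
  let ?c = "pcompose c (qmap \<delta>)"
  define T where "T = (\<lambda>y. pe (?c * [:0, 1:]) (a y))"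
  have T: "T x = pe ?c (u (a x))" "T x \<in> V" if "x \<in> V" for x
    using that unfolding T_def by (simp_all only: pe_mult a_mem pe_X pe_mem mem)
  have T_add: "T (x + y) = T x + T y" if "x \<in> V" "y \<in> V" for x y
    unfolding T_def using that by (simp only: a_lin pe_lin a_mem)
  have alt: "B y (T y) = 0" if "y \<in> V" for y using assms(1) that by (simp add: T_def)
  have comm: "T z = pe ?c (a (u z))" if z: "z \<in> V" for z
  proof -
    let ?d = "T z - pe ?c (a (u z))"
    have "B ?d x = 0" if x: "x \<in> V" for x
    proof -
      have "B (x + z) (T x + T z) = 0" using alt[of "x + z"] x z by (simp only: T_add mem)
      then have "B x (T z) + B z (T x) = 0"
        using x z T(2) alt by (simp only: B_lin mem add_0 add_0_right add.commute)
      moreover have "B z (T x) = B (pe ?c (u z)) (a x)"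
        using x z T(1) by (simp add: selfadjoint_pe selfadjoint_u pe_endo)
      also have "\<dots> = B (pe ?c (a (u z))) x" using x z by (simp add: selfadjoint_a[symmetric] a_pe_qmap)
      finally show ?thesis using x z T(2) B_antisym[of "T z" x] by (simp add: B_diff add_eq_0_iff2)
    qed
    then have "?d = 0" using B_nondegenerate[of ?d] T(2) z by simp
    then show ?thesis by simp
  qed
  have E: "pe ?c (u (a x) - a (u x)) = 0" if "x \<in> V" for x
    using that comm T(1) by (simp add: pe_arg_diff)
  show ?thesis
    using z by (simp only: pe_mult commutator_twice[symmetric]) (simp add: E)
qed

section \<open>A generator of a non-degenerate submodule\<close>

text \<open>Since the functional f |-> B(y, f(u) a y) vanishes on F[w], its values on t F[w] decide.
  They define a functional on F[t]/(r^n), which is non-degenerate as soon as it does not vanish on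
  the ideal of r^(n - 1); the existence of a suitable vector comes from
  \<open>commutator_eq_0\<close>.\<close>

lemma exists_generator:
  assumes r: "Factorial_Ring.irreducible r" "k * pcompose r (qmap \<delta>) + l * rdpoly = 1"
    and S: "\<not> r dvd S" and n: "n \<ge> 1"
    and ann: "\<And>x. x \<in> V \<Longrightarrow> pe (pcompose (r ^ n * S) (qmap \<delta>)) x = 0"
    and nonzero: "x0 \<in> V" "pe (pcompose (r ^ (n - 1) * S) (qmap \<delta>)) x0 \<noteq> 0"
  obtains y where "y \<in> V" "pe (pcompose (r ^ n) (qmap \<delta>)) y = 0"
    "\<And>f. (\<And>g. B y (pe (f * g) (a y)) = 0) \<Longrightarrow> pcompose (r ^ n) (qmap \<delta>) dvd f"
proof -
  let ?W = "\<lambda>f. pcompose f (qmap \<delta>)"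
  let ?C = "r ^ (n - 1) * S"
  have rn: "r ^ n = r * r ^ (n - 1)" using n by (cases n) auto
  have "\<exists>x\<in>V. B x (pe (?W ?C * [:0, 1:]) (a x)) \<noteq> 0"
  proof (rule ccontr)
    assume *: "\<not> (\<exists>x\<in>V. B x (pe (?W ?C * [:0, 1:]) (a x)) \<noteq> 0)"
    have 1: "pe rdpoly (pe (?W ?C) x0) = 0"
      using commutator_eq_0[OF _ nonzero(1), of ?C] * nonzero(1) by (simp add: pe_mult pe_commute)
    have "pe (?W r) (pe (?W ?C) x0) = pe (?W (r ^ n * S)) x0"
      using nonzero(1) by (simp only: rn pcompose_mult mult.assoc pe_mult pe_mem)
    then have "pe (?W r) (pe (?W ?C) x0) = 0" using ann nonzero(1) by simp
    then show False using pe_coprime[OF _ _ 1 r(2)] nonzero by simp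
  qed
  then obtain x where x: "x \<in> V" "B x (pe (?W ?C * [:0, 1:]) (a x)) \<noteq> 0" by blast
  \<comment> \<open>g inverts S modulo r. Applying S(w) to x lands in the part killed by r^n(w) and
    puts two factors S into the functional; g compensates one of them, and l at g r^(n - 1) becomes
    the nonzero value found at x.\<close>
  obtain k' g where gS: "k' * r + g * S = 1" using irreducible_bezout[OF r(1) S] by blast
  define y where "y = pe (?W S) x"
  have y: "y \<in> V" using x by (simp add: y_def)
  have Py: "pe (?W (r ^ n)) y = 0" using ann[OF x(1)] x by (simp add: y_def pcompose_mult pe_mult)
  have Pay: "pe (?W (r ^ n)) (a y) = 0" using Py y a_pe_qmap[of y "r ^ n"] by (simp add: a_0)
  define l where "l h = B y (pe (?W h * [:0, 1:]) (a y))" for h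
  have l_add: "l (h + h') = l h + l h'" for h h'
    unfolding l_def using y by (simp only: pcompose_add distrib_right pe_add a_mem B_lin pe_mem)
  have l_rn: "l (r ^ n * h) = 0" for h
    unfolding l_def pcompose_mult using y Pay
    by (simp only: mult.commute[of "?W (r ^ n)"] mult.assoc pe_mult a_mem pe_zero B_0
        mult.left_commute[of _ "?W (r ^ n)"] pe_commute[of _ "?W (r ^ n)"] pe_mem)
  have "l (g * r ^ (n - 1)) \<noteq> 0"
  proof -
    have "l h = B x (pe (?W (S * h * S) * [:0, 1:]) (a x))" for h
    proof -
      have "l h = B x (pe (?W S) (pe (?W h * [:0, 1:]) (pe (?W S) (a x))))"
        unfolding l_def y_def using x(1) by (simp only: selfadjoint_pe a_pe_qmap pe_mem a_mem)
      also have "pe (?W S) (pe (?W h * [:0, 1:]) (pe (?W S) (a x)))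
          = pe (?W S * ((?W h * [:0, 1:]) * ?W S)) (a x)"
        using x(1) by (simp only: pe_mult pe_mem a_mem)
      also have "?W S * ((?W h * [:0, 1:]) * ?W S) = ?W (S * h * S) * [:0, 1:]"
        unfolding pcompose_mult by (simp only: ac_simps)
      finally show ?thesis .
    qed
    moreover have "S * (g * r ^ (n - 1)) * S = ?C + - k' * (r ^ n * S)"
    proof -
      have "S * (g * r ^ (n - 1)) * S = ?C * (g * S)" by (simp only: ac_simps)
      also have "g * S = 1 - k' * r" using gS by (simp add: algebra_simps)
      also have "?C * (1 - k' * r) = ?C + - k' * (r ^ n * S)" unfolding rn by (simp add: algebra_simps)
      finally show ?thesis .
    qed
    moreover have "pe (?W (- k' * (r ^ n * S)) * [:0, 1:]) (a x) = 0"
      unfolding pcompose_mult[of "- k'"] using ann x(1)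
      by (simp only: mult.commute[of _ "[:0, 1:]"] mult.assoc[symmetric] pe_mult a_mem pe_zero mem pe_mem)
    ultimately show ?thesis using x
      by (simp only: pcompose_add distrib_right pe_add a_mem B_lin pe_mem B_0) simp
  qed
  then have l_ne: "l (r ^ (n - 1) * g) \<noteq> 0" by (simp add: mult.commute)
  \<comment> \<open>Every nonzero ideal of F[t]/(r^n) contains r^(n - 1): if h = r^j m with j < n
    and r not dividing m, then r^(n - 1) g is a multiple of h modulo r^n, which contradicts
    \<open>l_ne\<close>.\<close>
  have dvd: "r ^ n dvd h" if h: "\<And>g. l (h * g) = 0" for h
  proof -
    have "r ^ j dvd h" if "j \<le> n" for j
      using that
    proof (induction j)
      case (Suc j)
      then have "r ^ j dvd h" by simp
      then obtain m where m: "h = r ^ j * m" by (rule dvdE)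
      have "r dvd m"
      proof (rule ccontr)
        assume "\<not> r dvd m"
        then obtain e e' where e: "e * r + e' * m = 1" using irreducible_bezout[OF r(1)] by blast
        have nj: "r ^ (n - 1) = r ^ (n - 1 - j) * r ^ j" using Suc.prems by (simp add: power_add[symmetric])
        have "r ^ (n - 1) * g = r ^ (n - 1) * g * (e * r + e' * m)" using e by simp
        also have "\<dots> = r ^ n * (g * e) + r ^ (n - 1) * g * e' * m"
          unfolding rn by (simp add: algebra_simps)
        also have "r ^ (n - 1) * g * e' * m = h * (r ^ (n - 1 - j) * g * e')"
          unfolding m nj by (simp only: ac_simps)
        finally have "l (r ^ (n - 1) * g) = 0" by (simp only: l_add l_rn h add_0)
        then show False using l_ne by simp
      qed
      then show ?case unfolding m power_Suc2 by (rule mult_dvd_mono[OF dvd_refl])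
    qed simp
    then show ?thesis by simp
  qed
  have "?W (r ^ n) dvd f" if f: "\<And>g. B y (pe (f * g) (a y)) = 0" for f
  proof -
    \<comment> \<open>Testing f against h(w) sees only f1, as the functional vanishes on F[w]. Once
      r^n divides f1, testing against t h(w) sees only f0.\<close>
    obtain f0 f1 where f01: "f = ?W f0 + [:0, 1:] * ?W f1" by (rule qmap_decomposition)
    have l0: "B y (pe (?W h) (a y)) = 0" for h using form_pcompose_qmap[OF y] .
    have "l (f1 * h) = 0" for h
    proof -
      have "f * ?W h = ?W (f0 * h) + ?W (f1 * h) * [:0, 1:]"
        unfolding f01 pcompose_mult by (simp only: ring_distribs ac_simps)
      then show ?thesis using f[of "?W h"] l0 y unfolding l_def by (simp only: pe_add a_mem B_lin pe_mem add_0)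
    qed
    then have "r ^ n dvd f1" by (rule dvd)
    then obtain m where m: "f1 = r ^ n * m" by blast
    have "l (f0 * h) = 0" for h
    proof -
      have "f * (?W h * [:0, 1:]) = ?W (f0 * h) * [:0, 1:] + ([:0, 1:] * ?W m * ?W h * [:0, 1:]) * ?W (r ^ n)"
        unfolding f01 m pcompose_mult by (simp only: ring_distribs ac_simps)
      then show ?thesis using f[of "?W h * [:0, 1:]"] y Pay unfolding l_def
        by (simp only: pe_add a_mem B_lin pe_mem pe_mult[of "a y" _ "?W (r ^ n)"] pe_zero B_0 add_0_right)
    qed
    then have "r ^ n dvd f0" by (rule dvd)
    then obtain m' where "f0 = r ^ n * m'" by blast
    then have "f = ?W (r ^ n) * (?W m' + [:0, 1:] * ?W m)"
      unfolding f01 m by (simp only: pcompose_mult ring_distribs ac_simps)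
    then show ?thesis by (rule dvdI)
  qed
  then show thesis using that y Py by blast
qed

end

section \<open>Orthogonal splitting and Lagrangian splitting\<close>

lemma (in vector_space) symplectic_difference_restrict:
  assumes V: "symplectic_pair scale V b u" and U: "subspace U" "U \<subseteq> V"
    and nd: "\<And>x. x \<in> U \<Longrightarrow> (\<And>y. y \<in> U \<Longrightarrow> b x y = 0) \<Longrightarrow> x = 0"
    and u12: "alternating_endo scale V b u1" "alternating_endo scale V b u2"
      "\<And>x. x \<in> V \<Longrightarrow> u x = u1 x - u2 x"
      "\<And>x. x \<in> V \<Longrightarrow> poly_endo scale p u1 x = 0" "\<And>x. x \<in> V \<Longrightarrow> poly_endo scale q u2 x = 0"
    and stable: "\<And>x. x \<in> U \<Longrightarrow> u1 x \<in> U" "\<And>x. x \<in> U \<Longrightarrow> u2 x \<in> U"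
  shows "symplectic_difference p q scale U b u"
proof -
  have "u x \<in> U" if "x \<in> U" for x
  proof -
    have "u x = u1 x - u2 x" using u12(3) U that by blast
    then show ?thesis using subspace_diff[OF U(1) stable(1)[OF that] stable(2)[OF that]] by simp
  qed
  then have "symplectic_pair scale U b u"
    using V U(2) nd fd_space_subspace_of[OF _ U]
    by (auto simp: symplectic_pair_def symplectic_form_def bilinear_on_def linear_on_def
        alternating_endo_def endo_on_def subset_eq)
  moreover have "alternating_endo scale U b u1" "alternating_endo scale U b u2"
    using u12(1,2) stable U(2)
    by (auto simp: alternating_endo_def endo_on_def linear_on_def subset_eq)
  ultimately show ?thesis
    using u12(3-5) U(2) unfolding symplectic_difference_def by blast
qed

text \<open>Riesz representation on U makes its orthogonal C a complement, and self-adjointness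
  makes C stable under u1 and u2. The decomposition u1 - u2 thus restricts to both summands, and
  indecomposability forces C to vanish.\<close>

lemma orthogonal_splitting:
  fixes s :: "'a::field \<Rightarrow> 'v::ab_group_add \<Rightarrow> 'v"
  assumes ind: "indecomposable_difference p q s V b u" and U: "Modules.module.subspace s U" "U \<subseteq> V" "U \<noteq> {0}"
    and nd: "\<And>x. x \<in> U \<Longrightarrow> (\<And>y. y \<in> U \<Longrightarrow> b x y = 0) \<Longrightarrow> x = 0"
    and u12: "alternating_endo s V b u1" "alternating_endo s V b u2"
      "\<And>x. x \<in> V \<Longrightarrow> u x = u1 x - u2 x"
      "\<And>x. x \<in> V \<Longrightarrow> poly_endo s p u1 x = 0" "\<And>x. x \<in> V \<Longrightarrow> poly_endo s q u2 x = 0"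
    and stable: "\<And>x. x \<in> U \<Longrightarrow> u1 x \<in> U" "\<And>x. x \<in> U \<Longrightarrow> u2 x \<in> U"
    and selfadjoint: "\<And>x y. x \<in> V \<Longrightarrow> y \<in> V \<Longrightarrow> b (u1 x) y = b x (u1 y)"
      "\<And>x y. x \<in> V \<Longrightarrow> y \<in> V \<Longrightarrow> b (u2 x) y = b x (u2 y)"
  shows "U = V"
proof -
  have sp: "symplectic_pair s V b u"
    using ind by (simp add: indecomposable_difference_def symplectic_difference_def)
  then have fd: "fd_space s V" and form: "symplectic_form s V b" and au: "alternating_endo s V b u"
    by (auto simp: symplectic_pair_def)
  interpret vector_space s using fd by (simp add: fd_space_def)
  interpret V: endo_space s V u
    using fd_space_subspace[OF fd] au by unfold_locales (simp_all add: alternating_endo_def)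
  have b: "b (x + y) z = b x z + b y z" "b (s c x) z = c * b x z"
    "b z (x + y) = b z x + b z y" "b z (s c x) = c * b z x" if "x \<in> V" "y \<in> V" "z \<in> V" for x y z c
    using that form by (auto simp: symplectic_form_def bilinear_on_def linear_on_def)
  have b_diff: "b (x - y) z = b x z - b y z" if "x \<in> V" "y \<in> V" "z \<in> V" for x y z
    using b(1)[of "x - y" y z] that by simp
  have UV: "x \<in> V" if "x \<in> U" for x using that U by blast
  define C where "C = {x \<in> V. \<forall>y\<in>U. b x y = 0}"
  have CV: "C \<subseteq> V" by (auto simp: C_def)
  have C: "subspace C"
    using U(2) b(2)[of 0 0 _ 0] by (auto simp: subspace_def C_def b subset_eq)
  have fdU: "fd_space s U" using fd_space_subspace_of[OF fd U(1,2)] .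
  have bU: "bilinear_on s U b"
    using form U(2) by (auto simp: symplectic_form_def bilinear_on_def linear_on_def subset_eq)
  have antisym: "b x y = - b y x" if "x \<in> V" "y \<in> V" for x y
    by (rule symplectic_form_antisym[OF form vector_space_axioms V.sub that])
  have ndU: "x = 0" if x: "x \<in> U" and "\<And>z. z \<in> U \<Longrightarrow> b z x = 0" for x
  proof (rule nd[OF x])
    fix y assume "y \<in> U"
    then show "b x y = 0" using antisym[of x y] that UV by simp
  qed
  have "\<exists>y\<in>U. x - y \<in> C" if x: "x \<in> V" for x
  proof -
    have "linear_on s (*) U (b x)"
      using form x U(2) by (auto simp: symplectic_form_def bilinear_on_def linear_on_def subset_eq)
    then obtain y where y: "y \<in> U" "\<And>z. z \<in> U \<Longrightarrow> b y z = b x z"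
      using bilinear_represent[OF fdU bU U(1) subset_refl, of "b x"] ndU by blast
    then show ?thesis using x UV by (intro bexI[of _ y]) (auto simp: C_def b_diff)
  qed
  \<comment> \<open>The orthogonal projection on U: pr x is the vector of U that has the same
    pairings with U as x.\<close>
  then obtain pr where pr: "\<And>x. x \<in> V \<Longrightarrow> pr x \<in> U" "\<And>x. x \<in> V \<Longrightarrow> x - pr x \<in> C" by metis
  have zero: "x = 0" if "x \<in> U" "x \<in> C" for x using nd[OF that(1)] that(2) by (simp add: C_def)
  have prI: "pr x = y" if "x \<in> V" "y \<in> U" "x - y \<in> C" for x y
  proof -
    have "(x - y) - (x - pr x) \<in> C" by (rule subspace_diff[OF C that(3) pr(2)[OF that(1)]])
    then have "pr x - y \<in> C" by simp
    then have "pr x - y = 0" by (rule zero[OF subspace_diff[OF U(1) pr(1)[OF that(1)] that(2)]])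
    then show ?thesis by simp
  qed
  have stableC: "w x \<in> C" if "x \<in> C" "alternating_endo s V b w" "\<And>x. x \<in> U \<Longrightarrow> w x \<in> U"
    "\<And>x y. x \<in> V \<Longrightarrow> y \<in> V \<Longrightarrow> b (w x) y = b x (w y)" for w x
    using that UV by (auto simp: C_def alternating_endo_def endo_on_def)
  have u_stable: "u x \<in> U" if "x \<in> U" for x
    using u12(3)[OF UV[OF that]] subspace_diff[OF U(1) stable(1)[OF that] stable(2)[OF that]] by simp
  have c12: "u1 x \<in> C" "u2 x \<in> C" if "x \<in> C" for x
    using stableC[OF that u12(1) stable(1) selfadjoint(1)] stableC[OF that u12(2) stable(2) selfadjoint(2)]
    by blast+
  have u_stableC: "u x \<in> C" if "x \<in> C" for x
  proof -
    have "u x = u1 x - u2 x" using u12(3) that CV by blast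
    then show ?thesis using subspace_diff[OF C c12[OF that]] by simp
  qed
  have CU: "b x y = 0" "b y x = 0" if "x \<in> C" "y \<in> U" for x y
    using that antisym[of y x] CV UV by (auto simp: C_def)
  have ndC: "x = 0" if x: "x \<in> C" and *: "\<And>y. y \<in> C \<Longrightarrow> b x y = 0" for x
  proof -
    have "b x y = 0" if y: "y \<in> V" for y
    proof -
      have "b x (pr y + (y - pr y)) = b x (pr y) + b x (y - pr y)"
        using x y pr[OF y] CV UV by (intro b) auto
      then show ?thesis using CU(1)[OF x pr(1)[OF y]] *[OF pr(2)[OF y]] by simp
    qed
    then show ?thesis using form x CV by (auto simp: symplectic_form_def)
  qed
  have dU: "symplectic_difference p q s U b u"
    by (rule symplectic_difference_restrict[OF sp U(1,2) nd u12 stable])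
  have dC: "symplectic_difference p q s C b u"
    by (rule symplectic_difference_restrict[OF sp C CV ndC u12 c12])
  interpret ss: module_prod s s ..
  have iso: "isometric s V b u ss.scale (U \<times> C) (sum_form b b) (map_prod u u)"
    unfolding isometric_def
  proof (intro exI conjI ballI)
    let ?\<phi> = "\<lambda>x. (pr x, x - pr x)"
    have add: "pr (x + y) = pr x + pr y" if "x \<in> V" "y \<in> V" for x y
      using that pr UV subspace_add[OF C pr(2)[OF that(1)] pr(2)[OF that(2)]]
      by (intro prI) (auto intro: subspace_add U simp: algebra_simps)
    have scale: "pr (s c x) = s c (pr x)" if "x \<in> V" for x c
      using that pr UV subspace_scale[OF C pr(2)[OF that], of c]
      by (intro prI) (auto intro: subspace_scale U simp: scale_right_diff_distrib)
    show "linear_on s ss.scale V ?\<phi>"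
      by (auto simp: linear_on_def ss.scale_prod add scale algebra_simps)
    show "bij_betw ?\<phi> V (U \<times> C)"
    proof (rule bij_betw_byWitness[where f' = "\<lambda>(x, y). x + y"])
      have "pr (x + y) = x" if "x \<in> U" "y \<in> C" for x y using that UV CV by (intro prI) auto
      then show "\<forall>z\<in>U \<times> C. ?\<phi> ((\<lambda>(x, y). x + y) z) = z" by auto
    qed (use pr UV CV in auto)
    show "sum_form b b (?\<phi> x) (?\<phi> y) = b x y" if xy: "x \<in> V" "y \<in> V" for x y
    proof -
      have "b (pr x + (x - pr x)) (pr y + (y - pr y)) = b (pr x) (pr y) + b (x - pr x) (pr y)
          + (b (pr x) (y - pr y) + b (x - pr x) (y - pr y))"
        using xy pr UV by (simp only: b V.mem)
      then show ?thesis using CU pr xy by (simp add: sum_form_def)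
    qed
    show "map_prod u u (?\<phi> x) = ?\<phi> (u x)" if x: "x \<in> V" for x
    proof -
      have "u x - u (pr x) \<in> C" using u_stableC[OF pr(2)[OF x]] x pr UV by (simp add: V.endo_diff)
      then have "pr (u x) = u (pr x)" using x u_stable pr UV by (intro prI) auto
      then show ?thesis using x pr UV by (simp add: V.endo_diff)
    qed
  qed
  have "C = {0}"
  proof (rule ccontr)
    assume "C \<noteq> {0}"
    then show False using ind dU dC U(3) iso unfolding indecomposable_difference_def by blast
  qed
  then have "x - pr x = 0" if "x \<in> V" for x using pr(2)[OF that] by simp
  then have "x \<in> U" if "x \<in> V" for x using pr(1)[OF that] that by simp
  then show ?thesis using U(2) by blast
qed

text \<open>The form identifies the second Lagrangian \<open>L'\<close> with the dual space of \<open>L\<close>.\<close>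

lemma lagrangian_splitting_isometric:
  fixes s :: "'a::field \<Rightarrow> 'v::ab_group_add \<Rightarrow> 'v"
  assumes sp: "symplectic_pair s V b u"
    and L: "Modules.module.subspace s L" "L \<subseteq> V" "Modules.module.subspace s L'" "L' \<subseteq> V"
    and iso: "\<And>x y. x \<in> L \<Longrightarrow> y \<in> L \<Longrightarrow> b x y = 0" "\<And>x y. x \<in> L' \<Longrightarrow> y \<in> L' \<Longrightarrow> b x y = 0"
    and stable: "\<And>x. x \<in> L \<Longrightarrow> u x \<in> L" "\<And>x. x \<in> L' \<Longrightarrow> u x \<in> L'"
    and selfadjoint: "\<And>x y. x \<in> V \<Longrightarrow> y \<in> V \<Longrightarrow> b (u x) y = b x (u y)"
    and V: "\<And>z. z \<in> V \<Longrightarrow> \<exists>x\<in>L. \<exists>y\<in>L'. z = x + y"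
  shows "isometric s V b u (ext_scale s) (ext_space s L) ext_form (ext_endo L u)"
proof -
  have fd: "fd_space s V" and form: "symplectic_form s V b" and au: "alternating_endo s V b u"
    using sp by (auto simp: symplectic_pair_def)
  interpret vector_space s using fd by (simp add: fd_space_def)
  interpret V: endo_space s V u
    using fd_space_subspace[OF fd] au by unfold_locales (simp_all add: alternating_endo_def)
  have b: "b (x + y) z = b x z + b y z" "b (s c x) z = c * b x z"
    "b z (x + y) = b z x + b z y" "b z (s c x) = c * b z x" if "x \<in> V" "y \<in> V" "z \<in> V" for x y z c
    using that form by (auto simp: symplectic_form_def bilinear_on_def linear_on_def)
  have b0: "b z 0 = 0" if "z \<in> V" for z
    using b(4)[of z z z 0] that by simp
  have antisym: "b x y = - b y x" if "x \<in> V" "y \<in> V" for x y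
    by (rule symplectic_form_antisym[OF form vector_space_axioms V.sub that])
  have nd: "x = 0" if "x \<in> V" "\<And>z. z \<in> V \<Longrightarrow> b x z = 0" for x
    using that form by (simp add: symplectic_form_def)
  have LV: "x \<in> V" if "x \<in> L" for x using that L by blast
  have L'V: "x \<in> V" if "x \<in> L'" for x using that L by blast
  obtain l l' where l: "\<And>z. z \<in> V \<Longrightarrow> l z \<in> L" "\<And>z. z \<in> V \<Longrightarrow> l' z \<in> L'" "\<And>z. z \<in> V \<Longrightarrow> z = l z + l' z"
    using V by metis
  have zero: "x = 0" if "x \<in> L" "x \<in> L'" for x
  proof (rule nd)
    fix z assume z: "z \<in> V"
    have "b x (l z + l' z) = b x (l z) + b x (l' z)" using that l z LV L'V by (intro b) auto
    then show "b x z = 0" using iso that l[OF z] by simp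
  qed (use that LV in simp)
  have lI: "l z = x" "l' z = y" if "z \<in> V" "z = x + y" "x \<in> L" "y \<in> L'" for z x y
  proof -
    have "l z - x = y - l' z" using l(3)[OF that(1)] that(2) by (simp add: algebra_simps)
    moreover have "l z - x \<in> L" using l that L(1) by (intro subspace_diff) auto
    moreover have "y - l' z \<in> L'" using l that L(3) by (intro subspace_diff) auto
    ultimately have "l z - x = 0" "y - l' z = 0" using zero by metis+
    then show "l z = x" "l' z = y" by simp_all
  qed
  have l_add: "l (x + y) = l x + l y" "l' (x + y) = l' x + l' y" if xy: "x \<in> V" "y \<in> V" for x y
  proof -
    have "x + y = (l x + l y) + (l' x + l' y)"
      using l(3)[OF xy(1)] l(3)[OF xy(2)] by (metis add.assoc add.left_commute)
    moreover have "x + y \<in> V" "l x + l y \<in> L" "l' x + l' y \<in> L'"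
      using xy subspace_add[OF L(1) l(1)[OF xy(1)] l(1)[OF xy(2)]]
        subspace_add[OF L(3) l(2)[OF xy(1)] l(2)[OF xy(2)]] by simp_all
    ultimately show "l (x + y) = l x + l y" "l' (x + y) = l' x + l' y"
      using lI[of "x + y" "l x + l y" "l' x + l' y"] by blast+
  qed
  have l_scale: "l (s c x) = s c (l x)" "l' (s c x) = s c (l' x)" if x: "x \<in> V" for x c
  proof -
    have "s c x = s c (l x) + s c (l' x)"
      unfolding scale_right_distrib[symmetric] using l(3)[OF x] by simp
    moreover have "s c x \<in> V" "s c (l x) \<in> L" "s c (l' x) \<in> L'"
      using x subspace_scale[OF L(1) l(1)[OF x]] subspace_scale[OF L(3) l(2)[OF x]] by simp_all
    ultimately show "l (s c x) = s c (l x)" "l' (s c x) = s c (l' x)"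
      using lI[of "s c x" "s c (l x)" "s c (l' x)"] by blast+
  qed
  have l_u: "l (u x) = u (l x)" "l' (u x) = u (l' x)" if x: "x \<in> V" for x
  proof -
    have "u x = u (l x) + u (l' x)"
      using V.endo_lin(1)[of "l x" "l' x"] l[OF x] LV L'V by simp
    moreover have "u x \<in> V" "u (l x) \<in> L" "u (l' x) \<in> L'"
      using x stable l(1,2)[OF x] by simp_all
    ultimately show "l (u x) = u (l x)" "l' (u x) = u (l' x)"
      using lI[of "u x" "u (l x)" "u (l' x)"] by blast+
  qed
  define \<theta> where "\<theta> y = (\<lambda>z. if z \<in> L then b y z else 0)" for y
  have theta_dual: "\<theta> y \<in> dual_space s L" if "y \<in> V" for y
    using that LV subspace_add[OF L(1)] subspace_scale[OF L(1)]
    by (auto simp: dual_space_def linear_on_def \<theta>_def b)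
  interpret sf: module_prod s "fun_scale :: 'a \<Rightarrow> ('v \<Rightarrow> 'a) \<Rightarrow> _"
    by unfold_locales (auto simp: fun_scale_def fun_eq_iff algebra_simps)
  show ?thesis
    unfolding isometric_def ext_scale_def ext_space_def
  proof (intro exI conjI ballI)
    let ?\<phi> = "\<lambda>z. (l z, \<theta> (l' z))"
    have l'V: "l' z \<in> V" "l z \<in> V" if "z \<in> V" for z using l that LV L'V by auto
    show "linear_on s sf.scale V ?\<phi>"
      using LV by (auto simp: linear_on_def sf.scale_prod l_add l_scale \<theta>_def fun_eq_iff fun_scale_def b l'V)
    show "bij_betw ?\<phi> V (L \<times> dual_space s L)"
      unfolding bij_betw_def
    proof
      have "x = y" if xy: "x \<in> V" "y \<in> V" "l x = l y" "\<theta> (l' x) = \<theta> (l' y)" for x y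
      proof -
        let ?d = "l' x - l' y"
        have d: "?d \<in> L'" using xy l L(3) by (intro subspace_diff) auto
        have bd: "b ?d z = 0" if "z \<in> L" for z
        proof -
          have "b (l' x) z = b (l' y) z" using fun_cong[OF xy(4), of z] that by (simp add: \<theta>_def)
          moreover have "b (?d + l' y) z = b ?d z + b (l' y) z"
            using d that xy l'V LV L'V by (intro b) auto
          ultimately show ?thesis by simp
        qed
        have "?d = 0"
        proof (rule nd)
          fix z assume z: "z \<in> V"
          have "b ?d (l z + l' z) = b ?d (l z) + b ?d (l' z)" using d l'V z L'V by (intro b) auto
          then show "b ?d z = 0" using bd iso(2)[OF d] l[OF z] by simp
        qed (use d L'V in simp)
        then have "l' x = l' y" by simp
        then show "x = y" using l(3)[OF xy(1)] l(3)[OF xy(2)] xy(3) by simp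
      qed
      then show "inj_on ?\<phi> V" by (auto intro: inj_onI)
      show "?\<phi> ` V = L \<times> dual_space s L"
      proof
        show "?\<phi> ` V \<subseteq> L \<times> dual_space s L" using l theta_dual l'V by auto
        show "L \<times> dual_space s L \<subseteq> ?\<phi> ` V"
        proof clarify
          fix x \<psi> assume x: "x \<in> L" and \<psi>: "\<psi> \<in> dual_space s L"
          have "linear_on s (*) L \<psi>" "bilinear_on s V b"
            using \<psi> form by (auto simp: dual_space_def symplectic_form_def)
          moreover have "y = 0" if "y \<in> L" "\<And>z. z \<in> V \<Longrightarrow> b z y = 0" for y
            using nd[of y] antisym[of y] that LV by simp
          ultimately obtain z where z: "z \<in> V" "\<And>y. y \<in> L \<Longrightarrow> b z y = \<psi> y"
            using bilinear_represent[OF fd _ L(1,2)] by blast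
          \<comment> \<open>The component of z in L is orthogonal to L, so the component in L' alone
            represents \<psi>.\<close>
          have zl: "b (l' z) y = \<psi> y" if "y \<in> L" for y
          proof -
            have "b (l z + l' z) y = b (l z) y + b (l' z) y" using that z l'V LV by (intro b) auto
            then show ?thesis using z l(3)[OF z(1)] iso(1)[OF l(1)[OF z(1)] that] that by simp
          qed
          have "\<theta> (l' z) = \<psi>" using zl \<psi> by (auto simp: \<theta>_def dual_space_def fun_eq_iff)
          moreover have "x + l' z \<in> V" using x LV l'V z by simp
          moreover have "l (x + l' z) = x" "l' (x + l' z) = l' z"
            using lI[of "x + l' z" x "l' z"] x LV l'V z l by auto
          ultimately show "(x, \<psi>) \<in> ?\<phi> ` V" by (metis (no_types, lifting) rev_image_eqI)
        qed
      qed
    qed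
    show "ext_form (?\<phi> x) (?\<phi> y) = b x y" if xy: "x \<in> V" "y \<in> V" for x y
    proof -
      have "b (l x + l' x) (l y + l' y)
          = b (l x) (l y) + b (l' x) (l y) + (b (l x) (l' y) + b (l' x) (l' y))"
        using xy l'V by (simp only: b V.mem)
      then have "b x y = b (l' x) (l y) + b (l x) (l' y)"
        using l(3)[OF xy(1)] l(3)[OF xy(2)] iso l xy by simp
      also have "b (l x) (l' y) = - b (l' y) (l x)" using xy l'V by (intro antisym) auto
      finally show ?thesis using l(1) xy by (simp add: ext_form_def \<theta>_def)
    qed
    show "ext_endo L u (?\<phi> x) = ?\<phi> (u x)" if x: "x \<in> V" for x
      using l'V[OF x] LV stable
      by (auto simp: ext_endo_def l_u[OF x] transpose_on_def \<theta>_def fun_eq_iff selfadjoint)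
  qed
qed

section \<open>The submodule of a generator\<close>

locale generated_difference = sp_difference s V u \<tau> \<mu> \<alpha> \<beta> B a
  for s :: "'a::field \<Rightarrow> 'v::ab_group_add \<Rightarrow> 'v" (infixr "*s" 75) and V u and \<tau> \<mu> \<alpha> \<beta> :: 'a and B a +
  fixes y R P
  assumes y: "y \<in> V" and P: "P = pcompose R (qmap \<delta>)" and Py: "pe P y = 0"
    and nd: "\<And>f. (\<And>g. B y (pe (f * g) (a y)) = 0) \<Longrightarrow> P dvd f"
begin

lemma ay: "a y \<in> V"
  using y by simp

lemma Pay: "pe P (a y) = 0"
  using y Py a_pe_qmap[of y R] by (simp add: P a_0)

lemma ann_y: "pe f y = 0 \<longleftrightarrow> P dvd f"
proof
  assume *: "pe f y = 0"
  show "P dvd f"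
  proof (rule nd)
    fix g show "B y (pe (f * g) (a y)) = 0"
      using * y by (simp add: pe_mult selfadjoint_pe[symmetric] B_0)
  qed
qed (use pe_dvd[OF y Py] in blast)

lemma ann_ay: "pe f (a y) = 0 \<longleftrightarrow> P dvd f"
proof
  assume *: "pe f (a y) = 0"
  show "P dvd f"
  proof (rule nd)
    fix g show "B y (pe (f * g) (a y)) = 0"
      using * y by (simp add: mult.commute[of f] pe_mult B_0)
  qed
qed (use pe_dvd[OF ay Pay] in blast)

lemma isotropic:
  assumes z: "z \<in> V" and "x \<in> cyc z" "x' \<in> cyc z"
  shows "B x x' = 0"
proof -
  obtain f g where "x = pe f z" "x' = pe g z" using assms by (auto simp: cyc_def)
  then show ?thesis using z pe_alternating[OF z, of "f * g"] by (simp add: selfadjoint_pe pe_mult)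
qed

definition gen :: "'v set" where "gen = {x + x' | x x'. x \<in> cyc y \<and> x' \<in> cyc (a y)}"

lemma genI: "pe f y + pe g (a y) \<in> gen"
  by (auto simp: gen_def cyc_def)

lemma genE:
  assumes "x \<in> gen"
  obtains f g where "x = pe f y + pe g (a y)"
  using assms by (auto simp: gen_def cyc_def)

lemma gen_subspace: "subspace gen"
proof -
  have "gen = {x + x' | x x'. x \<in> cyc y \<and> x' \<in> cyc (a y)}" by (simp add: gen_def)
  then show ?thesis using subspace_sums[OF cyc_subspace[OF y] cyc_subspace[OF ay]] by simp
qed

lemma gen_subset: "gen \<subseteq> V"
  using y by (auto elim!: genE)

lemma gen_endo: "x \<in> gen \<Longrightarrow> u x \<in> gen"
proof -
  assume "x \<in> gen"
  then obtain f g where "x = pe f y + pe g (a y)" by (rule genE)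
  then have "u x = pe (pCons 0 f) y + pe (pCons 0 g) (a y)"
    using y by (simp add: pe_pCons endo_lin)
  then show ?thesis using genI by simp
qed

lemma gen_a: "x \<in> gen \<Longrightarrow> a x \<in> gen"
proof -
  assume "x \<in> gen"
  then obtain f g where x: "x = pe f y + pe g (a y)" by (rule genE)
  have "a x = (pe (reflect \<delta> f) (a y) + pe (kap * ddiff \<delta> f) y)
      + (pe (reflect \<delta> g) (\<tau> *s a y - \<alpha> *s y) + pe (kap * ddiff \<delta> g) (a y))"
    using y by (simp only: x a_lin pe_mem a_mem a_pe a_a)
  also have "\<dots> = pe (kap * ddiff \<delta> f - [:\<alpha>:] * reflect \<delta> g) y
      + pe (reflect \<delta> f + [:\<tau>:] * reflect \<delta> g + kap * ddiff \<delta> g) (a y)"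
    using y by (simp only: pe_add pe_diff a_mem pe_const_mult pe_arg_diff mem pe_lin)
      (simp add: algebra_simps)
  finally show ?thesis using genI by simp
qed

lemma form_gen:
  "B (pe f y + pe g (a y)) (pe f' y + pe g' (a y)) = B y (pe (f * g') (a y)) - B y (pe (g * f') (a y))"
proof -
  have cyc: "pe h z \<in> cyc z" for h z by (simp add: cyc_def)
  have "B (pe f y + pe g (a y)) (pe f' y + pe g' (a y)) = B (pe g (a y)) (pe f' y) + B (pe f y) (pe g' (a y))"
    using y isotropic[OF y cyc cyc, of f f'] isotropic[OF ay cyc cyc, of g g'] by (simp add: B_lin)
  also have "B (pe g (a y)) (pe f' y) = - B (pe f' y) (pe g (a y))" using y by (intro B_antisym) auto
  also have "B (pe f' y) (pe g (a y)) = B y (pe (g * f') (a y))"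
    using y by (simp add: selfadjoint_pe pe_mult pe_commute)
  also have "B (pe f y) (pe g' (a y)) = B y (pe (f * g') (a y))"
    using y by (simp add: selfadjoint_pe pe_mult)
  finally show ?thesis by simp
qed

text \<open>Each summand being isotropic, pairing with F[u] a y tests only f and pairing with F[u] y
  tests only g.\<close>

lemma gen_eq_0:
  assumes "\<And>z. z \<in> gen \<Longrightarrow> B (pe f y + pe g (a y)) z = 0"
  shows "P dvd f" "P dvd g"
proof -
  have *: "B y (pe (f * g') (a y)) = B y (pe (g * f') (a y))" for f' g'
    using assms[OF genI[of f' g']] unfolding form_gen by simp
  show "P dvd f"
  proof (rule nd)
    fix h show "B y (pe (f * h) (a y)) = 0" using *[of h 0] y by (simp add: B_0)
  qed
  show "P dvd g"
  proof (rule nd)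
    fix h show "B y (pe (g * h) (a y)) = 0" using *[of 0 h] y by (simp add: B_0)
  qed
qed

lemma gen_nondegenerate:
  assumes "x \<in> gen" "\<And>z. z \<in> gen \<Longrightarrow> B x z = 0"
  shows "x = 0"
proof -
  obtain f g where x: "x = pe f y + pe g (a y)" using assms(1) by (rule genE)
  have "P dvd f" "P dvd g" using gen_eq_0[of f g] assms(2) unfolding x by blast+
  then have "pe f y = 0" "pe g (a y) = 0" using ann_y ann_ay by blast+
  then show ?thesis unfolding x by simp
qed

text \<open>The zero vector is orthogonal to \<open>gen\<close>, so \<open>gen_eq_0\<close> applies.
  Together with \<open>ann_y\<close> and \<open>ann_ay\<close> this makes \<open>gen\<close> free of
  rank 2 over F[t]/P, which is the dimension count behind indecomposability.\<close>

lemma independent_generators: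
  assumes "pe f y + pe g (a y) = 0"
  shows "P dvd f" "P dvd g"
  using gen_eq_0[of f g] unfolding assms using gen_subset B_0(1) by blast+

lemma isometric_extension:
  assumes "gen = V"
  shows "isometric s V B u (ext_scale s) (ext_space s (cyc y)) ext_form (ext_endo (cyc y) u)"
proof (rule lagrangian_splitting_isometric)
  show "symplectic_pair s V B u" using fd form alt_u by (simp add: symplectic_pair_def)
  show "\<exists>x\<in>cyc y. \<exists>x'\<in>cyc (a y). z = x + x'" if "z \<in> V" for z
    using that unfolding assms[symmetric] gen_def by blast
  show "u x \<in> cyc y" if "x \<in> cyc y" for x
    using cyc_endo[OF y] that by (auto simp: endo_on_def)
  show "u x \<in> cyc (a y)" if "x \<in> cyc (a y)" for x
    using cyc_endo[OF ay] that by (auto simp: endo_on_def)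
qed (use cyc_subspace cyc_subset y ay isotropic selfadjoint_u in blast)+

end

section \<open>Roots in the algebraic closure\<close>

abbreviation evac :: "'a::field poly \<Rightarrow> 'a alg_closure \<Rightarrow> 'a alg_closure" where
  "evac f z \<equiv> poly (map_poly to_ac f) z"

lemma evac_pCons: "evac (pCons c f) z = to_ac c + z * evac f z"
  by (simp add: Polynomial.map_poly_pCons)

lemma evac_add: "evac (f + g) z = evac f z + evac g z"
  by (induction f g rule: poly_induct2) (simp_all add: evac_pCons algebra_simps)

lemma evac_mult: "evac (f * g) z = evac f z * evac g z"
proof (induction f)
  case (pCons c f)
  have smult: "evac (Polynomial.smult c g) z = to_ac c * evac g z" for c
    by (induction g) (simp_all add: evac_pCons algebra_simps)
  have "pCons c f * g = Polynomial.smult c g + pCons 0 (f * g)" by simp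
  then show ?case using pCons
    by (simp add: evac_add evac_pCons smult algebra_simps del: mult_pCons_left)
qed simp

lemma evac_1: "evac 1 z = 1"
  unfolding one_pCons by (simp add: evac_pCons)

lemma evac_pcompose: "evac (pcompose f g) z = evac f (evac g z)"
  by (induction f) (simp_all add: pcompose_pCons evac_add evac_mult evac_pCons)

lemma evac_power: "evac (f ^ n) z = evac f z ^ n"
  by (induction n) (simp_all add: evac_1 evac_mult)

lemma degree_map_to_ac: "Polynomial.degree (map_poly to_ac f) = Polynomial.degree f"
  by (rule degree_map_poly) simp

lemma evac_has_root:
  assumes "Polynomial.degree f > 0"
  obtains z where "evac f z = 0"
  using alg_closed_imp_poly_has_root[of "map_poly to_ac f"] assms by (auto simp: degree_map_to_ac)

lemma bezout_if_no_common_root: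
  fixes f g :: "'a::field poly"
  assumes "\<And>z. evac f z = 0 \<Longrightarrow> evac g z = 0 \<Longrightarrow> False"
  obtains k l where "k * f + l * g = 1"
proof -
  obtain d k l where d: "d = k * f + l * g" "d dvd f" "d dvd g" using poly_bezout by blast
  have common: "evac f z = 0 \<and> evac g z = 0" if "evac d z = 0" for z
    using d(2,3) that by (auto simp: dvd_def evac_mult)
  have "Polynomial.degree d = 0"
  proof (rule ccontr)
    assume "Polynomial.degree d \<noteq> 0"
    then obtain z where "evac d z = 0" using evac_has_root[of d] by blast
    then show False using common assms by blast
  qed
  then obtain c where c: "d = [:c:]" by (rule degree_eq_zeroE)
  have "c \<noteq> 0" using common[of 0] assms[of 0] c by auto
  then have "([:inverse c:] * k) * f + ([:inverse c:] * l) * g = [:inverse c:] * d"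
    by (simp only: d(1) distrib_left mult.assoc)
  also have "\<dots> = 1" using c \<open>c \<noteq> 0\<close> by (simp add: one_pCons)
  finally show thesis by (rule that)
qed

lemma irreducible_dvd_if_common_root:
  assumes "Factorial_Ring.irreducible r" "evac r z = 0" "evac f z = 0"
  shows "r dvd f"
proof (rule ccontr)
  assume "\<not> r dvd f"
  then obtain k l where "k * r + l * f = 1" using irreducible_bezout[OF assms(1)] by blast
  then have "evac (k * r + l * f) z = 1" by (simp only: evac_1)
  then show False using assms by (simp add: evac_add evac_mult)
qed

lemma (in quadratics) root_diffs_eq: 
  "root_diffs [:\<alpha>, -\<tau>, 1:] [:\<beta>, -\<mu>, 1:] = {z. evac rdpoly z = 0}"
proof -
  have split: "\<exists>x1 x2. to_ac b = x1 + x2 \<and> to_ac c = x1 * x2 \<and> root_set [:c, -b, 1:] = {x1, x2}"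
    for b c :: 'a
  proof -
    obtain x where x: "evac [:c, -b, 1:] x = 0" using evac_has_root[of "[:c, -b, 1:]"] by auto
    let ?y = "to_ac b - x"
    have c: "to_ac c = x * ?y" using x by (simp add: evac_pCons algebra_simps add_eq_0_iff)
    have "evac [:c, -b, 1:] z = (z - x) * (z - ?y)" for z
      by (simp add: evac_pCons c) (simp add: algebra_simps)
    then have "root_set [:c, -b, 1:] = {x, ?y}" by (auto simp: root_set_def)
    then show ?thesis using c by (intro exI[of _ x] exI[of _ ?y]) simp
  qed
  obtain x1 x2 where x: "to_ac \<tau> = x1 + x2" "to_ac \<alpha> = x1 * x2" "root_set [:\<alpha>, -\<tau>, 1:] = {x1, x2}"
    using split by blast
  obtain y1 y2 where y: "to_ac \<mu> = y1 + y2" "to_ac \<beta> = y1 * y2" "root_set [:\<beta>, -\<mu>, 1:] = {y1, y2}"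
    using split by blast
  have "evac rdpoly z = (z - (x1 - y1)) * (z - (x1 - y2)) * (z - (x2 - y1)) * (z - (x2 - y2))" for z
    by (rule poly_rdpoly) (simp_all add: x y)
  then show ?thesis by (auto simp: root_diffs_def x(3) y(3))
qed

section \<open>Eigenvalues in the algebraic closure\<close>

text \<open>Linear factors are stripped from G until the remaining factor no longer kills x; its
  value at x is then an eigenvector. Algebraic closedness is a hypothesis on the scalars of the
  locale, because the lemma is applied after extension of scalars.\<close>

lemma (in endo_space) eigenvector_of_annihilated:
  assumes ac: "\<And>f :: 'a poly. Polynomial.degree f > 0 \<Longrightarrow> \<exists>z. poly f z = 0"
    and "x \<in> V" "x \<noteq> 0" "G \<noteq> 0" "pe G x = 0"
  obtains k y where "poly G k = 0" "y \<in> V" "y \<noteq> 0" "u y = k *s y"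
proof -
  have "\<exists>k y. poly G k = 0 \<and> y \<in> V \<and> y \<noteq> 0 \<and> u y = k *s y"
    using assms(4,5)
  proof (induction "Polynomial.degree G" arbitrary: G rule: less_induct)
    case less
    have "Polynomial.degree G > 0"
    proof (rule ccontr)
      assume "\<not> Polynomial.degree G > 0"
      then have "Polynomial.degree G = 0" by simp
      then obtain c where "G = [:c:]" by (rule degree_eq_zeroE)
      then show False using less.prems assms(2,3) by simp
    qed
    then obtain k where k: "poly G k = 0" using ac by blast
    then obtain H where H: "G = [:-k, 1:] * H" by (metis dvdE poly_eq_0_iff_dvd)
    have "H \<noteq> 0" using H less.prems by auto
    show ?case
    proof (cases "pe H x = 0")
      case True
      have "Polynomial.degree G = Suc (Polynomial.degree H)"
        unfolding H using \<open>H \<noteq> 0\<close> by (subst degree_mult_eq) auto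
      then obtain k' y where "poly H k' = 0" "y \<in> V" "y \<noteq> 0" "u y = k' *s y"
        using less.hyps[OF _ \<open>H \<noteq> 0\<close> True] by auto
      then show ?thesis using H by auto
    next
      case False
      have "pe [:-k, 1:] (pe H x) = 0" using less.prems(2) assms(2) by (simp only: H pe_mult)
      then have "u (pe H x) = k *s pe H x" using assms(2) by (simp add: pe_pCons endo_0)
      then show ?thesis using k False assms(2) by (intro exI[of _ k] exI[of _ "pe H x"]) simp
    qed
  qed
  then show thesis using that by blast
qed

lemma (in vector_space) exists_representation:
  assumes fd: "fd_space scale V" and u: "endo_on scale V u"
  obtains A where "represented_by scale V u A"
proof -
  obtain B where B: "finite B" "span B = V" using fd by (auto simp: fd_space_def)
  obtain C where C: "C \<subseteq> V" "independent C" "V \<subseteq> span C"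
    using maximal_independent_subset by metis
  have fin: "finite C" using independent_span_bound[OF B(1) C(2)] B C by auto
  have span: "span C = V" using span_minimal[OF C(1) fd_space_subspace[OF fd]] C(3) by blast
  obtain bs where bs: "set bs = C" "distinct bs" using finite_distinct_list[OF fin] by blast
  let ?n = "length bs"
  define A where "A = mat ?n ?n (\<lambda>(i, j). representation C (u (bs ! j)) (bs ! i))"
  have "u (bs ! j) = (\<Sum>i<?n. scale (A $$ (i, j)) (bs ! i))" if j: "j < ?n" for j
  proof -
    have "bs ! j \<in> V" using C(1) bs(1) j by auto
    then have "u (bs ! j) \<in> span C" unfolding span using u by (auto simp: endo_on_def)
    then have "u (bs ! j) = (\<Sum>b\<in>C. scale (representation C (u (bs ! j)) b) b)"
      by (intro sum_representation_eq[symmetric] C fin) auto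
    also have "\<dots> = (\<Sum>i<?n. scale (representation C (u (bs ! j)) (bs ! i)) (bs ! i))"
      by (rule sum.reindex_bij_betw[OF bij_betw_nth, symmetric]) (use bs in auto)
    finally show ?thesis using j by (simp add: A_def)
  qed
  then have "represented_by scale V u A"
    unfolding represented_by_def using bs C(2) span by (intro exI[of _ bs]) (auto simp: A_def)
  then show thesis by (rule that)
qed

section \<open>Extension of scalars to the algebraic closure, in coordinates\<close>

locale matrix_coords = endo_space s V u for s :: "'a::field \<Rightarrow> 'v::ab_group_add \<Rightarrow> 'v" (infixr "*s" 75)
  and V u +
  fixes bs A
  assumes bs: "distinct bs" "independent (set bs)" "span (set bs) = V"
    and A: "A \<in> carrier_mat (length bs) (length bs)"
      "\<And>j. j < length bs \<Longrightarrow> u (bs ! j) = (\<Sum>i<length bs. A $$ (i, j) *s (bs ! i))"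
begin

abbreviation "n \<equiv> length bs"

definition coords :: "'v \<Rightarrow> nat \<Rightarrow> 'a alg_closure" where
  "coords x i = (if i < n then to_ac (representation (set bs) x (bs ! i)) else 0)"

text \<open>The action of A over the closure. Vectors are modelled as functions on
  \<open>nat\<close> that vanish from n on: these form a group under pointwise addition, so that
  \<open>endo_space\<close> can be instantiated with them.\<close>

definition mat_op :: "(nat \<Rightarrow> 'a alg_closure) \<Rightarrow> nat \<Rightarrow> 'a alg_closure" where
  "mat_op Z i = (if i < n then (\<Sum>j<n. to_ac (A $$ (i, j)) * Z j) else 0)"

lemma coords_lin:
  "x \<in> V \<Longrightarrow> y \<in> V \<Longrightarrow> coords (x + y) = (\<lambda>i. coords x i + coords y i)"
  "x \<in> V \<Longrightarrow> coords (c *s x) = (\<lambda>i. to_ac c * coords x i)"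
  using bs by (auto simp: coords_def fun_eq_iff representation_add representation_scale)

lemma coords_0: "coords 0 = (\<lambda>i. 0)"
  by (auto simp: coords_def fun_eq_iff representation_zero)

lemma expand: "x \<in> V \<Longrightarrow> x = (\<Sum>i<n. representation (set bs) x (bs ! i) *s (bs ! i))"
proof -
  assume x: "x \<in> V"
  have "x = (\<Sum>b\<in>set bs. representation (set bs) x b *s b)"
    using x bs by (intro sum_representation_eq[symmetric]) auto
  also have "\<dots> = (\<Sum>i<n. representation (set bs) x (bs ! i) *s (bs ! i))"
    by (rule sum.reindex_bij_betw[OF bij_betw_nth, symmetric]) (use bs in auto)
  finally show ?thesis .
qed

lemma bs_mem: "i < n \<Longrightarrow> bs ! i \<in> V"
  using bs(3) span_base by force

lemma coords_basis: "j < n \<Longrightarrow> coords (bs ! j) = (\<lambda>i. if i = j then 1 else 0)"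
  using bs by (auto simp: coords_def fun_eq_iff representation_basis nth_eq_iff_index_eq)

lemma coords_sum:
  assumes "\<And>j. j < (m::nat) \<Longrightarrow> g j \<in> V"
  shows "coords (\<Sum>j<m. c j *s g j) i = (\<Sum>j<m. to_ac (c j) * coords (g j) i)"
  using assms
proof (induction m)
  case (Suc m)
  have "(\<Sum>j<m. c j *s g j) \<in> V" using Suc.prems by (intro subspace_sum[OF sub]) simp
  then show ?case using Suc by (simp add: coords_lin)
qed (simp add: coords_0)

lemma endo_sum:
  assumes "\<And>j. j < (m::nat) \<Longrightarrow> g j \<in> V"
  shows "u (\<Sum>j<m. g j) = (\<Sum>j<m. u (g j))"
  using assms
proof (induction m)
  case (Suc m)
  have "(\<Sum>j<m. g j) \<in> V" using Suc.prems by (intro subspace_sum[OF sub]) simp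
  then show ?case using Suc by (simp add: endo_lin)
qed (simp add: endo_0)

lemma coords_endo:
  assumes x: "x \<in> V"
  shows "coords (u x) = mat_op (coords x)"
proof
  fix i
  have basis: "coords (u (bs ! j)) i = (if i < n then to_ac (A $$ (i, j)) else 0)" if j: "j < n" for j
  proof -
    have "coords (u (bs ! j)) i = (\<Sum>k<n. to_ac (A $$ (k, j)) * coords (bs ! k) i)"
      unfolding A(2)[OF j] by (rule coords_sum) (rule bs_mem)
    also have "\<dots> = (\<Sum>k<n. if k = i then to_ac (A $$ (i, j)) else 0)"
      by (intro sum.cong) (auto simp: coords_basis)
    finally show ?thesis by simp
  qed
  let ?c = "\<lambda>j. representation (set bs) x (bs ! j)"
  have "u x = (\<Sum>j<n. u (?c j *s (bs ! j)))"
    using bs_mem by (subst expand[OF x], subst endo_sum) auto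
  also have "\<dots> = (\<Sum>j<n. ?c j *s u (bs ! j))"
    using bs_mem by (simp add: endo_lin)
  finally have "coords (u x) i = (\<Sum>j<n. to_ac (?c j) * coords (u (bs ! j)) i)"
    using coords_sum[of n "\<lambda>j. u (bs ! j)" ?c i] bs_mem by simp
  also have "\<dots> = (\<Sum>j<n. to_ac (?c j) * (if i < n then to_ac (A $$ (i, j)) else 0))"
    by (intro sum.cong) (simp_all add: basis)
  also have "\<dots> = mat_op (coords x) i"
    by (auto simp: mat_op_def coords_def mult.commute intro!: sum.cong)
  finally show "coords (u x) i = mat_op (coords x) i" .
qed

lemma coords_eq_0: "x \<in> V \<Longrightarrow> coords x = (\<lambda>i. 0) \<Longrightarrow> x = 0"
proof -
  assume x: "x \<in> V" and 0: "coords x = (\<lambda>i. 0)"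
  have "representation (set bs) x (bs ! i) = 0" if "i < n" for i
    using fun_cong[OF 0, of i] that by (simp add: coords_def)
  then show "x = 0" using expand[OF x] by simp
qed

lemma mat_op_eigenvalue:
  assumes Y: "\<And>i. i \<ge> n \<Longrightarrow> Y i = 0" "Y \<noteq> (\<lambda>i. 0)" and k: "mat_op Y = (\<lambda>i. k * Y i)"
  shows "eigenvalue (map_mat to_ac A) k"
proof -
  have "vec n Y \<noteq> 0\<^sub>v n"
  proof
    assume *: "vec n Y = 0\<^sub>v n"
    have "Y i = 0" for i
      using arg_cong[OF *, of "\<lambda>v. Matrix.vec_index v i"] Y(1)[of i] by (cases "i < n") auto
    then show False using Y(2) by auto
  qed
  moreover have "map_mat to_ac A *\<^sub>v vec n Y = k \<cdot>\<^sub>v vec n Y"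
  proof (rule eq_vecI)
    fix i assume i: "i < dim_vec (k \<cdot>\<^sub>v vec n Y)"
    then have "(map_mat to_ac A *\<^sub>v vec n Y) $ i = mat_op Y i"
      using A(1) by (auto simp: mat_op_def scalar_prod_def atLeast0LessThan)
    then show "(map_mat to_ac A *\<^sub>v vec n Y) $ i = (k \<cdot>\<^sub>v vec n Y) $ i" using i k by simp
  qed (use A(1) in simp)
  ultimately show ?thesis using A(1) unfolding eigenvalue_def eigenvector_def by (intro exI[of _ "vec n Y"]) simp
qed

text \<open>For an eigenvector w of A, summing w_j times the coordinates of h(u) at the j-th basis
  vector computes h(A) w = h(k) w. For h = f the sum is 0, while some coordinate of w is
  not.\<close>

lemma evac_eigenvalue:
  assumes k: "eigenvalue (map_mat to_ac A) k" and f: "\<And>x. x \<in> V \<Longrightarrow> pe f x = 0"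
  shows "evac f k = 0"
proof -
  obtain w where w: "w \<in> carrier_vec n" "w \<noteq> 0\<^sub>v n" "map_mat to_ac A *\<^sub>v w = k \<cdot>\<^sub>v w"
    using k A(1) by (auto simp: eigenvalue_def eigenvector_def)
  have Aw: "(\<Sum>j<n. to_ac (A $$ (i, j)) * w $ j) = k * w $ i" if "i < n" for i
  proof -
    have "(map_mat to_ac A *\<^sub>v w) $ i = (\<Sum>j<n. to_ac (A $$ (i, j)) * w $ j)"
      using A(1) w(1) that by (auto simp: scalar_prod_def atLeast0LessThan)
    then show ?thesis using w that by simp
  qed
  have key: "(\<Sum>j<n. w $ j * coords (pe h (bs ! j)) i) = evac h k * w $ i" if "i < n" for h i
    using that
  proof (induction h arbitrary: i)
    case (pCons c h)
    have "(\<Sum>j<n. w $ j * coords (pe (pCons c h) (bs ! j)) i)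
        = (\<Sum>j<n. to_ac c * (w $ j * coords (bs ! j) i))
        + (\<Sum>j<n. w $ j * mat_op (coords (pe h (bs ! j))) i)"
      unfolding sum.distrib[symmetric]
      by (intro sum.cong) (auto simp: bs_mem pe_pCons coords_lin coords_endo algebra_simps)
    also have "(\<Sum>j<n. to_ac c * (w $ j * coords (bs ! j) i)) = (\<Sum>j<n. if j = i then to_ac c * w $ i else 0)"
      by (intro sum.cong) (auto simp: coords_basis)
    also have "\<dots> = to_ac c * w $ i" using pCons.prems by simp
    also have "(\<Sum>j<n. w $ j * mat_op (coords (pe h (bs ! j))) i)
        = (\<Sum>j<n. \<Sum>l<n. to_ac (A $$ (i, l)) * (w $ j * coords (pe h (bs ! j)) l))"
      using pCons.prems by (auto simp: mat_op_def sum_distrib_left ac_simps intro!: sum.cong)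
    also have "\<dots> = (\<Sum>l<n. to_ac (A $$ (i, l)) * (\<Sum>j<n. w $ j * coords (pe h (bs ! j)) l))"
      by (subst sum.swap) (simp add: sum_distrib_left)
    also have "\<dots> = (\<Sum>l<n. evac h k * (to_ac (A $$ (i, l)) * w $ l))"
      by (intro sum.cong) (auto simp: pCons.IH)
    also have "\<dots> = evac h k * (k * w $ i)"
      unfolding sum_distrib_left[symmetric] using Aw pCons.prems by simp
    finally show ?case by (simp add: evac_pCons algebra_simps)
  qed (simp add: coords_0)
  obtain i where i: "i < n" "w $ i \<noteq> 0"
  proof -
    have "\<exists>i<n. w $ i \<noteq> 0"
    proof (rule ccontr)
      assume "\<not> (\<exists>i<n. w $ i \<noteq> 0)"
      then have "w = 0\<^sub>v n" using w(1) by (intro eq_vecI) auto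
      then show False using w(2) by simp
    qed
    then show thesis using that by blast
  qed
  have "evac f k * w $ i = 0"
    unfolding key[OF i(1), symmetric] using f bs_mem by (simp add: coords_0)
  then show ?thesis using i(2) by simp
qed

lemma annihilated_eigenvalue:
  assumes x: "x \<in> V" "x \<noteq> 0" and f: "f \<noteq> 0" "pe f x = 0"
  obtains k where "evac f k = 0" "eigenvalue (map_mat to_ac A) k"
proof -
  let ?W = "{Z :: nat \<Rightarrow> 'a alg_closure. \<forall>i\<ge>n. Z i = 0}"
  interpret W: vector_space "fun_scale :: 'a alg_closure \<Rightarrow> (nat \<Rightarrow> 'a alg_closure) \<Rightarrow> _"
    by unfold_locales (auto simp: fun_scale_def fun_eq_iff algebra_simps)
  interpret W: endo_space "fun_scale :: 'a alg_closure \<Rightarrow> (nat \<Rightarrow> 'a alg_closure) \<Rightarrow> _" ?W mat_op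
    by unfold_locales
      (auto simp: W.subspace_def fun_scale_def endo_on_def linear_on_def mat_op_def fun_eq_iff
        sum.distrib algebra_simps sum_distrib_left)
  have mem: "coords y \<in> ?W" for y by (simp add: coords_def)
  have "W.pe (map_poly to_ac h) (coords y) = coords (pe h y)" if "y \<in> V" for h y
    using that
  proof (induction h)
    case (pCons c h)
    then show ?case using mem[of y]
      by (simp add: W.pe_pCons pe_pCons Polynomial.map_poly_pCons coords_lin coords_endo)
        (simp add: fun_scale_def fun_eq_iff)
  qed (simp add: coords_0 fun_eq_iff)
  then have ann: "W.pe (map_poly to_ac f) (coords x) = 0"
    using x f by (simp add: coords_0 fun_eq_iff)
  have nz: "coords x \<noteq> 0" using coords_eq_0[OF x(1)] x(2) by (auto simp: fun_eq_iff)
  have "poly.coeff (map_poly to_ac f) (Polynomial.degree f) \<noteq> 0" using f(1) by (simp add: coeff_map_poly)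
  then have nzf: "map_poly to_ac f \<noteq> 0" by auto
  have ac: "\<exists>z. poly g z = 0" if "Polynomial.degree g > 0" for g :: "'a alg_closure poly"
    using that by (rule alg_closed_imp_poly_has_root)
  obtain k Y where Y: "evac f k = 0" "Y \<in> ?W" "Y \<noteq> 0" "mat_op Y = fun_scale k Y"
    by (rule W.eigenvector_of_annihilated[OF ac mem nz nzf ann])
  then have "eigenvalue (map_mat to_ac A) k"
    by (intro mat_op_eigenvalue[of Y]) (auto simp: fun_scale_def fun_eq_iff)
  then show thesis by (rule that[OF Y(1)])
qed

end

context endo_space
begin

lemma closure_eigenvalue_root:
  assumes "k \<in> closure_eigenvalues s V u" "\<And>x. x \<in> V \<Longrightarrow> pe f x = 0"
  shows "evac f k = 0"
proof -
  obtain A bs where *: "eigenvalue (map_mat to_ac A) k"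
    "distinct bs" "independent (set bs)" "span (set bs) = V" "A \<in> carrier_mat (length bs) (length bs)"
    "\<And>j. j < length bs \<Longrightarrow> u (bs ! j) = (\<Sum>i<length bs. A $$ (i, j) *s (bs ! i))"
    using assms(1) unfolding closure_eigenvalues_def represented_by_def by blast
  interpret matrix_coords s V u bs A by unfold_locales (fact *)+
  show ?thesis using evac_eigenvalue[OF *(1)] assms(2) by blast
qed

lemma annihilated_closure_eigenvalue:
  assumes fd: "fd_space s V" and x: "x \<in> V" "x \<noteq> 0" and f: "f \<noteq> 0" "pe f x = 0"
  obtains k where "evac f k = 0" "k \<in> closure_eigenvalues s V u"
proof -
  obtain A where rep: "represented_by s V u A" using exists_representation[OF fd endo] by blast
  obtain bs where *: "distinct bs" "independent (set bs)" "span (set bs) = V"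
    "A \<in> carrier_mat (length bs) (length bs)"
    "\<And>j. j < length bs \<Longrightarrow> u (bs ! j) = (\<Sum>i<length bs. A $$ (i, j) *s (bs ! i))"
    using rep unfolding represented_by_def by blast
  interpret matrix_coords s V u bs A by unfold_locales (fact *)+
  obtain k where k: "evac f k = 0" "eigenvalue (map_mat to_ac A) k"
    by (rule annihilated_eigenvalue[OF x f])
  have "k \<in> closure_eigenvalues s V u" unfolding closure_eigenvalues_def using rep k(2) by blast
  with k(1) show thesis by (rule that)
qed

end

section \<open>Regular indecomposable differences\<close>

lemma monic_quadratic_eq:
  assumes "Polynomial.lead_coeff p = 1" "Polynomial.degree p = 2"
  shows "p = [:poly.coeff p 0, - poly_trace p, 1:]"
proof (rule poly_eqI)
  fix i :: nat
  consider "i = 0" | "i = 1" | "i = 2" | "i > 2" by linarith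
  then show "poly.coeff p i = poly.coeff [:poly.coeff p 0, - poly_trace p, 1:] i"
    using assms by cases (auto simp: poly_trace_def numeral_2_eq_2 coeff_eq_0 coeff_pCons split: nat.splits)
qed

text \<open>A divisor of least positive degree has no proper factor.\<close>

lemma exists_irreducible_factor:
  fixes h :: "'a::field poly"
  assumes "Polynomial.degree h > 0"
  obtains r where "Factorial_Ring.irreducible r" "Polynomial.lead_coeff r = 1" "r dvd h"
proof -
  let ?P = "\<lambda>d. d dvd h \<and> Polynomial.degree d > 0"
  obtain d where d: "d dvd h" "Polynomial.degree d > 0"
    and least: "\<And>e. e dvd h \<Longrightarrow> Polynomial.degree e > 0 \<Longrightarrow> Polynomial.degree d \<le> Polynomial.degree e"
    using ex_has_least_nat[of ?P h Polynomial.degree] assms by auto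
  define r where "r = Polynomial.smult (inverse (Polynomial.lead_coeff d)) d"
  have d0: "d \<noteq> 0" using d(2) by auto
  have deg: "Polynomial.degree r = Polynomial.degree d" using d0 by (simp add: r_def)
  have "r dvd d" using d0 by (simp add: r_def smult_dvd_iff)
  then have rh: "r dvd h" using d(1) by (rule dvd_trans)
  have "Factorial_Ring.irreducible r"
  proof (rule Factorial_Ring.irreducibleI)
    show "r \<noteq> 0" using deg d(2) by auto
    then show "\<not> r dvd 1" using deg d(2) by (simp add: is_unit_iff_degree)
    fix x z assume xz: "r = x * z"
    then have nz: "x \<noteq> 0" "z \<noteq> 0" using \<open>r \<noteq> 0\<close> by auto
    have sum: "Polynomial.degree d = Polynomial.degree x + Polynomial.degree z"
      using deg nz by (simp add: xz degree_mult_eq)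
    have "x dvd h" using xz rh by (auto intro: dvd_trans)
    then have "Polynomial.degree x = 0 \<or> Polynomial.degree z = 0" using least[of x] sum by linarith
    then show "x dvd 1 \<or> z dvd 1" using nz by (auto simp: is_unit_iff_degree)
  qed
  moreover have "Polynomial.lead_coeff r = 1" using d0 by (simp add: r_def)
  ultimately show thesis using rh by (rule that)
qed

lemma split_off_power:
  fixes h r :: "'a::field poly"
  assumes "h \<noteq> 0" "Polynomial.degree r > 0" "r dvd h"
  obtains n S where "n \<ge> 1" "h = r ^ n * S" "\<not> r dvd S"
proof -
  have r0: "r \<noteq> 0" using assms(2) by auto
  have bound: "n \<le> Polynomial.degree h" if "r ^ n dvd h" for n
  proof -
    have "n * 1 \<le> n * Polynomial.degree r" using assms(2) by (intro mult_le_mono) auto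
    also have "\<dots> = Polynomial.degree (r ^ n)" using r0 by (simp add: degree_power_eq)
    also have "\<dots> \<le> Polynomial.degree h" using that assms(1) by (rule dvd_imp_degree_le)
    finally show ?thesis by simp
  qed
  define n where "n = (GREATEST n. r ^ n dvd h)"
  have n: "r ^ n dvd h" unfolding n_def
    by (rule GreatestI_nat[of "\<lambda>n. r ^ n dvd h" 0 "Polynomial.degree h"]) (auto intro: bound)
  have max: "k \<le> n" if "r ^ k dvd h" for k unfolding n_def
    by (rule Greatest_le_nat[of "\<lambda>n. r ^ n dvd h" k "Polynomial.degree h"]) (auto intro: bound that)
  obtain S where S: "h = r ^ n * S" using n by blast
  have "\<not> r dvd S"
  proof
    assume "r dvd S"
    then have "r ^ Suc n dvd h" unfolding S power_Suc2 by (rule mult_dvd_mono[OF dvd_refl])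
    then show False using max[of "Suc n"] by simp
  qed
  moreover have "n \<ge> 1" using max[of 1] assms(3) by simp
  ultimately show thesis using that S by blast
qed

lemma pcompose_qmap_monic:
  fixes r :: "'a::field poly"
  assumes "Polynomial.lead_coeff r = 1"
  shows "Polynomial.lead_coeff (pcompose (r ^ n) (qmap \<delta>)) = 1"
    and "Polynomial.degree (pcompose (r ^ n) (qmap \<delta>)) = 2 * n * Polynomial.degree r"
proof -
  have "r \<noteq> 0" using assms by auto
  have deg: "Polynomial.degree (qmap \<delta>) = 2" by (simp add: qmap_def)
  have lc: "Polynomial.lead_coeff (qmap \<delta>) = 1" by (simp add: qmap_def)
  have "Polynomial.lead_coeff (r ^ n) = 1" using assms by (simp add: lead_coeff_power)
  then show "Polynomial.lead_coeff (pcompose (r ^ n) (qmap \<delta>)) = 1"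
    using lead_coeff_comp[of "qmap \<delta>" "r ^ n"] deg lc by simp
  show "Polynomial.degree (pcompose (r ^ n) (qmap \<delta>)) = 2 * n * Polynomial.degree r"
    using \<open>r \<noteq> 0\<close> deg by (simp add: degree_pcompose degree_power_eq)
qed

lemma irreducible_degree_pos:
  fixes r :: "'a::field poly"
  assumes "Factorial_Ring.irreducible r"
  shows "Polynomial.degree r > 0"
proof (rule ccontr)
  assume "\<not> Polynomial.degree r > 0"
  moreover have "r \<noteq> 0" "\<not> r dvd 1" using assms by (auto simp: Factorial_Ring.irreducible_def)
  ultimately show False by (simp add: is_unit_iff_degree)
qed

context quadratics
begin

lemma rdpoly_nonzero: "rdpoly \<noteq> 0"
proof -
  have "Polynomial.degree (pcompose rdpoly0 (qmap \<delta>)) = 4"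
    by (simp only: degree_pcompose) (simp add: rdpoly0_def qmap_def)
  then show ?thesis unfolding pcompose_rdpoly0 by auto
qed

lemma bezout_rdpoly:
  assumes "root_set (pcompose r (qmap \<delta>)) \<inter> root_diffs [:\<alpha>, -\<tau>, 1:] [:\<beta>, -\<mu>, 1:] = {}"
  obtains k l where "k * pcompose r (qmap \<delta>) + l * rdpoly = 1"
proof (rule bezout_if_no_common_root[of "pcompose r (qmap \<delta>)" rdpoly])
  fix z assume "evac (pcompose r (qmap \<delta>)) z = 0" "evac rdpoly z = 0"
  then show False using assms unfolding root_diffs_eq root_set_def by blast
qed (rule that)

lemma sp_difference_of_symplectic_difference:
  fixes s :: "'a \<Rightarrow> 'v::ab_group_add \<Rightarrow> 'v"
  assumes "symplectic_difference [:\<alpha>, -\<tau>, 1:] [:\<beta>, -\<mu>, 1:] s V b u"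
  obtains a u2 where "sp_difference s V u \<tau> \<mu> \<alpha> \<beta> b a" "alternating_endo s V b u2"
    "\<And>x. x \<in> V \<Longrightarrow> u x = a x - u2 x"
    "\<And>x. x \<in> V \<Longrightarrow> poly_endo s [:\<alpha>, -\<tau>, 1:] a x = 0"
    "\<And>x. x \<in> V \<Longrightarrow> poly_endo s [:\<beta>, -\<mu>, 1:] u2 x = 0"
proof -
  obtain a u2 where au: "alternating_endo s V b a" "alternating_endo s V b u2"
    "\<And>x. x \<in> V \<Longrightarrow> u x = a x - u2 x"
    "\<And>x. x \<in> V \<Longrightarrow> poly_endo s [:\<alpha>, -\<tau>, 1:] a x = 0"
    "\<And>x. x \<in> V \<Longrightarrow> poly_endo s [:\<beta>, -\<mu>, 1:] u2 x = 0"
    using assms by (auto simp: symplectic_difference_def)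
  have sp: "symplectic_pair s V b u" using assms by (simp add: symplectic_difference_def)
  then have fd: "fd_space s V" and form: "symplectic_form s V b" and alt: "alternating_endo s V b u"
    by (auto simp: symplectic_pair_def)
  interpret vector_space s using fd by (simp add: fd_space_def)
  note sub = fd_space_subspace[OF fd]
  interpret U: endo_space s V u
    using sub alt by unfold_locales (simp_all add: alternating_endo_def)
  interpret A: endo_space s V a
    using sub au(1) by unfold_locales (simp_all add: alternating_endo_def)
  interpret U2: endo_space s V u2
    using sub au(2) by unfold_locales (simp_all add: alternating_endo_def)
  have aa: "a (a x) = s \<tau> (a x) - s \<alpha> x" if "x \<in> V" for x
    using au(4)[OF that] that
    by (simp add: A.pe_pCons A.endo_lin A.endo_0 A.endo_diff A.endo_neg add_eq_0_iff eq_neg_iff_add_eq_0 algebra_simps)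
  have u2u2: "u2 (u2 x) = s \<mu> (u2 x) - s \<beta> x" if "x \<in> V" for x
    using au(5)[OF that] that
    by (simp add: U2.pe_pCons U2.endo_lin U2.endo_0 U2.endo_diff U2.endo_neg add_eq_0_iff eq_neg_iff_add_eq_0 algebra_simps)
  have u2: "u2 x = a x - u x" if "x \<in> V" for x using au(3)[OF that] by simp
  have au_rel: "a (u x) = s \<delta> (a x) - u (a x) + U.pe kap x" if x: "x \<in> V" for x
  proof -
    have "a (a x - u x) - u (a x - u x) = s \<mu> (a x - u x) - s \<beta> x"
      using u2u2[OF x] x by (simp add: u2)
    then have "a (a x) - a (u x) - (u (a x) - u (u x)) = s \<mu> (a x) - s \<mu> (u x) - s \<beta> x"
      using x by (simp add: A.endo_diff U.endo_diff scale_right_diff_distrib)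
    then have "a (u x) = (s \<tau> (a x) - s \<alpha> x) - u (a x) + u (u x) - s \<mu> (a x) + s \<mu> (u x) + s \<beta> x"
      using aa[OF x] by (simp add: algebra_simps)
    moreover have kap: "U.pe kap x = s (\<beta> - \<alpha>) x + (s \<mu> (u x) + u (u x))"
      using x by (simp add: kap_def U.pe_pCons U.endo_lin U.endo_0)
    ultimately show ?thesis
      unfolding kap by (simp add: \<delta>_def scale_left_diff_distrib algebra_simps)
  qed
  have "sp_difference s V u \<tau> \<mu> \<alpha> \<beta> b a"
    using fd form alt au(1) aa au_rel by unfold_locales
  then show thesis using au by (intro that)
qed

end

context sp_difference
begin

lemma generated_differenceI:
  assumes "y \<in> V" "pe (pcompose R (qmap \<delta>)) y = 0"
    "\<And>f. (\<And>g. B y (pe (f * g) (a y)) = 0) \<Longrightarrow> pcompose R (qmap \<delta>) dvd f"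
  shows "generated_difference s V u \<tau> \<mu> \<alpha> \<beta> B a y R (pcompose R (qmap \<delta>))"
  using assms by unfold_locales auto

text \<open>A multiple \<open>f * reflect \<delta> f\<close> of an annihilating polynomial is a polynomial in
  \<open>t^2 - \<delta> t\<close>.\<close>

lemma exists_minimal_poly_qmap:
  assumes "V \<noteq> {0}"
  obtains h where "Polynomial.degree h > 0" "\<And>x. x \<in> V \<Longrightarrow> pe (pcompose h (qmap \<delta>)) x = 0"
    "\<And>k. k \<noteq> 0 \<Longrightarrow> Polynomial.degree k < Polynomial.degree h \<Longrightarrow> \<exists>x\<in>V. pe (pcompose k (qmap \<delta>)) x \<noteq> 0"
proof -
  let ?ann = "\<lambda>h. h \<noteq> 0 \<and> (\<forall>x\<in>V. pe (pcompose h (qmap \<delta>)) x = 0)"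
  obtain f where f: "f \<noteq> 0" "\<And>x. x \<in> V \<Longrightarrow> pe f x = 0"
    using exists_annihilating_poly[OF fd] by blast
  have "reflect \<delta> f \<noteq> 0" using f(1) by (metis reflect_hom(6) reflect_reflect)
  then have nz: "f * reflect \<delta> f \<noteq> 0" using f(1) by simp
  have "ddiff \<delta> (f * reflect \<delta> f) = 0" by (simp add: ddiff_mult ddiff_reflect algebra_simps)
  then obtain h0 where h0: "f * reflect \<delta> f = pcompose h0 (qmap \<delta>)" by (rule ddiff_eq_0_imp)
  have "pe (pcompose h0 (qmap \<delta>)) x = 0" if "x \<in> V" for x
    unfolding h0[symmetric] using f(2) that by (simp add: pe_mult)
  moreover have "h0 \<noteq> 0" using nz h0 by auto
  ultimately have "?ann h0" by blast
  then obtain h where h: "?ann h" "\<And>k. ?ann k \<Longrightarrow> Polynomial.degree h \<le> Polynomial.degree k"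
    using ex_has_least_nat[of ?ann h0 Polynomial.degree] by blast
  obtain x where x: "x \<in> V" "x \<noteq> 0" using assms mem(1) by blast
  have "Polynomial.degree h > 0"
  proof (rule ccontr)
    assume "\<not> Polynomial.degree h > 0"
    then have "Polynomial.degree h = 0" by simp
    then obtain c where c: "h = [:c:]" by (rule degree_eq_zeroE)
    then have "pe [:c:] x = 0" using h(1) x(1) by (metis pcompose_const)
    then show False using x c h(1) by simp
  qed
  moreover have "\<exists>x\<in>V. pe (pcompose k (qmap \<delta>)) x \<noteq> 0"
    if "k \<noteq> 0" "Polynomial.degree k < Polynomial.degree h" for k
    using h(2)[of k] that by (meson not_le)
  ultimately show thesis using h(1) by (intro that) blast+
qed

text \<open>A common root with \<open>rdpoly\<close> need not itself be an eigenvalue of u. But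
  \<open>rdpoly\<close> is a polynomial in t^2 - \<delta> t, so r and \<open>rdpoly0\<close> get a
  common root, r divides \<open>rdpoly0\<close>, and all of r(t^2 - \<delta> t) divides
  \<open>rdpoly\<close>. Thus \<open>rdpoly\<close> at u kills z, and some eigenvalue of u is a root
  difference.\<close>

lemma regular_imp_no_common_root:
  assumes reg: "pq_regular [:\<alpha>, -\<tau>, 1:] [:\<beta>, -\<mu>, 1:] s V u"
    and r: "Factorial_Ring.irreducible r" and z: "z \<in> V" "z \<noteq> 0" "pe (pcompose r (qmap \<delta>)) z = 0"
  shows "root_set (pcompose r (qmap \<delta>)) \<inter> root_diffs [:\<alpha>, -\<tau>, 1:] [:\<beta>, -\<mu>, 1:] = {}"
proof (rule ccontr)
  assume "\<not> ?thesis"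
  then obtain k where k: "evac (pcompose r (qmap \<delta>)) k = 0" "evac rdpoly k = 0"
    unfolding root_diffs_eq root_set_def by blast
  let ?\<rho> = "evac (qmap \<delta>) k"
  have "evac r ?\<rho> = 0" "evac rdpoly0 ?\<rho> = 0"
    using k by (simp_all add: evac_pcompose pcompose_rdpoly0[symmetric])
  then have "r dvd rdpoly0" by (rule irreducible_dvd_if_common_root[OF r])
  then obtain m where "rdpoly0 = r * m" by blast
  then have "rdpoly = pcompose r (qmap \<delta>) * pcompose m (qmap \<delta>)"
    unfolding pcompose_rdpoly0[symmetric] by (simp only: pcompose_mult)
  then have "pe rdpoly z = 0" using z by (intro pe_dvd[OF z(1,3)]) simp
  then obtain k' where k': "evac rdpoly k' = 0" "k' \<in> closure_eigenvalues s V u"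
    by (rule annihilated_closure_eigenvalue[OF fd z(1,2) rdpoly_nonzero])
  then show False using reg unfolding pq_regular_def root_diffs_eq by blast
qed

end

lemma (in quadratics) regular_indecomposable_is_extension:
  fixes s :: "'a \<Rightarrow> 'v::ab_group_add \<Rightarrow> 'v"
  defines "p \<equiv> [:\<alpha>, -\<tau>, 1:]" and "q \<equiv> [:\<beta>, -\<mu>, 1:]"
  assumes ind: "indecomposable_difference p q s V b u" and reg: "pq_regular p q s V u"
  obtains n r W where "n \<ge> 1" "Polynomial.lead_coeff r = 1" "Factorial_Ring.irreducible r"
    "root_set (pcompose r (qmap \<delta>)) \<inter> root_diffs p q = {}"
    "fd_space s W" "endo_on s W u" "represented_by s W u (companion (pcompose (r ^ n) (qmap \<delta>)))"
    "isometric s V b u (ext_scale s) (ext_space s W) ext_form (ext_endo W u)"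
proof -
  have sd: "symplectic_difference p q s V b u" and ntriv: "V \<noteq> {0}"
    using ind by (auto simp: indecomposable_difference_def)
  obtain a u2 where D: "sp_difference s V u \<tau> \<mu> \<alpha> \<beta> b a" and u2: "alternating_endo s V b u2"
    "\<And>x. x \<in> V \<Longrightarrow> u x = a x - u2 x"
    "\<And>x. x \<in> V \<Longrightarrow> poly_endo s [:\<alpha>, -\<tau>, 1:] a x = 0"
    "\<And>x. x \<in> V \<Longrightarrow> poly_endo s [:\<beta>, -\<mu>, 1:] u2 x = 0"
    by (rule sp_difference_of_symplectic_difference[OF sd[unfolded p_def q_def]]) (rule that)
  interpret sp_difference s V u \<tau> \<mu> \<alpha> \<beta> b a by (rule D)
  let ?W = "\<lambda>f. pcompose f (qmap \<delta>)"
  obtain h where h: "Polynomial.degree h > 0" "\<And>x. x \<in> V \<Longrightarrow> pe (?W h) x = 0"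
    "\<And>k. k \<noteq> 0 \<Longrightarrow> Polynomial.degree k < Polynomial.degree h \<Longrightarrow> \<exists>x\<in>V. pe (?W k) x \<noteq> 0"
    by (rule exists_minimal_poly_qmap[OF ntriv]) blast
  obtain r where r: "Factorial_Ring.irreducible r" "Polynomial.lead_coeff r = 1" "r dvd h"
    using exists_irreducible_factor[OF h(1)] by blast
  have rdeg: "Polynomial.degree r > 0" using irreducible_degree_pos[OF r(1)] .
  have "h \<noteq> 0" using h(1) by auto
  then obtain n S where nS: "n \<ge> 1" "h = r ^ n * S" "\<not> r dvd S"
    using split_off_power[OF _ rdeg r(3)] by blast
  \<comment> \<open>Its degree is below that of the minimal polynomial h of u^2 - \<delta> u, so it
    does not kill V. A nonzero value \<open>pe (?W ?c) x0\<close> is killed by r(u^2 - \<delta> u),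
    and regularity is applied to this vector.\<close>
  let ?c = "r ^ (n - 1) * S"
  have hc: "h = r * ?c" using nS(1,2) by (cases n) (simp_all add: mult.assoc)
  then have "?c \<noteq> 0" using \<open>h \<noteq> 0\<close> by auto
  moreover have "Polynomial.degree ?c < Polynomial.degree h"
  proof -
    have "r \<noteq> 0" using rdeg by auto
    then have "Polynomial.degree h = Polynomial.degree r + Polynomial.degree ?c"
      using \<open>?c \<noteq> 0\<close> by (subst hc) (rule degree_mult_eq)
    then show ?thesis using rdeg by simp
  qed
  ultimately obtain x0 where x0: "x0 \<in> V" "pe (?W ?c) x0 \<noteq> 0" using h(3) by blast
  have "pe (?W r) (pe (?W ?c) x0) = pe (?W h) x0"
    using x0(1) by (simp only: hc[symmetric] pe_mult[symmetric] pcompose_mult[symmetric])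
  then have "pe (?W r) (pe (?W ?c) x0) = 0" using h(2)[OF x0(1)] by simp
  then have roots: "root_set (?W r) \<inter> root_diffs p q = {}"
    unfolding p_def q_def
    by (intro regular_imp_no_common_root[OF reg[unfolded p_def q_def] r(1) pe_mem[OF x0(1)] x0(2)])
  obtain k l where kl: "k * ?W r + l * rdpoly = 1"
    by (rule bezout_rdpoly[OF roots[unfolded p_def q_def]])
  have ann: "pe (?W (r ^ n * S)) x = 0" if "x \<in> V" for x using h(2)[OF that] unfolding nS(2) .
  obtain y where y: "y \<in> V" "pe (?W (r ^ n)) y = 0"
    "\<And>f. (\<And>g. b y (pe (f * g) (a y)) = 0) \<Longrightarrow> ?W (r ^ n) dvd f"
    by (rule exists_generator[OF r(1) kl nS(3,1) ann x0]) (assumption, rule that, assumption, assumption, blast)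
  interpret generated_difference s V u \<tau> \<mu> \<alpha> \<beta> b a y "r ^ n" "?W (r ^ n)"
    using y by (rule generated_differenceI)
  note monic = pcompose_qmap_monic[OF r(2), of n \<delta>]
  have deg: "Polynomial.degree (?W (r ^ n)) > 0" unfolding monic(2) using rdeg nS(1) by simp
  have "y \<noteq> 0"
  proof
    assume "y = 0"
    then have "?W (r ^ n) dvd 1" using ann_y[of 1] by simp
    then show False using deg by (metis is_unit_iff_degree less_irrefl zero_neq_one dvd_0_left)
  qed
  moreover have "y \<in> gen" using genI[of 1 0] y(1) by simp
  ultimately have "gen \<noteq> {0}" by blast
  have u2_gen: "u2 x \<in> gen" if "x \<in> gen" for x
  proof -
    have "u2 x = a x - u x" using u2(2)[of x] gen_subset that by auto
    then show ?thesis using subspace_diff[OF gen_subspace gen_a[OF that] gen_endo[OF that]] by simp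
  qed
  have "gen = V"
    by (rule orthogonal_splitting[OF ind[unfolded p_def q_def] gen_subspace gen_subset \<open>gen \<noteq> {0}\<close> gen_nondegenerate
      alt_a u2(1) u2(2) u2(3) u2(4) gen_a u2_gen selfadjoint_a selfadjoint[OF u2(1)]])
  show thesis
  proof (rule that)
    show "fd_space s (cyc y)" by (rule fd_space_subspace_of[OF fd cyc_subspace[OF y(1)] cyc_subset[OF y(1)]])
    show "represented_by s (cyc y) u (companion (?W (r ^ n)))"
      by (rule represented_by_companion_cyc[OF y(1) monic(1) deg ann_y])
    show "isometric s V b u (ext_scale s) (ext_space s (cyc y)) ext_form (ext_endo (cyc y) u)"
      by (rule isometric_extension[OF \<open>gen = V\<close>])
  qed (fact nS(1) r roots cyc_endo[OF y(1)])+
qed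

section \<open>Symplectic extensions of cyclic endomorphisms\<close>

text \<open>Forms and maps are functions on the whole type. A structure transported along an
  embedding agrees with \<open>ext_form\<close> and \<open>ext_endo\<close> only on the extension
  space.\<close>

lemma symplectic_difference_cong:
  fixes s :: "'a::field \<Rightarrow> 'v::ab_group_add \<Rightarrow> 'v"
  assumes sd: "symplectic_difference p q s V b u"
    and b: "\<And>x y. x \<in> V \<Longrightarrow> y \<in> V \<Longrightarrow> b x y = b' x y" and u: "\<And>x. x \<in> V \<Longrightarrow> u x = u' x"
  shows "symplectic_difference p q s V b' u'"
proof -
  have fd: "fd_space s V" using sd by (simp add: symplectic_difference_def symplectic_pair_def)
  interpret vector_space s using fd by (simp add: fd_space_def)
  have mem: "x + y \<in> V" "s c x \<in> V" if "x \<in> V" "y \<in> V" for x y c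
    using fd_space_subspace[OF fd] that by (auto intro: subspace_add subspace_scale)
  have lin: "linear_on s (*) V f \<Longrightarrow> linear_on s (*) V g" if "\<And>x. x \<in> V \<Longrightarrow> f x = g x" for f g :: "'v \<Rightarrow> 'a"
    using that mem by (auto simp: linear_on_def)
  have "bilinear_on s V b'" if "bilinear_on s V b"
    unfolding bilinear_on_def
  proof (intro conjI ballI)
    show "linear_on s (*) V (b' x)" if "x \<in> V" for x
      using lin[of "b x" "b' x"] b that \<open>bilinear_on s V b\<close> by (simp add: bilinear_on_def)
    show "linear_on s (*) V (\<lambda>x. b' x y)" if "y \<in> V" for y
      using lin[of "\<lambda>x. b x y" "\<lambda>x. b' x y"] b that \<open>bilinear_on s V b\<close> by (simp add: bilinear_on_def)
  qed
  then have "symplectic_form s V b'"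
    using sd b by (simp add: symplectic_difference_def symplectic_pair_def symplectic_form_def)
  have alt: "alternating_endo s V b' w'"
    if w: "alternating_endo s V b w" and eq: "\<And>x. x \<in> V \<Longrightarrow> w x = w' x" for w w'
  proof -
    have wV: "w x \<in> V" if "x \<in> V" for x using w that by (auto simp: alternating_endo_def endo_on_def)
    have "linear_on s s V w'" using w eq mem by (auto simp: alternating_endo_def endo_on_def linear_on_def)
    moreover have "w' x \<in> V" "b' x (w' x) = 0" if "x \<in> V" for x
      using wV[OF that] eq[OF that] b[OF that wV[OF that]] w that by (auto simp: alternating_endo_def)
    ultimately show ?thesis by (auto simp: alternating_endo_def endo_on_def)
  qed
  have "symplectic_pair s V b' u'"
    using \<open>symplectic_form s V b'\<close> fd alt[of u u'] sd u
    by (simp add: symplectic_pair_def symplectic_difference_def)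
  moreover obtain u1 u2 where *: "alternating_endo s V b u1" "alternating_endo s V b u2"
      "\<forall>x\<in>V. u x = u1 x - u2 x"
      "\<forall>x\<in>V. poly_endo s p u1 x = 0" "\<forall>x\<in>V. poly_endo s q u2 x = 0"
    using sd by (auto simp: symplectic_difference_def)
  ultimately show ?thesis
    unfolding symplectic_difference_def using alt[OF *(1) refl] alt[OF *(2) refl] u *(3-5)
    by (intro conjI exI[of _ u1] exI[of _ u2]) auto
qed

text \<open>The coordinates of \<open>split_embedding\<close> below turn \<open>split_form\<close> into the form of the symplectic
  extension. The two quadratic endomorphisms are \<open>split_op s D \<tau> \<alpha>\<close> and
  \<open>split_op s (D - v) \<mu> \<alpha>\<close>, whose difference maps \<open>(x, y)\<close> to \<open>(v x, \<delta> y - v y)\<close>.\<close>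

definition split_form :: "('v \<Rightarrow> 'v \<Rightarrow> 'a::field) \<Rightarrow> 'v \<times> 'v \<Rightarrow> 'v \<times> 'v \<Rightarrow> 'a" where
  "split_form A z z' = A (fst z') (snd z) - A (fst z) (snd z')"

definition split_op :: "('a::field \<Rightarrow> 'v::ab_group_add \<Rightarrow> 'v) \<Rightarrow> ('v \<Rightarrow> 'v) \<Rightarrow> 'a \<Rightarrow> 'a \<Rightarrow> 'v \<times> 'v \<Rightarrow> 'v \<times> 'v" where
  "split_op s D l \<alpha> z = (D (fst z) - s \<alpha> (snd z), fst z + s l (snd z) - D (snd z))"

locale split_space = vector_space s for s :: "'a::field \<Rightarrow> 'v::ab_group_add \<Rightarrow> 'v" +
  fixes V A
  assumes fd: "fd_space s V" and form: "symplectic_form s V A"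
begin

lemma sub: "subspace V"
  using fd by (rule fd_space_subspace)

lemma mem [simp]:
  "0 \<in> V" "x \<in> V \<Longrightarrow> y \<in> V \<Longrightarrow> x + y \<in> V" "x \<in> V \<Longrightarrow> y \<in> V \<Longrightarrow> x - y \<in> V" "x \<in> V \<Longrightarrow> s c x \<in> V"
  using sub by (auto intro: subspace_0 subspace_add subspace_diff subspace_scale)

lemma A_lin:
  assumes "x \<in> V" "y \<in> V" "z \<in> V"
  shows "A (x + y) z = A x z + A y z" "A (s c x) z = c * A x z"
    "A z (x + y) = A z x + A z y" "A z (s c x) = c * A z x"
  using assms form by (auto simp: symplectic_form_def bilinear_on_def linear_on_def)

lemma A_diff:
  assumes "x \<in> V" "y \<in> V" "z \<in> V"
  shows "A (x - y) z = A x z - A y z" "A z (x - y) = A z x - A z y"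
  using A_lin(1)[of "x - y" y z] A_lin(3)[of "x - y" y z] assms by simp_all

lemma A_self: "x \<in> V \<Longrightarrow> A x x = 0"
  using form by (simp add: symplectic_form_def)

lemma A_antisym: "x \<in> V \<Longrightarrow> y \<in> V \<Longrightarrow> A x y = - A y x"
  by (rule symplectic_form_antisym[OF form _ sub]) unfold_locales

lemma A_zero: "z \<in> V \<Longrightarrow> A 0 z = 0" "z \<in> V \<Longrightarrow> A z 0 = 0"
  using A_diff[of z z z] by simp_all

lemma A_nondegenerate: "x \<in> V \<Longrightarrow> (\<And>y. y \<in> V \<Longrightarrow> A x y = 0) \<Longrightarrow> x = 0"
  using form by (simp add: symplectic_form_def)

sublocale ss: vector_space_prod s s ..

lemma fd_space_prod: "fd_space ss.scale (V \<times> V)"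
proof -
  obtain B where B: "finite B" "span B = V" using fd by (auto simp: fd_space_def)
  have p: "vector_space ss.scale" by unfold_locales
  have "linear_on s ss.scale (span B) (\<lambda>x. (x, 0))" "linear_on s ss.scale (span B) (\<lambda>x. (0, x))"
    by (auto simp: linear_on_def ss.scale_prod)
  note im = linear_on_span_image[OF p this(1)] linear_on_span_image[OF p this(2)]
  have "ss.p.span ((\<lambda>x. (x, 0)) ` B \<union> (\<lambda>x. (0, x)) ` B) = V \<times> V"
    unfolding ss.p.span_Un im B(2) by force
  then show ?thesis using B(1) p unfolding fd_space_def by (intro conjI exI) auto
qed

text \<open>By \<open>adj\<close>, l - D is the adjoint of D for A, so the two diagonal entries
  cancel in the form; the scalar entries off the diagonal contribute only A(x, x) and A(y,
  y).\<close>

lemma split_op_alternating: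
  assumes D: "endo_on s V D"
    and adj: "\<And>x y. x \<in> V \<Longrightarrow> y \<in> V \<Longrightarrow> A (D x) y + A x (D y) = l * A x y"
  shows "alternating_endo ss.scale (V \<times> V) (split_form A) (split_op s D l \<alpha>)"
proof -
  have DV [simp]: "D x \<in> V" if "x \<in> V" for x using D that by (auto simp: endo_on_def)
  have D_lin: "D (x + y) = D x + D y" "D (s c x) = s c (D x)" if "x \<in> V" "y \<in> V" for x y c
    using D that by (auto simp: endo_on_def linear_on_def)
  have "split_form A z (split_op s D l \<alpha> z) = 0" if "z \<in> V \<times> V" for z
  proof -
    obtain x y where z: "z = (x, y)" "x \<in> V" "y \<in> V" using \<open>z \<in> V \<times> V\<close> by auto
    then show ?thesis using adj[of x y]
      by (simp add: split_form_def split_op_def A_diff A_lin A_self algebra_simps)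
  qed
  moreover have "endo_on ss.scale (V \<times> V) (split_op s D l \<alpha>)"
    by (auto simp: endo_on_def linear_on_def split_op_def ss.scale_prod D_lin scale_right_distrib
        scale_right_diff_distrib algebra_simps)
  ultimately show ?thesis by (simp add: alternating_endo_def)
qed

text \<open>Cayley-Hamilton for the matrix with rows (D, -\<alpha>) and (1, l - D), whose entries
  commute: its trace is l and its determinant D (l - D) + \<alpha> equals \<alpha> - e.\<close>

lemma split_op_quadratic:
  assumes D: "endo_on s V D" and DD: "\<And>x. x \<in> V \<Longrightarrow> D (D x) = s l (D x) + s e x" and z: "z \<in> V \<times> V"
  shows "poly_endo ss.scale [:\<alpha> - e, - l, 1:] (split_op s D l \<alpha>) z = 0"
proof -
  have DV [simp]: "D x \<in> V" if "x \<in> V" for x using D that by (auto simp: endo_on_def)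
  have D_lin: "D (x + y) = D x + D y" "D (s c x) = s c (D x)" if "x \<in> V" "y \<in> V" for x y c
    using D that by (auto simp: endo_on_def linear_on_def)
  have D_diff: "D (x - y) = D x - D y" if "x \<in> V" "y \<in> V" for x y
    using D_lin(1)[of "x - y" y] that by (simp add: algebra_simps)
  obtain x y where xy: "z = (x, y)" "x \<in> V" "y \<in> V" using z by auto
  have "poly_endo ss.scale [:\<alpha> - e, - l, 1:] (split_op s D l \<alpha>) z
      = ss.scale (\<alpha> - e) z + ss.scale (- l) (split_op s D l \<alpha> z) + split_op s D l \<alpha> (split_op s D l \<alpha> z)"
    by (simp add: poly_endo_def numeral_2_eq_2)
  also have "\<dots> = 0"
    using xy(2,3) by (simp add: xy(1) split_op_def ss.scale_prod D_lin D_diff DD scale_left_diff_distrib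
        scale_right_distrib scale_right_diff_distrib zero_prod_def mult.commute)
  finally show ?thesis .
qed

lemma split_form_symplectic: "symplectic_form ss.scale (V \<times> V) (split_form A)"
proof -
  have "bilinear_on ss.scale (V \<times> V) (split_form A)"
    by (auto simp: bilinear_on_def linear_on_def split_form_def ss.scale_prod A_lin algebra_simps)
  moreover have "split_form A z z = 0" for z by (simp add: split_form_def)
  moreover have "z = 0" if z: "z \<in> V \<times> V" and *: "\<forall>w\<in>V \<times> V. split_form A z w = 0" for z
  proof -
    obtain x y where xy: "z = (x, y)" "x \<in> V" "y \<in> V" using z by auto
    have "A x w = 0" if "w \<in> V" for w
      using *[rule_format, of "(0, w)"] that xy by (simp add: split_form_def A_zero)
    moreover have "A y w = 0" if "w \<in> V" for w
      using *[rule_format, of "(w, 0)"] that xy A_antisym[of y w] by (simp add: split_form_def A_zero)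
    ultimately show ?thesis using A_nondegenerate xy by (simp add: zero_prod_def)
  qed
  ultimately show ?thesis by (auto simp: symplectic_form_def)
qed

definition J :: "'v \<Rightarrow> 'v \<Rightarrow> 'a" where
  "J y = (\<lambda>x. if x \<in> V then A x y else 0)"

lemma J_lin: "x \<in> V \<Longrightarrow> y \<in> V \<Longrightarrow> J (x + y) = J x + J y" "x \<in> V \<Longrightarrow> J (s c x) = fun_scale c (J x)"
  by (auto simp: J_def fun_eq_iff fun_scale_def A_lin)

lemma J_inj: "x \<in> V \<Longrightarrow> y \<in> V \<Longrightarrow> J x = J y \<Longrightarrow> x = y"
proof -
  assume xy: "x \<in> V" "y \<in> V" "J x = J y"
  have "A (x - y) z = 0" if "z \<in> V" for z
    using fun_cong[OF xy(3), of z] that xy A_antisym[of "x - y" z] by (simp add: J_def A_diff)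
  then have "x - y = 0" using xy by (intro A_nondegenerate) auto
  then show "x = y" by simp
qed

lemma J_image: "J ` V = dual_space s V"
proof
  show "J ` V \<subseteq> dual_space s V"
    by (auto simp: J_def dual_space_def linear_on_def A_lin)
  show "dual_space s V \<subseteq> J ` V"
  proof
    fix \<phi> assume \<phi>: "\<phi> \<in> dual_space s V"
    then have lin: "linear_on s (*) V \<phi>" by (simp add: dual_space_def)
    have bil: "bilinear_on s V A" using form by (simp add: symplectic_form_def)
    have nd: "x = 0" if "x \<in> V" "\<And>z. z \<in> V \<Longrightarrow> A z x = 0" for x
      using that A_antisym[of x] by (intro A_nondegenerate) auto
    obtain y where y: "y \<in> V" "\<And>x. x \<in> V \<Longrightarrow> A y x = \<phi> x"
      using bilinear_represent[OF fd bil sub subset_refl lin] nd by blast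
    \<comment> \<open>The representing vector y enters A as first argument, whereas J puts its
      vector second; antisymmetry costs the sign.\<close>
    have "J (s (- 1) y) x = \<phi> x" for x
    proof (cases "x \<in> V")
      case True
      then have "J (s (- 1) y) x = - 1 * A x y"
        unfolding J_def using A_lin(4)[OF y(1) y(1) True, of "- 1"] by simp
      also have "\<dots> = \<phi> x" using y True A_antisym[of x y] by simp
      finally show ?thesis .
    next
      case False
      then show ?thesis using \<phi> by (simp add: J_def dual_space_def)
    qed
    then have "J (s (- 1) y) = \<phi>" ..
    moreover have "s (- 1) y \<in> V" using y(1) by (rule mem)
    ultimately show "\<phi> \<in> J ` V" by (metis image_eqI)
  qed
qed

definition split_embedding :: "'v \<times> 'v \<Rightarrow> 'v \<times> ('v \<Rightarrow> 'a)" where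
  "split_embedding z = (fst z, J (snd z))"

lemma split_embedding_image: "split_embedding ` (V \<times> V) = ext_space s V"
proof -
  have "split_embedding = map_prod id J" by (auto simp: split_embedding_def fun_eq_iff)
  then show ?thesis unfolding ext_space_def J_image[symmetric] by (simp add: map_prod_surj_on)
qed

lemma vector_space_fun_scale: "vector_space (fun_scale :: 'a \<Rightarrow> ('v \<Rightarrow> 'a) \<Rightarrow> _)"
  by unfold_locales (auto simp: fun_scale_def fun_eq_iff algebra_simps)

lemma ext_vector_space: "vector_space (ext_scale s)"
proof -
  interpret f: vector_space "fun_scale :: 'a \<Rightarrow> ('v \<Rightarrow> 'a) \<Rightarrow> _" by (rule vector_space_fun_scale)
  interpret sf: vector_space_prod s "fun_scale :: 'a \<Rightarrow> ('v \<Rightarrow> 'a) \<Rightarrow> _" ..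
  show ?thesis unfolding ext_scale_def by unfold_locales
qed

lemma ext_scale_pair: "ext_scale s c (x, \<phi>) = (s c x, fun_scale c \<phi>)"
proof -
  interpret f: vector_space "fun_scale :: 'a \<Rightarrow> ('v \<Rightarrow> 'a) \<Rightarrow> _" by (rule vector_space_fun_scale)
  interpret sf: vector_space_prod s "fun_scale :: 'a \<Rightarrow> ('v \<Rightarrow> 'a) \<Rightarrow> _" ..
  show ?thesis unfolding ext_scale_def by (rule sf.scale_prod)
qed

lemma linear_split_embedding: "linear_on ss.scale (ext_scale s) (V \<times> V) split_embedding"
  by (auto simp: linear_on_def split_embedding_def J_lin ss.scale_prod ext_scale_pair)

text \<open>For D, \<open>split_op_quadratic\<close> applies with e = 0 and gives p. By
  \<open>DD\<close> and \<open>Dv\<close>, E = D - v satisfies E^2 = \<mu> E + (\<alpha> - \<beta>),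
  so the same \<alpha> in the operator leads to the constant term \<beta> of q. Sharing \<alpha>
  cancels the entries off the diagonal in the difference.\<close>

lemma extension_symplectic_difference:
  assumes v: "endo_on s V v" and D: "endo_on s V D"
    and v_adj: "\<And>x y. x \<in> V \<Longrightarrow> y \<in> V \<Longrightarrow> A (v x) y + A x (v y) = (\<tau> - \<mu>) * A x y"
    and D_adj: "\<And>x y. x \<in> V \<Longrightarrow> y \<in> V \<Longrightarrow> A (D x) y + A x (D y) = \<tau> * A x y"
    and DD: "\<And>x. x \<in> V \<Longrightarrow> D (D x) = s \<tau> (D x)"
    and Dv: "\<And>x. x \<in> V \<Longrightarrow> D (v x) + v (D x)
      = s (\<tau> - \<mu>) (D x) + (s \<mu> (v x) + v (v x) + s (\<beta> - \<alpha>) x)"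
  shows "symplectic_difference [:\<alpha>, -\<tau>, 1:] [:\<beta>, -\<mu>, 1:] (ext_scale s) (ext_space s V) ext_form (ext_endo V v)"
proof -
  have vV [simp]: "v x \<in> V" "D x \<in> V" if "x \<in> V" for x using v D that by (auto simp: endo_on_def)
  have v_lin: "v (x + y) = v x + v y" "v (s c x) = s c (v x)" if "x \<in> V" "y \<in> V" for x y c
    using v that by (auto simp: endo_on_def linear_on_def)
  have D_lin: "D (x + y) = D x + D y" "D (s c x) = s c (D x)" if "x \<in> V" "y \<in> V" for x y c
    using D that by (auto simp: endo_on_def linear_on_def)
  have diff: "v (x - y) = v x - v y" "D (x - y) = D x - D y" if "x \<in> V" "y \<in> V" for x y
    using v_lin(1)[of "x - y" y] D_lin(1)[of "x - y" y] that by (simp_all add: algebra_simps)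
  define E where "E = (\<lambda>x. D x - v x)"
  have E: "endo_on s V E"
    by (auto simp: E_def endo_on_def linear_on_def v_lin D_lin scale_right_diff_distrib)
  have E_adj: "A (E x) y + A x (E y) = \<mu> * A x y" if "x \<in> V" "y \<in> V" for x y
    using v_adj[OF that] D_adj[OF that] that by (simp add: E_def A_diff algebra_simps)
  have EE: "E (E x) = s \<mu> (E x) + s (\<alpha> - \<beta>) x" if x: "x \<in> V" for x
  proof -
    have "E (E x) = D (D x) - (D (v x) + v (D x)) + v (v x)"
      using x by (simp add: E_def diff algebra_simps)
    also have "\<dots> = s \<mu> (E x) + s (\<alpha> - \<beta>) x"
      unfolding DD[OF x] Dv[OF x] by (simp add: E_def scale_left_diff_distrib scale_right_diff_distrib algebra_simps)
    finally show ?thesis .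
  qed
  let ?a = "split_op s D \<tau> \<alpha>" and ?b = "split_op s E \<mu> \<alpha>"
  define w where "w = (\<lambda>z. ?a z - ?b z)"
  have alt: "alternating_endo ss.scale (V \<times> V) (split_form A) ?a"
    "alternating_endo ss.scale (V \<times> V) (split_form A) ?b"
    by (rule split_op_alternating[OF D D_adj] split_op_alternating[OF E E_adj]; assumption)+
  have w: "w (x, y) = (v x, s (\<tau> - \<mu>) y - v y)" for x y
    by (simp add: w_def split_op_def E_def scale_left_diff_distrib)
  have "split_form A z (w z) = 0" if z: "z \<in> V \<times> V" for z
  proof -
    obtain x y where "z = (x, y)" "x \<in> V" "y \<in> V" using z by auto
    then show ?thesis using v_adj[of x y] by (simp add: w split_form_def A_diff A_lin algebra_simps)
  qed
  moreover have "endo_on ss.scale (V \<times> V) w"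
    unfolding endo_on_def
  proof
    show "linear_on ss.scale ss.scale (V \<times> V) w"
      by (auto simp: linear_on_def w ss.scale_prod v_lin scale_right_distrib
        scale_right_diff_distrib mult.commute)
    show "w ` (V \<times> V) \<subseteq> V \<times> V" by (auto simp: w)
  qed
  ultimately have pair: "symplectic_pair ss.scale (V \<times> V) (split_form A) w"
    using fd_space_prod split_form_symplectic by (simp add: symplectic_pair_def alternating_endo_def)
  have "poly_endo ss.scale [:\<alpha>, -\<tau>, 1:] ?a z = 0" if "z \<in> V \<times> V" for z
    using split_op_quadratic[OF D _ that, of \<tau> 0 \<alpha>] DD by simp
  moreover have "poly_endo ss.scale [:\<beta>, -\<mu>, 1:] ?b z = 0" if "z \<in> V \<times> V" for z
    using split_op_quadratic[OF E EE that, of \<alpha>] by simp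
  ultimately have sd: "symplectic_difference [:\<alpha>, -\<tau>, 1:] [:\<beta>, -\<mu>, 1:] ss.scale (V \<times> V) (split_form A) w"
    unfolding symplectic_difference_def using pair alt
    by (intro conjI exI[of _ ?a] exI[of _ ?b]) (auto simp: w_def)
  define K where "K = the_inv_into V J"
  have KJ: "K (J y) = y" if "y \<in> V" for y
    unfolding K_def using J_inj that by (intro the_inv_into_f_f) (auto simp: inj_on_def)
  interpret emb: space_embedding ss.scale "V \<times> V" "ext_scale s" split_embedding "map_prod id K"
    by (rule space_embedding.intro[OF fd_space_prod ext_vector_space linear_split_embedding])
      (auto simp: split_embedding_def KJ)
  show ?thesis
  proof (rule symplectic_difference_cong)
    show "symplectic_difference [:\<alpha>, -\<tau>, 1:] [:\<beta>, -\<mu>, 1:] (ext_scale s) (ext_space s V)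
        (\<lambda>x y. split_form A (map_prod id K x) (map_prod id K y))
        (\<lambda>x. split_embedding (w (map_prod id K x)))"
      using emb.symplectic_difference_image[OF sd] unfolding split_embedding_image .
    fix x' assume "x' \<in> ext_space s V"
    then obtain x y where x': "x' = (x, J y)" "x \<in> V" "y \<in> V"
      unfolding split_embedding_image[symmetric] by (auto simp: split_embedding_def)
    show "split_embedding (w (map_prod id K x')) = ext_endo V v x'"
    proof -
      have "J (s (\<tau> - \<mu>) y - v y) = transpose_on V v (J y)"
        using x'(3)
        by (auto simp: transpose_on_def J_def fun_eq_iff A_diff A_lin v_adj[symmetric])
      then show ?thesis using x' by (simp add: KJ w split_embedding_def ext_endo_def)
    qed
    fix y' assume "y' \<in> ext_space s V"
    then obtain z t where y': "y' = (z, J t)" "z \<in> V" "t \<in> V"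
      unfolding split_embedding_image[symmetric] by (auto simp: split_embedding_def)
    show "split_form A (map_prod id K x') (map_prod id K y') = ext_form x' y'"
      using x' y' by (simp add: KJ split_form_def ext_form_def) (simp add: J_def)
  qed
qed

lemma ext_endo_J:
  assumes "\<And>x. x \<in> V \<Longrightarrow> v x \<in> V" "\<And>x y. x \<in> V \<Longrightarrow> y \<in> V \<Longrightarrow> A (v x) y + A x (v y) = \<delta> * A x y" "y \<in> V"
  shows "ext_endo V v (x, J y) = (v x, J (s \<delta> y - v y))"
  using assms(1,3)
  by (auto simp: ext_endo_def transpose_on_def J_def fun_eq_iff A_diff A_lin assms(2)[symmetric])

text \<open>The upper bound on the dimension of the extension, against which
  \<open>generated_difference_no_complement\<close> sets an independent family.\<close>

lemma ext_space_span:
  assumes "finite E" "span E = V"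
  obtains F where "finite F" "card F \<le> 2 * card E" "Modules.module.span (ext_scale s) F = ext_space s V"
proof -
  interpret x: vector_space "ext_scale s" by (rule ext_vector_space)
  have J0: "J 0 = 0" using J_lin(2)[of 0 0] by (simp add: fun_scale_def fun_eq_iff)
  have "linear_on s (ext_scale s) (span E) (\<lambda>x. (x, 0))" "linear_on s (ext_scale s) (span E) (\<lambda>x. (0, J x))"
    unfolding assms(2) by (auto simp: linear_on_def ext_scale_pair J_lin) (simp_all add: fun_scale_def fun_eq_iff)
  note im = linear_on_span_image[OF ext_vector_space this(1)] linear_on_span_image[OF ext_vector_space this(2)]
  let ?F = "(\<lambda>x. (x, 0)) ` E \<union> (\<lambda>x. (0, J x)) ` E"
  have "x.span ?F = ext_space s V"
    unfolding x.span_Un im assms(2) split_embedding_image[symmetric] by (force simp: split_embedding_def)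
  moreover have "card ?F \<le> card E + card E"
    by (rule order.trans[OF card_Un_le add_mono]) (simp_all add: card_image_le assms(1))
  ultimately show thesis using assms(1) by (intro that[of ?F]) auto
qed

end

lemma (in split_space) J_0: "J 0 = 0"
  by (rule ext) (simp add: J_def A_zero)

section \<open>The form and the operator D on a cyclic space F[t]/P\<close>

locale cyclic_endo = endo_space s V v + quadratics \<tau> \<mu> \<alpha> \<beta>
  for s :: "'a::field \<Rightarrow> 'v::ab_group_add \<Rightarrow> 'v" (infixr "*s" 75) and V v and \<tau> \<mu> \<alpha> \<beta> :: 'a +
  fixes y R P
  assumes fd: "fd_space s V" and y: "y \<in> V" and cyc: "cyc y = V"
    and ann: "pe f y = 0 \<longleftrightarrow> P dvd f"
    and P: "P = pcompose R (qmap \<delta>)" and R: "Polynomial.degree R > 0"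
begin

text \<open>An arbitrary representative in F[t] of an element of F[t]/P. D and A are defined through
  it; \<open>D_pe\<close> and \<open>A_pe\<close> show that the choice does not matter.\<close>

definition rep :: "'v \<Rightarrow> 'a poly" where "rep x = (SOME f. pe f y = x)"

lemma rep: "x \<in> V \<Longrightarrow> pe (rep x) y = x"
  using cyc unfolding rep_def cyc_def by (metis (mono_tags, lifting) imageE someI)

lemma rep_dvd: "P dvd rep (pe f y) - f"
  using y by (simp add: ann[symmetric] pe_diff rep)

lemma pe_cases:
  assumes "x \<in> V"
  obtains f where "x = pe f y"
  using rep[OF assms] by metis

lemma reflect_P: "reflect \<delta> P = P"
  by (simp add: P)

text \<open>P is a polynomial in t^2 - \<delta> t, over which \<open>ddiff \<delta>\<close> is
  linear; hence divided differences descend to F[t]/P.\<close>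

lemma ddiff_dvd: "P dvd f \<Longrightarrow> P dvd ddiff \<delta> f"
proof -
  assume "P dvd f"
  then obtain g where "f = P * g" by blast
  then have "ddiff \<delta> f = P * ddiff \<delta> g" by (simp add: ddiff_mult reflect_P) (simp add: P)
  then show ?thesis by simp
qed

lemma reflect_dvd: "P dvd f \<Longrightarrow> P dvd reflect \<delta> f"
proof -
  assume "P dvd f"
  then obtain g where "f = P * g" by blast
  then have "reflect \<delta> f = P * reflect \<delta> g" by (simp add: reflect_hom reflect_P)
  then show ?thesis by simp
qed

lemma ddiff_diff: "ddiff \<delta> (f - g) = ddiff \<delta> f - ddiff \<delta> g"
  using ddiff_add[of \<delta> "f - g" g] by (simp add: algebra_simps)

text \<open>Modelled on \<open>a_pe\<close>: the component along F[u] y of a applied to f(u)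
  y.\<close>

definition D :: "'v \<Rightarrow> 'v" where "D x = pe (kap * ddiff \<delta> (rep x)) y"

lemma D_pe: "D (pe f y) = pe (kap * ddiff \<delta> f) y"
proof -
  have "P dvd kap * ddiff \<delta> (rep (pe f y)) - kap * ddiff \<delta> f"
    unfolding right_diff_distrib[symmetric] ddiff_diff[symmetric]
    by (intro dvd_mult ddiff_dvd rep_dvd)
  then have "pe (kap * ddiff \<delta> (rep (pe f y)) - kap * ddiff \<delta> f) y = 0" by (simp only: ann)
  then show ?thesis using y by (simp add: D_def pe_diff)
qed

text \<open>\<open>top_coeff P\<close> stands in for the functional f |-> B(y, f(u) a y). The
  reflection of the second factor makes A alternating, since f * reflect \<delta> f lies in
  F[t^2 - \<delta> t], where \<open>top_coeff P\<close> vanishes.\<close>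

definition A :: "'v \<Rightarrow> 'v \<Rightarrow> 'a" where "A x x' = top_coeff P (rep x * reflect \<delta> (rep x'))"

lemma A_pe: "A (pe f y) (pe g y) = top_coeff P (f * reflect \<delta> g)"
proof -
  let ?f = "rep (pe f y)" and ?g = "rep (pe g y)"
  have "?f * reflect \<delta> ?g - f * reflect \<delta> g = (?f - f) * reflect \<delta> ?g + f * reflect \<delta> (?g - g)"
    by (simp add: reflect_hom algebra_simps)
  also have "P dvd \<dots>" using rep_dvd[of f] reflect_dvd[OF rep_dvd[of g]] by (intro dvd_add dvd_mult dvd_mult2)
  finally show ?thesis unfolding A_def using top_coeff_dvd top_coeff_diff by (metis right_minus_eq)
qed

lemma top_coeff_ddiff: "ddiff \<delta> f = 0 \<Longrightarrow> top_coeff P f = 0"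
  by (erule ddiff_eq_0_imp) (simp add: P top_coeff_pcompose_qmap R)

lemma A_symplectic: "symplectic_form s V A"
proof -
  have lin: "A (x + z) t = A x t + A z t" "A (c *s x) t = c * A x t"
    "A t (x + z) = A t x + A t z" "A t (c *s x) = c * A t x" if "x \<in> V" "z \<in> V" "t \<in> V" for x z t c
  proof -
    define f g h where "f = rep x" and "g = rep z" and "h = rep t"
    then have fgh: "x = pe f y" "z = pe g y" "t = pe h y"
      using that by (simp_all add: rep)
    have "x + z = pe (f + g) y" "c *s x = pe ([:c:] * f) y"
      using y by (simp_all only: fgh pe_add pe_const_mult)
    moreover have "h * reflect \<delta> ([:c:] * f) = [:c:] * (h * reflect \<delta> f)"
      unfolding reflect_hom by (rule mult.left_commute)
    ultimately show "A (x + z) t = A x t + A z t" "A (c *s x) t = c * A x t"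
      "A t (x + z) = A t x + A t z" "A t (c *s x) = c * A t x"
      unfolding fgh by (simp_all only: A_pe reflect_hom distrib_left distrib_right top_coeff_add
          mult.assoc top_coeff_const_mult)
  qed
  have "A x x = 0" if x: "x \<in> V" for x
  proof -
    obtain f where "x = pe f y" using x by (rule pe_cases)
    moreover have "ddiff \<delta> (f * reflect \<delta> f) = 0" by (simp add: ddiff_mult ddiff_reflect algebra_simps)
    ultimately show ?thesis by (simp add: A_pe top_coeff_ddiff)
  qed
  moreover have "x = 0" if x: "x \<in> V" and *: "\<forall>z\<in>V. A x z = 0" for x
  proof -
    obtain f where f: "x = pe f y" using x by (rule pe_cases)
    have "top_coeff P (f * g) = 0" for g
      using *[rule_format, of "pe (reflect \<delta> g) y"] y by (simp add: f A_pe)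
    moreover have "Polynomial.degree P > 0"
      unfolding P degree_pcompose using R by (simp add: qmap_def)
    ultimately have "P dvd f" by (intro top_coeff_nondegenerate)
    then show ?thesis by (simp add: f ann)
  qed
  ultimately show ?thesis
    using lin by (simp add: symplectic_form_def bilinear_on_def linear_on_def)
qed

lemma v_pe: "v (pe f y) = pe ([:0, 1:] * f) y"
  using y by (simp add: pe_pCons)

text \<open>Because t and its reflection \<delta> - t add up to \<delta>.\<close>

lemma v_adjoint:
  assumes "x \<in> V" "z \<in> V"
  shows "A (v x) z + A x (v z) = \<delta> * A x z"
proof -
  define f g where "f = rep x" and "g = rep z"
  then have fg: "x = pe f y" "z = pe g y" using assms by (simp_all add: rep)
  have r: "reflect \<delta> [:0, 1:] = [:\<delta>:] - [:0, 1:]" by (simp add: reflect_def pcompose_pCons)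
  have "[:0, 1:] * f * reflect \<delta> g + f * reflect \<delta> ([:0, 1:] * g) = [:\<delta>:] * (f * reflect \<delta> g)"
    unfolding reflect_hom(3) r by (simp only: left_diff_distrib right_diff_distrib ac_simps) simp
  then show ?thesis
    unfolding fg v_pe A_pe top_coeff_add[symmetric] by (simp only: top_coeff_const_mult)
qed

text \<open>The difference of both sides is \<open>top_coeff P\<close> of E. Expanding the
  reflection of kap and using N * ddiff \<delta> g = reflect \<delta> g - g turns E into kap * ddiff
  \<delta> (f * g) - \<tau> f g. Since kap has divided difference \<tau>, this has divided
  difference 0, so E lies in F[t^2 - \<delta> t].\<close>

lemma D_adjoint:
  assumes "x \<in> V" "z \<in> V"
  shows "A (D x) z + A x (D z) = \<tau> * A x z"
proof -
  define f g where "f = rep x" and "g = rep z"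
  then have fg: "x = pe f y" "z = pe g y" using assms by (simp_all add: rep)
  define N where "N = [:\<delta>, -2:]"
  define Y where "Y = f * ddiff \<delta> g + ddiff \<delta> f * reflect \<delta> g"
  define E where "E = kap * ddiff \<delta> f * reflect \<delta> g + f * reflect \<delta> (kap * ddiff \<delta> g)
    - [:\<tau>:] * (f * reflect \<delta> g)"
  have rd: "reflect \<delta> (ddiff \<delta> h) = ddiff \<delta> h" for h by (simp add: reflect_eq)
  have rN: "reflect \<delta> h = h + N * ddiff \<delta> h" for h unfolding N_def by (rule reflect_eq)
  have rk: "reflect \<delta> kap = kap + [:\<tau>:] * N" by (simp add: reflect_kap N_def)
  have Y0: "ddiff \<delta> Y = 0" by (simp add: Y_def ddiff_add ddiff_mult ddiff_reflect rd)
  have "f * reflect \<delta> (kap * ddiff \<delta> g) = kap * (f * ddiff \<delta> g) + [:\<tau>:] * (f * (N * ddiff \<delta> g))"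
    unfolding reflect_hom(3) rd rk by (simp only: ring_distribs ac_simps)
  also have "N * ddiff \<delta> g = reflect \<delta> g - g" by (simp add: rN)
  finally have "E = kap * Y - [:\<tau>:] * (f * g)"
    unfolding E_def Y_def by (simp only: ring_distribs ac_simps left_diff_distrib right_diff_distrib) simp
  moreover have "ddiff \<delta> (kap * Y) = [:\<tau>:] * Y" by (simp only: ddiff_mult ddiff_kap Y0) simp
  moreover have "ddiff \<delta> ([:\<tau>:] * (f * g)) = [:\<tau>:] * ddiff \<delta> (f * g)"
    by (simp only: ddiff_mult[of \<delta> "[:\<tau>:]"] ddiff_const reflect_hom) simp
  moreover have "Y = ddiff \<delta> (f * g)"
    unfolding ddiff_mult Y_def rN by (simp only: ring_distribs ac_simps)
  ultimately have "ddiff \<delta> E = 0" by (simp only: ddiff_diff) simp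
  then have "top_coeff P E = 0" by (rule top_coeff_ddiff)
  then show ?thesis
    unfolding fg D_pe A_pe E_def by (simp only: top_coeff_diff top_coeff_add top_coeff_const_mult) simp
qed

lemma D_endo: "endo_on s V D"
proof -
  have "D (x + z) = D x + D z" "D (c *s x) = c *s D x" if "x \<in> V" "z \<in> V" for x z c
  proof -
    define f g where "f = rep x" and "g = rep z"
    then have fg: "x = pe f y" "z = pe g y" using that by (simp_all add: rep)
    have xz: "x + z = pe (f + g) y" "c *s x = pe ([:c:] * f) y"
      using y by (simp_all only: fg pe_add pe_const_mult)
    show "D (x + z) = D x + D z"
      unfolding xz unfolding fg D_pe ddiff_add distrib_left using y by (rule pe_add)
    have "kap * ddiff \<delta> ([:c:] * f) = [:c:] * (kap * ddiff \<delta> f)"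
      by (simp only: ddiff_mult ddiff_const reflect_hom mult_zero_left add_0 mult.left_commute)
    then show "D (c *s x) = c *s D x"
      unfolding xz unfolding fg D_pe using y by (simp only: pe_const_mult)
  qed
  moreover have "D x \<in> V" if "x \<in> V" for x unfolding D_def using y by simp
  ultimately show ?thesis by (auto simp: endo_on_def linear_on_def)
qed

lemma D_D: "x \<in> V \<Longrightarrow> D (D x) = \<tau> *s D x"
proof -
  assume "x \<in> V"
  then obtain f where f: "x = pe f y" by (rule pe_cases)
  have "kap * ddiff \<delta> (kap * ddiff \<delta> f) = [:\<tau>:] * (kap * ddiff \<delta> f)"
    unfolding ddiff_mult[of \<delta> kap] ddiff_kap ddiff_ddiff by (simp only: mult_zero_right add_0_right mult.left_commute)
  then show ?thesis unfolding f D_pe using y by (simp only: pe_const_mult)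
qed

lemma D_v:
  assumes "x \<in> V"
  shows "D (v x) + v (D x) = \<delta> *s D x + (\<mu> *s v x + v (v x) + (\<beta> - \<alpha>) *s x)"
proof -
  obtain f where f: "x = pe f y" using assms by (rule pe_cases)
  have x: "[:0, 1:] * f = pCons 0 f" by simp
  have "D (v x) + v (D x) = pe (kap * ddiff \<delta> ([:0, 1:] * f) + [:0, 1:] * (kap * ddiff \<delta> f)) y"
    unfolding f v_pe D_pe using y by (simp only: pe_add)
  also have "kap * ddiff \<delta> ([:0, 1:] * f) + [:0, 1:] * (kap * ddiff \<delta> f)
      = kap * f + kap * (([:\<delta>, -1:] + [:0, 1:]) * ddiff \<delta> f)"
    unfolding x ddiff_pCons by (simp only: ring_distribs ac_simps)
  also have "[:\<delta>, -1:] + [:0, 1:] = [:\<delta>:]" by simp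
  also have "kap * f + kap * ([:\<delta>:] * ddiff \<delta> f) = [:\<delta>:] * (kap * ddiff \<delta> f) + kap * f"
    by (simp only: ac_simps)
  also have "pe \<dots> y = \<delta> *s D x + pe kap x"
    unfolding f D_pe using y by (simp only: pe_add pe_const_mult pe_mult[of y kap f])
  also have "pe kap x = \<mu> *s v x + v (v x) + (\<beta> - \<alpha>) *s x"
    using assms by (simp add: kap_def pe_pCons endo_lin endo_0)
  finally show ?thesis .
qed

sublocale split: split_space s V A
  using fd A_symplectic by unfold_locales

lemma extension_difference:
  "symplectic_difference [:\<alpha>, -\<tau>, 1:] [:\<beta>, -\<mu>, 1:] (ext_scale s) (ext_space s V) ext_form (ext_endo V v)"
  by (rule split.extension_symplectic_difference[OF endo D_endo v_adjoint[unfolded \<delta>_def]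
    D_adjoint D_D D_v[unfolded \<delta>_def]])

text \<open>Under J the transpose of v becomes \<delta> - v, and polynomials in \<delta> - v are
  reflected polynomials in v.\<close>

lemma extension_pe:
  assumes "x \<in> V" "z \<in> V"
  shows "poly_endo (ext_scale s) h (ext_endo V v) (x, split.J z) = (pe h x, split.J (pe (reflect \<delta> h) z))"
proof -
  have fdX: "fd_space (ext_scale s) (ext_space s V)" and U: "endo_on (ext_scale s) (ext_space s V) (ext_endo V v)"
    using extension_difference by (auto simp: symplectic_difference_def symplectic_pair_def alternating_endo_def)
  interpret Z: vector_space "ext_scale s" by (rule split.ext_vector_space)
  interpret Z: endo_space "ext_scale s" "ext_space s V" "ext_endo V v"
    using fd_space_subspace[OF fdX] U by unfold_locales
  have mem: "(x, split.J z) \<in> ext_space s V"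
    using assms by (auto simp: ext_space_def split.J_image[symmetric])
  show ?thesis
  proof (induction h)
    case 0
    show ?case by (simp add: reflect_hom split.J_0 zero_prod_def zero_fun_def)
  next
    case (pCons c h)
    have refl: "pe (reflect \<delta> (pCons c h)) z = c *s z + (\<delta> *s pe (reflect \<delta> h) z - v (pe (reflect \<delta> h) z))"
      unfolding reflect_pCons using assms
      by (simp only: pe_add pe_const pe_mult) (simp add: pe_pCons endo_0 endo_lin endo_neg)
    show ?case
      unfolding Z.pe_pCons[OF mem] pCons.IH refl
      using assms split.ext_endo_J[OF _ v_adjoint, of "pe (reflect \<delta> h) z" "pe h x"]
      by (simp add: pe_pCons split.ext_scale_pair split.J_lin plus_fun_def)
  qed
qed

lemma extension_annihilated:
  assumes "z \<in> ext_space s V"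
  shows "poly_endo (ext_scale s) P (ext_endo V v) z = 0"
proof -
  obtain x x' where z: "z = (x, split.J x')" "x \<in> V" "x' \<in> V"
    using assms unfolding split.split_embedding_image[symmetric] by (auto simp: split.split_embedding_def)
  have P0: "pe P x = 0" if x: "x \<in> V" for x
  proof -
    obtain f where "x = pe f y" using x by (rule pe_cases)
    then show ?thesis using y ann[of P] pe_commute[of y P f] by simp
  qed
  show ?thesis using z by (simp add: extension_pe reflect_P P0 split.J_0 zero_prod_def zero_fun_def)
qed

lemma extension_not_annihilated:
  assumes "\<not> P dvd h"
  shows "\<exists>z\<in>ext_space s V. poly_endo (ext_scale s) h (ext_endo V v) z \<noteq> 0"
proof
  show "(y, split.J 0) \<in> ext_space s V"
    using y by (auto simp: ext_space_def split.J_image[symmetric])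
  show "poly_endo (ext_scale s) h (ext_endo V v) (y, split.J 0) \<noteq> 0"
    using assms y by (simp add: extension_pe ann zero_prod_def)
qed

end

section \<open>Indecomposability\<close>

lemma sum_lessThan_add:
  fixes f :: "nat \<Rightarrow> 'a::comm_monoid_add"
  shows "sum f {..<m + n} = sum f {..<m} + (\<Sum>i<n. f (m + i))"
  by (induction n) (simp_all add: add.assoc)

text \<open>A generator and its image under \<open>a\<close> provide \<open>2 * degree P\<close> independent vectors.\<close>

lemma generated_difference_no_complement:
  fixes s1 :: "'a::field \<Rightarrow> 'v::ab_group_add \<Rightarrow> 'v" and s2 :: "'a \<Rightarrow> 'w::ab_group_add \<Rightarrow> 'w"
    and S :: "'a \<Rightarrow> 'x::ab_group_add \<Rightarrow> 'x"
  assumes gen: "generated_difference s1 V1 u1 \<tau> \<mu> \<alpha> \<beta> b1 a1 y R P" and degP: "Polynomial.degree P > 0"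
    and Z: "fd_space S Z" "finite F" "Modules.module.span S F = Z" "card F \<le> 2 * Polynomial.degree P"
    and \<Phi>: "linear_on S (module_prod.scale s1 s2) Z \<Phi>" "V1 \<times> V2 \<subseteq> \<Phi> ` Z"
    and V2: "fd_space s2 V2" "x2 \<in> V2"
  shows "x2 = 0"
proof (rule ccontr)
  assume "x2 \<noteq> 0"
  interpret generated_difference s1 V1 u1 \<tau> \<mu> \<alpha> \<beta> b1 a1 y R P by (rule gen)
  interpret s2: vector_space s2 using V2 by (simp add: fd_space_def)
  interpret S: vector_space S using Z by (simp add: fd_space_def)
  interpret T: vector_space_prod s1 s2 ..
  have T: "vector_space T.scale" by unfold_locales
  let ?N = "Polynomial.degree P"
  \<comment> \<open>One vector more than F can support. In a dependence, the projection to V2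
    isolates the coefficient of x2, and the projection to V1 is then a relation between y and a1
    y.\<close>
  define w where "w i = (if i < ?N then ((u1 ^^ i) y, 0)
    else if i < ?N + ?N then ((u1 ^^ (i - ?N)) (a1 y), 0) else (0, x2))" for i
  have "0 \<in> V2" using s2.subspace_0[OF fd_space_subspace[OF V2(1)]] .
  then have "w i \<in> V1 \<times> V2" for i using y V2(2) by (auto simp: w_def)
  then have "\<exists>z\<in>Z. \<Phi> z = w i" for i using \<Phi>(2) by (metis imageE subsetD)
  then obtain z where z: "\<And>i. z i \<in> Z" "\<And>i. \<Phi> (z i) = w i" by metis
  let ?I = "{..<Suc (?N + ?N)}"
  have "z ` ?I \<subseteq> S.span F" using Z(3) z(1) by auto
  moreover have "card F < card ?I" using Z(4) by simp
  ultimately obtain c i where c: "(\<Sum>i\<in>?I. S (c i) (z i)) = 0" "i \<in> ?I" "c i \<noteq> 0"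
    using S.dependent_family[OF Z(2) finite_lessThan] by blast
  have mem: "S (c i) (z i) \<in> Z" for i using z(1) fd_space_subspace[OF Z(1)] by (rule S.subspace_scale[rotated])
  have "(\<Sum>i\<in>?I. T.scale (c i) (w i)) = (\<Sum>i\<in>?I. \<Phi> (S (c i) (z i)))"
    using \<Phi>(1) z by (intro sum.cong) (simp_all add: linear_on_def)
  also have "\<dots> = \<Phi> (\<Sum>i\<in>?I. S (c i) (z i))"
    by (rule linear_on_sum[OF Z(1) T \<Phi>(1), symmetric]) (rule mem)
  also have "\<dots> = 0" unfolding c(1) by (rule linear_on_zero[OF Z(1) T \<Phi>(1)])
  finally have sum: "(\<Sum>i<?N + ?N. T.scale (c i) (w i)) + T.scale (c (?N + ?N)) (w (?N + ?N)) = 0" by simp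
  have c0: "c (?N + ?N) = 0"
  proof -
    have "snd (\<Sum>i<?N + ?N. T.scale (c i) (w i)) = (\<Sum>i<?N + ?N. 0)"
      unfolding snd_sum by (intro sum.cong) (auto simp: w_def T.scale_prod)
    moreover have "w (?N + ?N) = (0, x2)" by (simp add: w_def)
    ultimately have "s2 (c (?N + ?N)) x2 = 0"
      using arg_cong[OF sum, of snd] by (simp add: T.scale_prod)
    then show ?thesis using \<open>x2 \<noteq> 0\<close> by simp
  qed
  let ?f = "poly_of ?N c" and ?g = "poly_of ?N (\<lambda>i. c (?N + i))"
  have "pe ?f y + pe ?g (a1 y) = fst (\<Sum>i<?N + ?N. T.scale (c i) (w i))"
    unfolding sum_lessThan_add fst_add fst_sum using y
    by (simp add: pe_poly_of) (auto simp: w_def T.scale_prod intro!: arg_cong2[of _ _ _ _ "(+)"] sum.cong)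
  also have "\<dots> = 0" using arg_cong[OF sum, of fst] c0 by simp
  finally have "P dvd ?f" "P dvd ?g" using independent_generators by blast+
  then have "?f = 0" "?g = 0"
    using degree_poly_of[OF degP] by (meson dvd_imp_degree_le not_le)+
  then have "c j = 0" "c (?N + j) = 0" if "j < ?N" for j
    using coeff_poly_of[OF that, of c] coeff_poly_of[OF that, of "\<lambda>i. c (?N + i)"] by simp_all
  then have "c i = 0" if "i < ?N + ?N" for i
    using that by (metis add_diff_inverse_nat nat_add_left_cancel_less)
  then show False using c c0 by (cases "i = ?N + ?N") auto
qed

context quadratics
begin

lemma symplectic_difference_generator:
  assumes sd: "symplectic_difference [:\<alpha>, -\<tau>, 1:] [:\<beta>, -\<mu>, 1:] s V b u"
    and r: "Factorial_Ring.irreducible r" and n: "n \<ge> 1"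
    and roots: "root_set (pcompose r (qmap \<delta>)) \<inter> root_diffs [:\<alpha>, -\<tau>, 1:] [:\<beta>, -\<mu>, 1:] = {}"
    and ann: "\<And>x. x \<in> V \<Longrightarrow> poly_endo s (pcompose (r ^ n) (qmap \<delta>)) u x = 0"
    and nonzero: "x0 \<in> V" "poly_endo s (pcompose (r ^ (n - 1)) (qmap \<delta>)) u x0 \<noteq> 0"
  obtains a y where "generated_difference s V u \<tau> \<mu> \<alpha> \<beta> b a y (r ^ n) (pcompose (r ^ n) (qmap \<delta>))"
proof -
  obtain a where D: "sp_difference s V u \<tau> \<mu> \<alpha> \<beta> b a"
    by (rule sp_difference_of_symplectic_difference[OF sd]) (rule that)
  interpret sp_difference s V u \<tau> \<mu> \<alpha> \<beta> b a by (rule D)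
  obtain k l where kl: "k * pcompose r (qmap \<delta>) + l * rdpoly = 1"
    by (rule bezout_rdpoly[OF roots])
  have r1: "\<not> r dvd 1" using r by (auto simp: Factorial_Ring.irreducible_def)
  have ann': "pe (pcompose (r ^ n * 1) (qmap \<delta>)) x = 0" if "x \<in> V" for x using ann[OF that] by simp
  have nonzero': "pe (pcompose (r ^ (n - 1) * 1) (qmap \<delta>)) x0 \<noteq> 0" using nonzero(2) by simp
  obtain y where y: "y \<in> V" "pe (pcompose (r ^ n) (qmap \<delta>)) y = 0"
    "\<And>f. (\<And>g. b y (pe (f * g) (a y)) = 0) \<Longrightarrow> pcompose (r ^ n) (qmap \<delta>) dvd f"
    by (rule exists_generator[OF r kl r1 n ann' nonzero(1) nonzero'])
      (assumption, rule that, assumption, assumption, blast)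
  show thesis by (rule that, rule generated_differenceI[OF y])
qed

text \<open>A generator is available only in a summand on which r^(n - 1)(w), w = u^2 - \<delta> u,
  does not vanish. The vector x0 shows that one of the two summands is of this kind, but not which
  one; hence the two symmetric cases.\<close>

lemma indecomposable_if_few_generators:
  fixes S :: "'a \<Rightarrow> 'x::ab_group_add \<Rightarrow> 'x"
  defines "p \<equiv> [:\<alpha>, -\<tau>, 1:]" and "q \<equiv> [:\<beta>, -\<mu>, 1:]"
  assumes sd: "symplectic_difference p q S Z b u"
    and r: "Factorial_Ring.irreducible r" "Polynomial.lead_coeff r = 1" and n: "n \<ge> 1"
    and roots: "root_set (pcompose r (qmap \<delta>)) \<inter> root_diffs p q = {}"
    and ann: "\<And>x. x \<in> Z \<Longrightarrow> poly_endo S (pcompose (r ^ n) (qmap \<delta>)) u x = 0"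
    and nonzero: "x0 \<in> Z" "poly_endo S (pcompose (r ^ (n - 1)) (qmap \<delta>)) u x0 \<noteq> 0"
    and F: "finite F" "Modules.module.span S F = Z"
      "card F \<le> 2 * Polynomial.degree (pcompose (r ^ n) (qmap \<delta>))"
  shows "indecomposable_difference p q S Z b u"
proof -
  let ?P = "pcompose (r ^ n) (qmap \<delta>)" and ?C = "pcompose (r ^ (n - 1)) (qmap \<delta>)"
  have degP: "Polynomial.degree ?P > 0"
    unfolding pcompose_qmap_monic(2)[OF r(2)] using n irreducible_degree_pos[OF r(1)] by simp
  have fdX: "fd_space S Z" and uX: "endo_on S Z u"
    using sd by (auto simp: symplectic_difference_def symplectic_pair_def alternating_endo_def)
  interpret S: vector_space S using fdX by (simp add: fd_space_def)
  interpret Z: endo_space S Z u using fd_space_subspace[OF fdX] uX by unfold_locales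
  have "Z \<noteq> {0}" using nonzero by auto
  moreover have False
    if sd1: "symplectic_difference p q s1 V1 b1 u1" "V1 \<noteq> {0}"
      and sd2: "symplectic_difference p q s2 V2 b2 u2" "V2 \<noteq> {0}"
      and iso: "isometric S Z b u (module_prod.scale s1 s2) (V1 \<times> V2) (sum_form b1 b2) (map_prod u1 u2)"
    for s1 s2 :: "'a \<Rightarrow> 'x \<Rightarrow> 'x" and V1 V2 b1 b2 u1 u2
  proof -
    obtain \<Phi> where \<Phi>: "linear_on S (module_prod.scale s1 s2) Z \<Phi>" "bij_betw \<Phi> Z (V1 \<times> V2)"
      and com: "\<And>x. x \<in> Z \<Longrightarrow> map_prod u1 u2 (\<Phi> x) = \<Phi> (u x)"
      using iso by (auto simp: isometric_def)
    have fd: "fd_space s1 V1" "fd_space s2 V2" and u12: "endo_on s1 V1 u1" "endo_on s2 V2 u2"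
      using sd1 sd2 by (auto simp: symplectic_difference_def symplectic_pair_def alternating_endo_def)
    interpret s1: vector_space s1 using fd by (simp add: fd_space_def)
    interpret s2: vector_space s2 using fd by (simp add: fd_space_def)
    interpret V1: endo_space s1 V1 u1 using fd_space_subspace[OF fd(1)] u12(1) by unfold_locales
    interpret V2: endo_space s2 V2 u2 using fd_space_subspace[OF fd(2)] u12(2) by unfold_locales
    interpret T: vector_space_prod s1 s2 ..
    interpret T': vector_space_prod s2 s1 ..
    have T: "vector_space T.scale" by unfold_locales
    have im: "\<Phi> ` Z = V1 \<times> V2" and inj: "inj_on \<Phi> Z" using \<Phi>(2) by (auto simp: bij_betw_def)
    have \<Phi>_lin: "x \<in> Z \<Longrightarrow> y \<in> Z \<Longrightarrow> \<Phi> (x + y) = \<Phi> x + \<Phi> y"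
      "x \<in> Z \<Longrightarrow> fst (\<Phi> (S c x)) = s1 c (fst (\<Phi> x))"
      "x \<in> Z \<Longrightarrow> snd (\<Phi> (S c x)) = s2 c (snd (\<Phi> x))" for x y c
      using \<Phi>(1) by (auto simp: linear_on_def T.scale_def case_prod_beta)
    have lin1: "linear_on S s1 Z (\<lambda>x. fst (\<Phi> x))" and lin2: "linear_on S s2 Z (\<lambda>x. snd (\<Phi> x))"
      by (auto simp: linear_on_def \<Phi>_lin)
    have mem1: "(\<lambda>x. fst (\<Phi> x)) ` Z \<subseteq> V1" and mem2: "(\<lambda>x. snd (\<Phi> x)) ` Z \<subseteq> V2"
      using imageI[of _ Z \<Phi>] unfolding im by (auto simp: mem_Times_iff)
    have com12: "fst (\<Phi> (u x)) = u1 (fst (\<Phi> x))" "snd (\<Phi> (u x)) = u2 (snd (\<Phi> x))" if "x \<in> Z" for x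
      using com[OF that, symmetric] by (simp_all add: map_prod_def case_prod_beta)
    have pe1: "fst (\<Phi> (Z.pe h x)) = V1.pe h (fst (\<Phi> x))" if "x \<in> Z" for x h
      by (rule pe_intertwine[OF Z.endo_space_axioms V1.endo_space_axioms lin1 mem1 com12(1) that])
    have pe2: "snd (\<Phi> (Z.pe h x)) = V2.pe h (snd (\<Phi> x))" if "x \<in> Z" for x h
      by (rule pe_intertwine[OF Z.endo_space_axioms V2.endo_space_axioms lin2 mem2 com12(2) that])
    have \<Phi>0: "\<Phi> 0 = 0" by (rule linear_on_zero[OF fdX T \<Phi>(1)])
    have ann1: "V1.pe ?P x = 0" if x: "x \<in> V1" for x
    proof -
      have "(x, 0) \<in> \<Phi> ` Z" unfolding im using x by simp
      then obtain z where z: "z \<in> Z" "\<Phi> z = (x, 0)" by force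
      show ?thesis using pe1[OF z(1), of ?P] ann[OF z(1)] z(2) \<Phi>0 by simp
    qed
    have ann2: "V2.pe ?P x = 0" if x: "x \<in> V2" for x
    proof -
      have "(0, x) \<in> \<Phi> ` Z" unfolding im using x by simp
      then obtain z where z: "z \<in> Z" "\<Phi> z = (0, x)" by force
      show ?thesis using pe2[OF z(1), of ?P] ann[OF z(1)] z(2) \<Phi>0 by simp
    qed
    have "\<Phi> (Z.pe ?C x0) \<noteq> \<Phi> 0"
      using nonzero inj by (metis Z.pe_mem Z.mem(1) inj_onD)
    then consider "V1.pe ?C (fst (\<Phi> x0)) \<noteq> 0" | "V2.pe ?C (snd (\<Phi> x0)) \<noteq> 0"
      unfolding \<Phi>0 using pe1[OF nonzero(1)] pe2[OF nonzero(1)] by (metis prod.collapse zero_prod_def)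
    then show False
    proof cases
      case 1
      have x1: "fst (\<Phi> x0) \<in> V1" using mem1 nonzero(1) by blast
      obtain a y where gen: "generated_difference s1 V1 u1 \<tau> \<mu> \<alpha> \<beta> b1 a y (r ^ n) ?P"
        by (rule symplectic_difference_generator[OF sd1(1)[unfolded p_def q_def] r(1) n
          roots[unfolded p_def q_def] ann1 x1 1])
      have "x = 0" if "x \<in> V2" for x
        by (rule generated_difference_no_complement[OF gen degP fdX F \<Phi>(1) _ fd(2) that]) (simp add: im)
      then show False using sd2(2) V2.mem(1) by auto
    next
      case 2
      have x2: "snd (\<Phi> x0) \<in> V2" using mem2 nonzero(1) by blast
      obtain a y where gen: "generated_difference s2 V2 u2 \<tau> \<mu> \<alpha> \<beta> b2 a y (r ^ n) ?P"
        by (rule symplectic_difference_generator[OF sd2(1)[unfolded p_def q_def] r(1) n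
          roots[unfolded p_def q_def] ann2 x2 2])
      have lin: "linear_on S T'.scale Z (\<lambda>x. prod.swap (\<Phi> x))"
        by (auto simp: linear_on_def \<Phi>_lin T'.scale_def prod_eq_iff)
      have sub: "V2 \<times> V1 \<subseteq> (\<lambda>x. prod.swap (\<Phi> x)) ` Z"
        unfolding image_image[of prod.swap \<Phi> Z, symmetric] im by (simp add: product_swap)
      have "x = 0" if "x \<in> V1" for x
        by (rule generated_difference_no_complement[OF gen degP fdX F lin sub fd(1) that])
      then show False using sd1(2) V1.mem(1) by auto
    qed
  qed
  ultimately show ?thesis unfolding indecomposable_difference_def using sd by blast
qed

lemma companion_extension_indecomposable:
  fixes s :: "'a \<Rightarrow> 'v::ab_group_add \<Rightarrow> 'v"
  defines "p \<equiv> [:\<alpha>, -\<tau>, 1:]" and "q \<equiv> [:\<beta>, -\<mu>, 1:]"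
  assumes n: "n \<ge> 1" and r: "Polynomial.lead_coeff r = 1" "Factorial_Ring.irreducible r"
    and roots: "root_set (pcompose r (qmap \<delta>)) \<inter> root_diffs p q = {}"
    and fd: "fd_space s V" and v: "endo_on s V v"
    and matrix: "represented_by s V v (companion (pcompose (r ^ n) (qmap \<delta>)))"
  shows "indecomposable_difference p q (ext_scale s) (ext_space s V) ext_form (ext_endo V v)"
    and "pq_regular p q (ext_scale s) (ext_space s V) (ext_endo V v)"
proof -
  let ?P = "pcompose (r ^ n) (qmap \<delta>)" and ?C = "pcompose (r ^ (n - 1)) (qmap \<delta>)"
  have rdeg: "Polynomial.degree r > 0" using irreducible_degree_pos[OF r(2)] .
  note monic = pcompose_qmap_monic[OF r(1), where \<delta> = \<delta>]
  have degP: "Polynomial.degree ?P > 0" unfolding monic(2) using n rdeg by simp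
  interpret s: vector_space s using fd by (simp add: fd_space_def)
  interpret v: endo_space s V v using fd_space_subspace[OF fd] v by unfold_locales
  obtain y where y: "y \<in> V" "v.cyc y = V" "\<And>f. v.pe f y = 0 \<longleftrightarrow> ?P dvd f"
    using v.represented_by_companion_imp_cyc[OF monic(1) degP matrix] by blast
  have "r \<noteq> 0" using r by auto
  then have "Polynomial.degree (r ^ n) > 0" using n rdeg by (simp add: degree_power_eq)
  then interpret cyclic_endo s V v \<tau> \<mu> \<alpha> \<beta> y "r ^ n" ?P
    using fd y by unfold_locales auto
  obtain bs where bs: "s.span (set bs) = V" "companion ?P \<in> carrier_mat (length bs) (length bs)"
    using matrix by (auto simp: represented_by_def)
  have "length bs = Polynomial.degree ?P" using carrier_matD(1)[OF bs(2)] by (simp only: companion_def Let_def dim_row_mat)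
  then have card: "card (set bs) \<le> Polynomial.degree ?P" using card_length[of bs] by simp
  obtain F where F: "finite F" "card F \<le> 2 * card (set bs)" "Modules.module.span (ext_scale s) F = ext_space s V"
    using split.ext_space_span[OF finite_set bs(1)] by blast
  have "\<not> ?P dvd ?C"
  proof
    assume "?P dvd ?C"
    moreover have "?C \<noteq> 0" using monic(1)[of "n - 1"] by auto
    ultimately have "Polynomial.degree ?P \<le> Polynomial.degree ?C" by (rule dvd_imp_degree_le)
    then show False unfolding monic(2) using n rdeg by simp
  qed
  then obtain z where z: "z \<in> ext_space s V" "poly_endo (ext_scale s) ?C (ext_endo V v) z \<noteq> 0"
    using extension_not_annihilated by blast
  show "indecomposable_difference p q (ext_scale s) (ext_space s V) ext_form (ext_endo V v)"
    unfolding p_def q_def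
    using F card
    by (intro indecomposable_if_few_generators[OF extension_difference r(2,1) n roots[unfolded p_def q_def]
        extension_annihilated z]) auto
  have fdX: "fd_space (ext_scale s) (ext_space s V)" and U: "endo_on (ext_scale s) (ext_space s V) (ext_endo V v)"
    using extension_difference by (auto simp: symplectic_difference_def symplectic_pair_def alternating_endo_def)
  interpret Z: vector_space "ext_scale s" by (rule split.ext_vector_space)
  interpret Z: endo_space "ext_scale s" "ext_space s V" "ext_endo V v"
    using fd_space_subspace[OF fdX] U by unfold_locales
  have "k \<notin> root_diffs p q"
    if "k \<in> closure_eigenvalues (ext_scale s) (ext_space s V) (ext_endo V v)" for k
  proof -
    have "evac ?P k = 0" using Z.closure_eigenvalue_root[OF that extension_annihilated] .
    then have "evac r (evac (qmap \<delta>) k) ^ n = 0" by (simp only: evac_pcompose evac_power)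
    then have "evac (pcompose r (qmap \<delta>)) k = 0" by (simp add: evac_pcompose)
    then show ?thesis using roots by (auto simp: root_set_def)
  qed
  then show "pq_regular p q (ext_scale s) (ext_space s V) (ext_endo V v)"
    unfolding pq_regular_def by blast
qed

end

theorem mainTheorem10:
  fixes p q :: "'a::field poly" and \<delta> :: 'a
  assumes "Polynomial.lead_coeff p = 1" and "Polynomial.degree p = 2"
    and "Polynomial.lead_coeff q = 1" and "Polynomial.degree q = 2"
    and "\<delta> = poly_trace p - poly_trace q"
  shows
    "(\<forall>n r (s :: 'a \<Rightarrow> 'v::ab_group_add \<Rightarrow> 'v) V v.
        n \<ge> 1 \<and> Polynomial.lead_coeff r = 1 \<and> Factorial_Ring.irreducible r \<and>
        root_set (pcompose r [:0, -\<delta>, 1:]) \<inter> root_diffs p q = {} \<and>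
        fd_space s V \<and> endo_on s V v \<and>
        represented_by s V v (companion (pcompose (r ^ n) [:0, -\<delta>, 1:]))
        \<longrightarrow> indecomposable_difference p q (ext_scale s) (ext_space s V) ext_form (ext_endo V v) \<and>
            pq_regular p q (ext_scale s) (ext_space s V) (ext_endo V v))
     \<and>
     (\<forall>(s :: 'a \<Rightarrow> 'w::ab_group_add \<Rightarrow> 'w) V b u.
        indecomposable_difference p q s V b u \<and> pq_regular p q s V u
        \<longrightarrow> (\<exists>n r (t :: 'a \<Rightarrow> 'w \<Rightarrow> 'w) W v.
              n \<ge> 1 \<and> Polynomial.lead_coeff r = 1 \<and> Factorial_Ring.irreducible r \<and>
              root_set (pcompose r [:0, -\<delta>, 1:]) \<inter> root_diffs p q = {} \<and>
              fd_space t W \<and> endo_on t W v \<and>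
              represented_by t W v (companion (pcompose (r ^ n) [:0, -\<delta>, 1:])) \<and>
              isometric s V b u (ext_scale t) (ext_space t W) ext_form (ext_endo W v)))"
proof -
  interpret Q: quadratics "poly_trace p" "poly_trace q" "poly.coeff p 0" "poly.coeff q 0" .
  have p: "p = [:poly.coeff p 0, - poly_trace p, 1:]" using assms(1,2) by (rule monic_quadratic_eq)
  have q: "q = [:poly.coeff q 0, - poly_trace q, 1:]" using assms(3,4) by (rule monic_quadratic_eq)
  have W: "[:0, -\<delta>, 1:] = qmap Q.\<delta>" by (simp add: qmap_def Q.\<delta>_def assms(5))
  show ?thesis
    unfolding W
  proof (intro conjI allI impI; elim conjE)
    fix n r and s :: "'a \<Rightarrow> 'v \<Rightarrow> 'v" and V v
    assume *: "n \<ge> 1" "Polynomial.lead_coeff r = 1" "Factorial_Ring.irreducible r"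
      "root_set (pcompose r (qmap Q.\<delta>)) \<inter> root_diffs p q = {}"
      "fd_space s V" "endo_on s V v" "represented_by s V v (companion (pcompose (r ^ n) (qmap Q.\<delta>)))"
    note Q.companion_extension_indecomposable[folded p q, OF *]
    then show "indecomposable_difference p q (ext_scale s) (ext_space s V) ext_form (ext_endo V v)"
      "pq_regular p q (ext_scale s) (ext_space s V) (ext_endo V v)" .
  next
    fix s :: "'a \<Rightarrow> 'w \<Rightarrow> 'w" and V b u
    assume "indecomposable_difference p q s V b u" "pq_regular p q s V u"
    note Q.regular_indecomposable_is_extension[folded p q, OF this]
    then obtain n r W where *: "n \<ge> 1" "Polynomial.lead_coeff r = 1" "Factorial_Ring.irreducible r"
      "root_set (pcompose r (qmap Q.\<delta>)) \<inter> root_diffs p q = {}"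
      "fd_space s W" "endo_on s W u" "represented_by s W u (companion (pcompose (r ^ n) (qmap Q.\<delta>)))"
      "isometric s V b u (ext_scale s) (ext_space s W) ext_form (ext_endo W u)" .
    \<comment> \<open>The extended endomorphism is u itself on a cyclic subspace W, so the scalar
      multiplication is kept.\<close>
    show "\<exists>n r (t :: 'a \<Rightarrow> 'w \<Rightarrow> 'w) W v.
        n \<ge> 1 \<and> Polynomial.lead_coeff r = 1 \<and> Factorial_Ring.irreducible r \<and>
        root_set (pcompose r (qmap Q.\<delta>)) \<inter> root_diffs p q = {} \<and>
        fd_space t W \<and> endo_on t W v \<and>
        represented_by t W v (companion (pcompose (r ^ n) (qmap Q.\<delta>))) \<and>
        isometric s V b u (ext_scale t) (ext_space t W) ext_form (ext_endo W v)"
      by (intro exI conjI) (fact *)+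
  qed
qed

end
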